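(* Let $\Omega\subset\mathbb{R}^3$ be a bounded domain, let $p\ge1$ be a real number, and let $k\ge1$. Let $\mathcal{T}$ be a conforming hexahedral grid of $\Omega$ such that at each vertex $V$ all adjacent faces are orthogonal to one of three linearly independent unit vectors $\mathbf{n}_{V,1},\mathbf{n}_{V,2},\mathbf{n}_{V,3}$ associated to $V$. Then $$H_{h,k}^{\mathrm{sym\,Curl}}\subset H(\operatorname{sym}\operatorname{Curl})\subset H(\operatorname{dev}\operatorname{sym}\operatorname{Curl}).$$ On the other hand, for any $k\ge1$ and any connected such grid $\mathcal{T}$ with more than one element, there is a function $U_h\in H_{h,k}^{\mathrm{sym\,Curl}}$ such that $U_h\notin H(\operatorname{Curl})$.
   Context: For $A\in\mathbb{R}^{3\times3}$: $\operatorname{sym}A:=\frac12(A+A^T)$, $\operatorname{dev}A:=A-\frac13(\operatorname{trace}A)I$. $\operatorname{Curl}$ is the classical $\operatorname{curl}$ applied row-wise (distributionally). $H(\operatorname{Curl})$, $H(\operatorname{sym}\operatorname{Curl})$ and $H(\operatorname{dev}\operatorname{sym}\operatorname{Curl})$ are the spaces of all $P\in L^p(\Omega;\mathbb{R}^{3\times3})$ for which, respectively, $\operatorname{Curl}P$, $\operatorname{sym}\operatorname{Curl}P$ and $\operatorname{dev}\operatorname{sym}\operatorname{Curl}P$ lies in $L^p(\Omega;\mathbb{R}^{3\times3})$. A domain is a nonempty connected open set. A conforming hexahedral grid $\mathcal{T}$ of $\Omega$ is a finite set of non-degenerate closed hexahedra with planar faces, each the image of the unit cube $[0,1]^3$ under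 an invertible trilinear map (whose parameters are the local coordinates), such that $\Omega$ is the interior of their union and any two distinct hexahedra intersect in the empty set, a common vertex, a common edge or a common face. For each element $H$ adjacent to a vertex $V$, the three faces of $H$ at $V$ are orthogonal to $\mathbf{n}_{V,1},\mathbf{n}_{V,2},\mathbf{n}_{V,3}$, respectively. $\Pi_k^\times(H;\mathbb{R}^{3\times3})$ is the space of $\mathbb{R}^{3\times3}$-valued functions on $H$ that are polynomials of degree $k$ or less in each of the three local coordinates. Lagrange points of $H$ are the images of the points of $[0,1]^3$ with coordinates in $\{0,\frac1k,\dots,1\}$; inner Lagrange points of an edge or face are those in its relative interior. Once and for all for the entire grid the following are fixed: for each vertex $V$ the vectors $\mathbf{n}_{V,1},\mathbf{n}_{V,2},\mathbf{n}_{V,3}$ including their numbering and orientation; for each face a unit normal $\mathbf{n}$ and two vectors $\mathbf{a}_1,\mathbf{a}_2$ such that $\mathbf{a}_1,\mathbf{a}_2,\mathbf{n}$ are linearly independent; for each edge $E$ a unit tangent $\mathbf{t}_E$ and two unit vectors $\mathbf{n}_{E,1},\mathbf{n}_{E,2}$ spanning the plane orthogonal to $E$. For a face with normal $\mathbf{n}$ containing the edge $E$, set $\boldsymbol{\partial}:=\mathbf{t}_E\times\mathbf{n}$. $H_{h,k}^{\mathrm{sym\,Curl}}$ is the set of all $U_h\in L^2(\Omega;\mathbb{R}^{3\times3})$ with $U_h|_H\in\Pi_k^\times(H;\mathbb{R}^{3\times3})$ for all $H\in\mathcal{T}$ such that, writing $U$ for $U_h|_H$ evaluated at points of the closed hexahedron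 $H$, the following quantities coincide for the elements concerned: - for every vertex $V$, the quantities $\mathbf{n}_{V,2}^TU(V)(\mathbf{n}_{V,1}\times\mathbf{n}_{V,3})+\mathbf{n}_{V,3}^TU(V)(\mathbf{n}_{V,1}\times\mathbf{n}_{V,2})$ and $\mathbf{n}_{V,3}^TU(V)(\mathbf{n}_{V,2}\times\mathbf{n}_{V,1})+\mathbf{n}_{V,1}^TU(V)(\mathbf{n}_{V,2}\times\mathbf{n}_{V,3})$ coincide for all elements that share $V$; - for every vertex $V$ and every edge $E$ with endpoint $V$, the quantities $\mathbf{n}_{E,1}^TU(V)\mathbf{t}_E$ and $\mathbf{n}_{E,2}^TU(V)\mathbf{t}_E$ coincide for all elements having that edge; - for every edge $E$ and every inner Lagrange point $L$ of $E$, the quantities $\mathbf{n}_{E,1}^TU(L)\mathbf{t}_E$ and $\mathbf{n}_{E,2}^TU(L)\mathbf{t}_E$ coincide for all elements that share $E$; and for every face with normal $\mathbf{n}$ containing $E$, the quantities $\mathbf{t}_E^TU(L)(\mathbf{n}\times\mathbf{t}_E)$, $\mathbf{n}^TU(L)(\mathbf{n}\times\mathbf{t}_E)$ and $\mathbf{t}_E^TU(L)(\mathbf{n}\times\boldsymbol{\partial})+\boldsymbol{\partial}^TU(L)(\mathbf{n}\times\mathbf{t}_E)$ coincide for the elements having that face; - for every face $F$ with associated vectors $\mathbf{n},\mathbf{a}_1,\mathbf{a}_2$ and every inner Lagrange point $L$ of $F$, the quantities $\mathbf{a}_1^TU(L)(\mathbf{n}\times\mathbf{a}_1)$, $\mathbf{a}_2^TU(L)(\mathbf{n}\times\mathbf{a}_2)$,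 $\mathbf{a}_1^TU(L)(\mathbf{n}\times\mathbf{a}_2)+\mathbf{a}_2^TU(L)(\mathbf{n}\times\mathbf{a}_1)$, $\mathbf{n}^TU(L)(\mathbf{n}\times\mathbf{a}_1)$ and $\mathbf{n}^TU(L)(\mathbf{n}\times\mathbf{a}_2)$ coincide for the elements that share $F$. (All other local degrees of freedom are unconstrained across elements.) *)

theory Defs
  imports "HOL-Analysis.Analysis"
begin

unbundle cross3_syntax

section \<open>Matrices\<close>

definition mat_sym :: "real^3^3 \<Rightarrow> real^3^3" where
  "mat_sym A = (1/2) *\<^sub>R (A + transpose A)"

definition mat_dev :: "real^3^3 \<Rightarrow> real^3^3" where
  "mat_dev A = A - (trace A / 3) *\<^sub>R mat 1"

text \<open>The bilinear expression $u^T M v$.\<close>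
definition bil :: "real^3 \<Rightarrow> real^3^3 \<Rightarrow> real^3 \<Rightarrow> real" where
  "bil u M v = u \<bullet> (M *v v)"


section \<open>Lebesgue spaces and the distributional Curl\<close>

text \<open>Elements of function spaces are represented by functions on the whole space of which only the
  values on \<open>\<Omega>\<close> matter, up to null sets; all conditions below are invariant under such changes.\<close>

definition Lp_space :: "real \<Rightarrow> (real^3) set \<Rightarrow> (real^3 \<Rightarrow> real^3^3) set" where
  "Lp_space p \<Omega> = {f. f \<in> borel_measurable (lebesgue_on \<Omega>) \<and>
                     integrable (lebesgue_on \<Omega>) (\<lambda>x. norm (f x) powr p)}"

definition partial_deriv :: "3 \<Rightarrow> (real^3 \<Rightarrow> real) \<Rightarrow> real^3 \<Rightarrow> real" where
  "partial_deriv i f x = frechet_derivative f (at x) (axis i 1)"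

definition grad :: "(real^3 \<Rightarrow> real) \<Rightarrow> real^3 \<Rightarrow> real^3" where
  "grad f x = (\<chi> i. partial_deriv i f x)"

primrec C_order :: "nat \<Rightarrow> (real^3 \<Rightarrow> real) \<Rightarrow> bool" where
  "C_order 0 f \<longleftrightarrow> continuous_on UNIV f"
| "C_order (Suc m) f \<longleftrightarrow> (\<forall>x. f differentiable (at x)) \<and> (\<forall>i. C_order m (partial_deriv i f))"

definition test_functions :: "(real^3) set \<Rightarrow> (real^3 \<Rightarrow> real) set" where
  "test_functions \<Omega> = {\<phi>. (\<forall>m. C_order m \<phi>) \<and>
     compact (closure {x. \<phi> x \<noteq> 0}) \<and> closure {x. \<phi> x \<noteq> 0} \<subseteq> \<Omega>}"

text \<open>The matrix-valued distribution \<open>Curl P\<close>. For a smooth vector field $v$ and a test function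
  $\varphi$, integration by parts gives
  $\int (\mathrm{curl}\, v)\, \varphi = \int v \times \nabla\varphi$; this is applied to each row of \<open>P\<close>.\<close>
definition Curl_distr :: "(real^3) set \<Rightarrow> (real^3 \<Rightarrow> real^3^3) \<Rightarrow> (real^3 \<Rightarrow> real) \<Rightarrow> real^3^3" where
  "Curl_distr \<Omega> P \<phi> = (\<integral>x. (\<chi> i. (P x $ i) \<times> grad \<phi> x) \<partial>lebesgue_on \<Omega>)"

text \<open>All \<open>P\<close> in $L^p$ for which \<open>\<A> (Curl P)\<close> is (represented by) an $L^p$ function, where
  \<open>\<A>\<close> is a linear map on matrices.\<close>
definition H_space :: "(real^3^3 \<Rightarrow> real^3^3) \<Rightarrow> real \<Rightarrow> (real^3) set \<Rightarrow> (real^3 \<Rightarrow> real^3^3) set" where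
  "H_space \<A> p \<Omega> = {P \<in> Lp_space p \<Omega>. \<exists>G \<in> Lp_space p \<Omega>. \<forall>\<phi> \<in> test_functions \<Omega>.
     \<A> (Curl_distr \<Omega> P \<phi>) = (\<integral>x. \<phi> x *\<^sub>R G x \<partial>lebesgue_on \<Omega>)}"

definition H_Curl :: "real \<Rightarrow> (real^3) set \<Rightarrow> (real^3 \<Rightarrow> real^3^3) set" where
  "H_Curl = H_space (\<lambda>A. A)"

definition H_sym_Curl :: "real \<Rightarrow> (real^3) set \<Rightarrow> (real^3 \<Rightarrow> real^3^3) set" where
  "H_sym_Curl = H_space mat_sym"

definition H_dev_sym_Curl :: "real \<Rightarrow> (real^3) set \<Rightarrow> (real^3 \<Rightarrow> real^3^3) set" where
  "H_dev_sym_Curl = H_space (\<lambda>A. mat_dev (mat_sym A))"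


section \<open>Hexahedra and conforming grids\<close>

text \<open>Polynomials of degree at most \<open>k\<close> in each of the three variables.\<close>
definition poly_Q :: "nat \<Rightarrow> (real^3 \<Rightarrow> 'a::real_vector) \<Rightarrow> bool" where
  "poly_Q k q \<longleftrightarrow> (\<exists>C. \<forall>\<xi>. q \<xi> =
     (\<Sum>a\<le>k. \<Sum>b\<le>k. \<Sum>c\<le>k. ((\<xi>$1)^a * (\<xi>$2)^b * (\<xi>$3)^c) *\<^sub>R C a b c))"

abbreviation unit_cube :: "(real^3) set" where
  "unit_cube \<equiv> {\<xi>. \<forall>i. 0 \<le> \<xi>$i \<and> \<xi>$i \<le> 1}"

text \<open>In the following, \<open>F\<close> is the map from the unit cube (the local coordinates) onto a hexahedron.\<close>

definition hex_vertices :: "(real^3 \<Rightarrow> real^3) \<Rightarrow> (real^3) set" where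
  "hex_vertices F = F ` {\<xi>. \<forall>i. \<xi>$i \<in> {0, 1}}"

definition hex_edges :: "(real^3 \<Rightarrow> real^3) \<Rightarrow> (real^3) set set" where
  "hex_edges F = {F ` {\<xi> \<in> unit_cube. \<forall>j. j \<noteq> i \<longrightarrow> \<xi>$j = v$j} | i v. \<forall>j. v$j \<in> {0, 1}}"

definition hex_faces :: "(real^3 \<Rightarrow> real^3) \<Rightarrow> (real^3) set set" where
  "hex_faces F = {F ` {\<xi> \<in> unit_cube. \<xi>$i = c} | i c. c \<in> {0, 1}}"

definition lagrange_points :: "nat \<Rightarrow> (real^3 \<Rightarrow> real^3) \<Rightarrow> (real^3) set" where
  "lagrange_points k F = F ` {\<xi>. \<forall>i. \<exists>j\<le>k. \<xi>$i = real j / real k}"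

text \<open>Trilinear means degree at most one in each variable; non-degeneracy includes a nonvanishing
  Jacobian determinant on the closed cube.\<close>
definition hexahedron :: "(real^3) set \<Rightarrow> (real^3 \<Rightarrow> real^3) \<Rightarrow> bool" where
  "hexahedron H F \<longleftrightarrow> poly_Q 1 F \<and> inj_on F unit_cube \<and>
     (\<forall>\<xi>\<in>unit_cube. det (jacobian F (at \<xi>)) \<noteq> 0) \<and>
     H = F ` unit_cube \<and> (\<forall>S\<in>hex_faces F. coplanar S)"

text \<open>The grid is the set \<open>T\<close> of its elements, with a trilinear parametrization \<open>\<Phi> H\<close> of each element.\<close>
definition conforming_grid ::
    "(real^3) set \<Rightarrow> (real^3) set set \<Rightarrow> ((real^3) set \<Rightarrow> real^3 \<Rightarrow> real^3) \<Rightarrow> bool" where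
  "conforming_grid \<Omega> T \<Phi> \<longleftrightarrow> finite T \<and> (\<forall>H\<in>T. hexahedron H (\<Phi> H)) \<and>
     \<Omega> = interior (\<Union>T) \<and>
     (\<forall>H\<in>T. \<forall>H'\<in>T. H \<noteq> H' \<longrightarrow>
        H \<inter> H' = {} \<or>
        (\<exists>V \<in> hex_vertices (\<Phi> H) \<inter> hex_vertices (\<Phi> H'). H \<inter> H' = {V}) \<or>
        H \<inter> H' \<in> hex_edges (\<Phi> H) \<inter> hex_edges (\<Phi> H') \<or>
        H \<inter> H' \<in> hex_faces (\<Phi> H) \<inter> hex_faces (\<Phi> H'))"

definition grid_vertices where
  "grid_vertices T \<Phi> = (\<Union>H\<in>T. hex_vertices (\<Phi> H))"

definition grid_edges where
  "grid_edges T \<Phi> = (\<Union>H\<in>T. hex_edges (\<Phi> H))"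

definition grid_faces where
  "grid_faces T \<Phi> = (\<Union>H\<in>T. hex_faces (\<Phi> H))"

definition orthogonal_to_set :: "real^3 \<Rightarrow> (real^3) set \<Rightarrow> bool" where
  "orthogonal_to_set n S \<longleftrightarrow> (\<forall>x\<in>S. \<forall>y\<in>S. n \<bullet> (x - y) = 0)"


section \<open>The vectors fixed for the entire grid\<close>

record grid_vectors =
  vertex_normal :: "real^3 \<Rightarrow> 3 \<Rightarrow> real^3"
  face_normal :: "(real^3) set \<Rightarrow> real^3"
  face_a1 :: "(real^3) set \<Rightarrow> real^3"
  face_a2 :: "(real^3) set \<Rightarrow> real^3"
  edge_tangent :: "(real^3) set \<Rightarrow> real^3"
  edge_n1 :: "(real^3) set \<Rightarrow> real^3"
  edge_n2 :: "(real^3) set \<Rightarrow> real^3"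

text \<open>At each vertex \<open>V\<close>, every adjacent face is orthogonal to one of three linearly independent unit
  vectors. Injectivity excludes coinciding vectors, which linear independence of the range alone
  would not.\<close>
definition vertex_vectors where
  "vertex_vectors T \<Phi> D \<longleftrightarrow> (\<forall>V\<in>grid_vertices T \<Phi>.
     (\<forall>i. norm (vertex_normal D V i) = 1) \<and>
     inj (vertex_normal D V) \<and> independent (range (vertex_normal D V)) \<and>
     (\<forall>H\<in>T. V \<in> hex_vertices (\<Phi> H) \<longrightarrow>
        (\<forall>S\<in>hex_faces (\<Phi> H). V \<in> S \<longrightarrow> (\<exists>i. orthogonal_to_set (vertex_normal D V i) S))))"

definition face_vectors where
  "face_vectors T \<Phi> D \<longleftrightarrow> (\<forall>S\<in>grid_faces T \<Phi>.
     norm (face_normal D S) = 1 \<and> orthogonal_to_set (face_normal D S) S \<and>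
     distinct [face_a1 D S, face_a2 D S, face_normal D S] \<and>
     independent {face_a1 D S, face_a2 D S, face_normal D S})"

definition edge_vectors where
  "edge_vectors T \<Phi> D \<longleftrightarrow> (\<forall>E\<in>grid_edges T \<Phi>.
     norm (edge_tangent D E) = 1 \<and> (\<forall>x\<in>E. \<forall>y\<in>E. x - y \<in> span {edge_tangent D E}) \<and>
     norm (edge_n1 D E) = 1 \<and> norm (edge_n2 D E) = 1 \<and>
     span {edge_n1 D E, edge_n2 D E} = {x. orthogonal x (edge_tangent D E)})"


section \<open>The finite element space\<close>

text \<open>Functions on \<open>H\<close> that are polynomials of degree at most \<open>k\<close> in each local coordinate.\<close>
definition Pi_k :: "nat \<Rightarrow> (real^3 \<Rightarrow> real^3) \<Rightarrow> (real^3 \<Rightarrow> real^3^3) set" where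
  "Pi_k k F = {W. \<exists>q. poly_Q k q \<and> (\<forall>\<xi>\<in>unit_cube. W (F \<xi>) = q \<xi>)}"

text \<open>The quantity \<open>q\<close> takes the same value for all elements in \<open>S\<close>.\<close>
definition coincide :: "'h set \<Rightarrow> ('h \<Rightarrow> real) \<Rightarrow> bool" where
  "coincide S q \<longleftrightarrow> (\<forall>H\<in>S. \<forall>H'\<in>S. q H = q H')"

definition at_vertex where
  "at_vertex T \<Phi> V = {H\<in>T. V \<in> hex_vertices (\<Phi> H)}"

definition at_edge where
  "at_edge T \<Phi> E = {H\<in>T. E \<in> hex_edges (\<Phi> H)}"

definition at_face where
  "at_face T \<Phi> S = {H\<in>T. S \<in> hex_faces (\<Phi> H)}"

text \<open>Lagrange points, of the elements in \<open>Hs\<close>, in the relative interior of the edge or face \<open>X\<close>.\<close>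
definition inner_lagrange where
  "inner_lagrange k \<Phi> Hs X = rel_interior X \<inter> (\<Union>H\<in>Hs. lagrange_points k (\<Phi> H))"

text \<open>Below, \<open>W H\<close> is the function on the closed element \<open>H\<close>.\<close>

definition vertex_dofs_coincide where
  "vertex_dofs_coincide T \<Phi> D W \<longleftrightarrow> (\<forall>V\<in>grid_vertices T \<Phi>.
     let n1 = vertex_normal D V 1; n2 = vertex_normal D V 2; n3 = vertex_normal D V 3 in
       coincide (at_vertex T \<Phi> V)
         (\<lambda>H. bil n2 (W H V) (n1 \<times> n3) + bil n3 (W H V) (n1 \<times> n2)) \<and>
       coincide (at_vertex T \<Phi> V)
         (\<lambda>H. bil n3 (W H V) (n2 \<times> n1) + bil n1 (W H V) (n2 \<times> n3)))"

definition vertex_edge_dofs_coincide where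
  "vertex_edge_dofs_coincide T \<Phi> D W \<longleftrightarrow> (\<forall>V\<in>grid_vertices T \<Phi>. \<forall>E\<in>grid_edges T \<Phi>. V \<in> E \<longrightarrow>
     coincide (at_edge T \<Phi> E) (\<lambda>H. bil (edge_n1 D E) (W H V) (edge_tangent D E)) \<and>
     coincide (at_edge T \<Phi> E) (\<lambda>H. bil (edge_n2 D E) (W H V) (edge_tangent D E)))"

definition edge_dofs_coincide where
  "edge_dofs_coincide k T \<Phi> D W \<longleftrightarrow>
     (\<forall>E\<in>grid_edges T \<Phi>. \<forall>L\<in>inner_lagrange k \<Phi> (at_edge T \<Phi> E) E.
       let t = edge_tangent D E in
         coincide (at_edge T \<Phi> E) (\<lambda>H. bil (edge_n1 D E) (W H L) t) \<and>
         coincide (at_edge T \<Phi> E) (\<lambda>H. bil (edge_n2 D E) (W H L) t) \<and>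
         (\<forall>S\<in>grid_faces T \<Phi>. E \<subseteq> S \<longrightarrow>
            (let n = face_normal D S; d = t \<times> n in
               coincide (at_face T \<Phi> S) (\<lambda>H. bil t (W H L) (n \<times> t)) \<and>
               coincide (at_face T \<Phi> S) (\<lambda>H. bil n (W H L) (n \<times> t)) \<and>
               coincide (at_face T \<Phi> S) (\<lambda>H. bil t (W H L) (n \<times> d) + bil d (W H L) (n \<times> t)))))"

definition face_dofs_coincide where
  "face_dofs_coincide k T \<Phi> D W \<longleftrightarrow>
     (\<forall>S\<in>grid_faces T \<Phi>. \<forall>L\<in>inner_lagrange k \<Phi> (at_face T \<Phi> S) S.
       let n = face_normal D S; a1 = face_a1 D S; a2 = face_a2 D S in
         coincide (at_face T \<Phi> S) (\<lambda>H. bil a1 (W H L) (n \<times> a1)) \<and>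
         coincide (at_face T \<Phi> S) (\<lambda>H. bil a2 (W H L) (n \<times> a2)) \<and>
         coincide (at_face T \<Phi> S) (\<lambda>H. bil a1 (W H L) (n \<times> a2) + bil a2 (W H L) (n \<times> a1)) \<and>
         coincide (at_face T \<Phi> S) (\<lambda>H. bil n (W H L) (n \<times> a1)) \<and>
         coincide (at_face T \<Phi> S) (\<lambda>H. bil n (W H L) (n \<times> a2)))"

text \<open>An $L^2$ function is only determined almost everywhere; its restriction to \<open>H\<close> is the unique
  function in \<open>Pi_k\<close> agreeing with it almost everywhere, which has values on the closed element.\<close>
definition H_h_sym_Curl ::
    "nat \<Rightarrow> (real^3) set \<Rightarrow> (real^3) set set \<Rightarrow> ((real^3) set \<Rightarrow> real^3 \<Rightarrow> real^3) \<Rightarrow> grid_vectors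
       \<Rightarrow> (real^3 \<Rightarrow> real^3^3) set" where
  "H_h_sym_Curl k \<Omega> T \<Phi> D = {U \<in> Lp_space 2 \<Omega>. \<exists>W.
     (\<forall>H\<in>T. W H \<in> Pi_k k (\<Phi> H) \<and> (AE x in lebesgue_on (H \<inter> \<Omega>). U x = W H x)) \<and>
     vertex_dofs_coincide T \<Phi> D W \<and> vertex_edge_dofs_coincide T \<Phi> D W \<and>
     edge_dofs_coincide k T \<Phi> D W \<and> face_dofs_coincide k T \<Phi> D W}"

end

theory Submission
  imports Defs
begin

text \<open>Write \<open>2 sym (Curl U)\<close> entry by entry: the entry \<open>(i, m)\<close> is minus the divergence of the vector
  field \<open>e\<^sub>m \<times> U\<^sub>i + e\<^sub>i \<times> U\<^sub>m\<close>, where \<open>U\<^sub>i\<close> is a row of \<open>U\<close>. So the first inclusion says that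
  these piecewise polynomial fields have no surface divergence, that is, that their normal
  components are continuous across the faces inside the domain. On a face with normal \<open>n\<close> the
  normal component is the symmetric form \<open>u\<^sup>T U (n \<times> v) + v\<^sup>T U (n \<times> u)\<close> (\<open>sym_trace\<close>) at \<open>u =
  e\<^sub>i\<close>, \<open>v = e\<^sub>m\<close>. The degrees of freedom are chosen such that at every Lagrange point of the face
  the form of the jump vanishes on a basis: on the face vectors at inner points, on tangent,
  conormal and normal along edges, and on the three face normals at vertices (\<open>sym_trace_edge\<close>,
  \<open>sym_trace_face_inner\<close>, \<open>sym_trace_vertex\<close>). Both traces are polynomials of degree at most \<open>k\<close>
  in the same two face coordinates, so they agree on the whole face (\<open>sym_trace_continuous\<close>).

  That the coordinates are the same is a geometric fact. A face is the image of a square under a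
  bilinear map and, because it is planar and the Jacobian determinant does not vanish, a strictly
  convex quadrilateral. Its corners are the extreme points of its convex hull, and two bilinear
  maps with the same four corners in the same cyclic order agree up to a symmetry of the square
  (\<open>face_matching\<close>).

  The divergence theorem is proved on the unit cube. The Piola transform turns the integral over a
  hexahedron into an integral over the cube, where integration by parts is the fundamental theorem
  of calculus in each coordinate; the boundary terms are fluxes through faces
  (\<open>element_integration_by_parts\<close>). After summation over the grid every face carries its flux
  multiplied by the sum of the orientation signs of the elements at it. This sum vanishes for
  faces inside the domain, since constant fields have total flux zero against every test function,
  and a test function concentrated near one point of the face isolates the sum
  (\<open>face_signs_cancel\<close>). Faces whose relative interior misses the domain do not meet the support
  of a test function except in edges.

  The second inclusion holds since \<open>dev\<close> is linear.

  For the last claim, note that the symmetric form vanishes identically on multiples of the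
  identity. So \<open>U\<close> may be the identity on one element and zero on all others
  (\<open>scalar_identity_dofs\<close>). Its distributional \<open>Curl\<close> has a surface part on a face inside the
  domain, which exists because the domain is connected and there are at least two elements
  (\<open>inner_face_point\<close>). Bump functions that shrink towards the plane of the face keep their values
  on the face, while their integrals against any integrable function tend to zero; hence the
  \<open>Curl\<close> is not an \<open>L\<^sup>p\<close> function (\<open>exists_not_H_Curl\<close>).\<close>

section \<open>Functions with many derivatives\<close>

lemma partial_deriv_eqI:
  assumes "(f has_derivative f') (at x)"
  shows "partial_deriv i f x = f' (axis i 1)"
  using frechet_derivative_at[OF assms] by (simp add: partial_deriv_def)

lemma has_derivative_grad:
  assumes "f differentiable (at x)"
  shows "(f has_derivative (\<lambda>v. grad f x \<bullet> v)) (at x)"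
proof -
  have lin: "linear (frechet_derivative f (at x))"
    using assms by (rule linear_frechet_derivative)
  have "frechet_derivative f (at x) v = grad f x \<bullet> v" for v
  proof -
    have v: "v = (\<Sum>i\<in>UNIV. v$i *\<^sub>R axis i 1)"
      using basis_expansion[of v] by (simp add: scalar_mult_eq_scaleR)
    have "frechet_derivative f (at x) v = (\<Sum>i\<in>UNIV. v$i *\<^sub>R frechet_derivative f (at x) (axis i 1))"
      by (subst v) (simp add: linear_sum[OF lin] linear_scale[OF lin])
    then show ?thesis
      by (simp add: grad_def partial_deriv_def inner_vec_def mult.commute)
  qed
  then have "frechet_derivative f (at x) = (\<lambda>v. grad f x \<bullet> v)" by auto
  then show ?thesis using assms frechet_derivative_works by metis
qed

lemma partial_deriv_const: "partial_deriv i (\<lambda>x. c) = (\<lambda>x. 0)"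
  by (intro ext, rule partial_deriv_eqI[of _ "\<lambda>v. 0", simplified]) (auto intro: derivative_eq_intros)

lemma partial_deriv_add:
  assumes "\<And>x. f differentiable (at x)" "\<And>x. g differentiable (at x)"
  shows "partial_deriv i (\<lambda>x. f x + g x) = (\<lambda>x. partial_deriv i f x + partial_deriv i g x)"
proof
  fix x
  have "((\<lambda>x. f x + g x) has_derivative (\<lambda>v. grad f x \<bullet> v + grad g x \<bullet> v)) (at x)"
    by (intro has_derivative_add has_derivative_grad assms)
  from partial_deriv_eqI[OF this, of i]
  show "partial_deriv i (\<lambda>x. f x + g x) x = partial_deriv i f x + partial_deriv i g x"
    by (simp add: grad_def inner_axis)
qed

lemma partial_deriv_mult:
  assumes "\<And>x. f differentiable (at x)" "\<And>x. g differentiable (at x)"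
  shows "partial_deriv i (\<lambda>x. f x * g x) = (\<lambda>x. partial_deriv i f x * g x + f x * partial_deriv i g x)"
proof
  fix x
  have "((\<lambda>x. f x * g x) has_derivative (\<lambda>v. f x * (grad g x \<bullet> v) + (grad f x \<bullet> v) * g x)) (at x)"
    by (intro has_derivative_mult has_derivative_grad assms)
  from partial_deriv_eqI[OF this, of i]
  show "partial_deriv i (\<lambda>x. f x * g x) x = partial_deriv i f x * g x + f x * partial_deriv i g x"
    by (simp add: grad_def inner_axis)
qed

lemma C_order_continuous: "C_order m f \<Longrightarrow> continuous_on UNIV f"
  by (cases m) (auto intro!: continuous_at_imp_continuous_on differentiable_imp_continuous_within)

lemma C_order_Suc_D: "C_order (Suc m) f \<Longrightarrow> C_order m f"
proof (induction m arbitrary: f)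
  case 0
  then show ?case using C_order_continuous[of "Suc 0" f] by simp
qed auto

lemma C_order_const: "C_order m (\<lambda>x. c)"
  by (induction m arbitrary: c) (auto simp: partial_deriv_const)

lemma C_order_add:
  "C_order m f \<Longrightarrow> C_order m g \<Longrightarrow> C_order m (\<lambda>x. f x + g x)"
  by (induction m arbitrary: f g) (auto intro: continuous_on_add simp: partial_deriv_add)

lemma C_order_mult:
  "C_order m f \<Longrightarrow> C_order m g \<Longrightarrow> C_order m (\<lambda>x. f x * g x)"
proof (induction m arbitrary: f g)
  case (Suc m)
  from Suc.prems have "C_order m f" "C_order m g" using C_order_Suc_D by blast+
  with Suc show ?case by (auto simp: partial_deriv_mult intro!: C_order_add)
qed (auto intro: continuous_on_mult)

lemma grad_continuous:
  assumes "C_order (Suc m) f" shows "continuous_on UNIV (grad f)"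
proof -
  have "continuous_on UNIV (\<lambda>x. \<chi> i. partial_deriv i f x)"
    using assms by (intro continuous_on_vec_lambda) (auto dest: C_order_continuous)
  then show ?thesis by (simp add: grad_def[abs_def])
qed

section \<open>Bump functions\<close>

text \<open>The family \<open>exp (- 1 / t) / t\<^sup>j\<close>, extended by zero, contains its own derivatives up to linear
  combinations, which makes smoothness of all orders a plain induction.\<close>
definition flat :: "nat \<Rightarrow> real \<Rightarrow> real" where
  "flat j t = (if t > 0 then exp (- (1/t)) / t^j else 0)"

lemma flat_nonneg: "0 \<le> flat j t" by (simp add: flat_def)

text \<open>The exponential series contains the term \<open>(1 / t)\<^bsup>j + 1\<^esup> / (j + 1)!\<close>. The resulting linear bound
  gives the derivative at zero, because a difference quotient of a member of the family is the
  next member.\<close>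
lemma flat_bound: "flat j t \<le> fact (Suc j) * \<bar>t\<bar>"
proof (cases "t > 0")
  case True
  have "(1/t)^(Suc j) / fact (Suc j) \<le> exp (1/t)"
  proof -
    have s: "summable (\<lambda>n. (1/t)^n /\<^sub>R fact n)" by (rule summable_exp_generic)
    have "sum (\<lambda>n. (1/t)^n /\<^sub>R fact n) {Suc j} \<le> suminf (\<lambda>n. (1/t)^n /\<^sub>R fact n)"
      using True by (intro sum_le_suminf s) auto
    then show ?thesis by (simp add: exp_def field_simps)
  qed
  then have "1 \<le> exp (1/t) * (fact (Suc j) * t ^ Suc j)"
    using True by (simp add: power_one_over divide_simps del: fact_Suc power_Suc) (simp add: mult_ac)
  then have "exp (- (1/t)) \<le> fact (Suc j) * t ^ Suc j"
    by (simp add: exp_minus divide_simps mult_ac del: fact_Suc power_Suc)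
  then show ?thesis using True by (simp add: flat_def divide_simps mult_ac del: fact_Suc)
qed (auto simp: flat_def simp del: fact_Suc intro: mult_nonneg_nonpos)

lemma flat_deriv: "(flat j has_real_derivative (flat (j+2) t - j * flat (j+1) t)) (at t)"
proof (cases t "0::real" rule: linorder_cases)
  case less
  have "((\<lambda>x. 0) has_real_derivative 0) (at t)" by simp
  then have "(flat j has_real_derivative 0) (at t)"
    by (rule DERIV_cong_ev[THEN iffD1, rotated 3])
       (use less in \<open>auto simp: flat_def intro!: eventually_nhds_in_open[of "{..<0}", THEN eventually_mono]\<close>)
  then show ?thesis using less by (simp add: flat_def)
next
  case greater
  have "((\<lambda>x. exp (- (1/x)) / x^j) has_real_derivative (flat (j+2) t - j * flat (j+1) t)) (at t)"
    using greater
    by (auto intro!: derivative_eq_intros simp: flat_def field_simps power2_eq_square power_add)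
       (cases j; simp add: field_simps)
  then show ?thesis
    by (rule DERIV_cong_ev[THEN iffD1, rotated 3])
       (use greater in \<open>auto simp: flat_def intro!: eventually_nhds_in_open[of "{0<..}", THEN eventually_mono]\<close>)
next
  case equal
  have "((\<lambda>h. flat (Suc j) h) \<longlongrightarrow> 0) (at 0)"
  proof (rule tendsto_sandwich)
    show "\<forall>\<^sub>F h in at 0. 0 \<le> flat (Suc j) h" by (simp add: flat_nonneg)
    show "\<forall>\<^sub>F h in at 0. flat (Suc j) h \<le> fact (Suc (Suc j)) * \<bar>h\<bar>"
      using flat_bound by (intro always_eventually) blast
    show "((\<lambda>h::real. fact (Suc (Suc j)) * \<bar>h\<bar>) \<longlongrightarrow> 0) (at 0)"
      by (rule tendsto_eq_intros refl | simp)+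
  qed auto
  then have "((\<lambda>h. (flat j (0 + h) - flat j 0) / h) \<longlongrightarrow> 0) (at 0)"
    by (rule Lim_transform_eventually) (auto simp: flat_def eventually_at_filter)
  then show ?thesis using equal by (simp add: DERIV_def flat_def)
qed

lemma C_order_flat:
  assumes "\<And>m. C_order m r"
  shows "C_order m (\<lambda>x. flat j (r x))"
proof (induction m arbitrary: j)
  case 0
  have "continuous_on UNIV (flat j)"
    using flat_deriv by (intro DERIV_continuous_on) (auto intro: has_field_derivative_at_within)
  then show ?case
    using continuous_on_compose2[OF _ C_order_continuous[OF assms]] by auto
next
  case (Suc m)
  have dr: "r differentiable (at x)" for x using assms[of 1] by simp
  have d: "((\<lambda>x. flat j (r x)) has_derivative
       (\<lambda>v. (flat (j+2) (r x) - j * flat (j+1) (r x)) * (grad r x \<bullet> v))) (at x)" for x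
    using has_derivative_compose[OF has_derivative_grad[OF dr], of "flat j"] flat_deriv
    by (simp add: has_field_derivative_def o_def)
  have "partial_deriv i (\<lambda>x. flat j (r x)) =
     (\<lambda>x. (flat (j+2) (r x) + (- real j) * flat (j+1) (r x)) * partial_deriv i r x)" for i
    using partial_deriv_eqI[OF d] by (auto simp: grad_def inner_axis)
  moreover have "C_order m (partial_deriv i r)" for i using assms[of "Suc m"] by simp
  ultimately have "C_order m (partial_deriv i (\<lambda>x. flat j (r x)))" for i
    by (simp only:) (intro C_order_mult C_order_add C_order_const Suc.IH)
  then show ?case using d by (auto simp: differentiable_def)
qed

lemma C_order_inner: "C_order m (\<lambda>x. (x - a) \<bullet> v)"
proof (cases m)
  case (Suc k)
  have d: "((\<lambda>x. (x - a) \<bullet> v) has_derivative (\<lambda>h. h \<bullet> v)) (at x)" for x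
    by (auto intro!: derivative_eq_intros)
  have "partial_deriv i (\<lambda>x. (x - a) \<bullet> v) = (\<lambda>x. axis i 1 \<bullet> v)" for i
    using partial_deriv_eqI[OF d] by auto
  with d Suc show ?thesis by (auto simp: differentiable_def C_order_const)
qed (auto intro!: continuous_intros)

text \<open>For \<open>K \<ge> 0\<close> the support is an ellipsoid inside the ball of radius \<open>r\<close>, and it flattens towards
  the plane through \<open>a\<close> orthogonal to \<open>n\<close> as \<open>K\<close> grows, while the values on that plane do not
  change. With \<open>K = 0\<close> this is the usual radial bump.\<close>
definition bump :: "real^3 \<Rightarrow> real \<Rightarrow> real^3 \<Rightarrow> real \<Rightarrow> real^3 \<Rightarrow> real" where
  "bump a r n K x = flat 0 (r\<^sup>2 - (x - a) \<bullet> (x - a) - K * ((x - a) \<bullet> n)\<^sup>2)"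

lemma bump_nonneg: "0 \<le> bump a r n K x" by (simp add: bump_def flat_nonneg)

lemma bump_le_1: "bump a r n K x \<le> 1" by (simp add: bump_def flat_def)

lemma bump_center: "r > 0 \<Longrightarrow> bump a r n K a > 0" by (simp add: bump_def flat_def)

lemma bump_plane: "(x - a) \<bullet> n = 0 \<Longrightarrow> bump a r n K x = bump a r n 0 x"
  by (simp add: bump_def)

lemma bump_outside:
  assumes "0 \<le> K" "0 < r" "dist a x \<ge> r" shows "bump a r n K x = 0"
proof -
  have "r\<^sup>2 \<le> (norm (x - a))\<^sup>2"
    using assms by (intro power_mono) (auto simp: dist_norm norm_minus_commute)
  then have "r\<^sup>2 - (x - a) \<bullet> (x - a) - K * ((x - a) \<bullet> n)\<^sup>2 \<le> 0"
    using assms by (simp add: power2_norm_eq_inner) (smt (verit) mult_nonneg_nonneg zero_le_power2)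
  then show ?thesis by (simp add: bump_def flat_def)
qed

lemma bump_tendsto:
  assumes "(x - a) \<bullet> n \<noteq> 0"
  shows "(\<lambda>K. bump a r n (real K) x) \<longlonglongrightarrow> 0"
proof (rule tendsto_eventually)
  obtain K0 :: nat where "r\<^sup>2 / ((x - a) \<bullet> n)\<^sup>2 < real K0" using reals_Archimedean2 by blast
  then have k: "r\<^sup>2 < real K0 * ((x - a) \<bullet> n)\<^sup>2" using assms by (simp add: field_simps)
  have "bump a r n (real K) x = 0" if "K \<ge> K0" for K
  proof -
    have "real K0 * ((x - a) \<bullet> n)\<^sup>2 \<le> real K * ((x - a) \<bullet> n)\<^sup>2" using that by (intro mult_right_mono) auto
    with k have "r\<^sup>2 - (x - a) \<bullet> (x - a) - real K * ((x - a) \<bullet> n)\<^sup>2 \<le> 0"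
      using inner_ge_zero[of "x - a"] by linarith
    then show ?thesis by (simp add: bump_def flat_def)
  qed
  then show "\<forall>\<^sub>F K in sequentially. bump a r n (real K) x = 0" by (auto simp: eventually_sequentially)
qed

lemma bump_C_order: "C_order m (bump a r n K)"
proof -
  have e: "(\<lambda>x. r\<^sup>2 - (x - a) \<bullet> (x - a) - K * ((x - a) \<bullet> n)\<^sup>2) =
    (\<lambda>x. (r\<^sup>2 + (-1) * ((((x - a) \<bullet> axis 1 1) * ((x - a) \<bullet> axis 1 1) + ((x - a) \<bullet> axis 2 1) * ((x - a) \<bullet> axis 2 1))
       + ((x - a) \<bullet> axis 3 1) * ((x - a) \<bullet> axis 3 1))) + (- K) * (((x - a) \<bullet> n) * ((x - a) \<bullet> n)))"
    by (auto simp: inner_axis inner_vec_def[of "_ - a" "_ - a"] sum_3 power2_eq_square)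
  have "C_order m (\<lambda>x. r\<^sup>2 - (x - a) \<bullet> (x - a) - K * ((x - a) \<bullet> n)\<^sup>2)" for m
    unfolding e by (intro C_order_add C_order_mult C_order_const C_order_inner)
  then show ?thesis unfolding bump_def[abs_def] by (rule C_order_flat)
qed

lemma bump_test:
  assumes "0 \<le> K" "0 < r" "cball a r \<subseteq> \<Omega>"
  shows "bump a r n K \<in> test_functions \<Omega>"
proof -
  have "{x. bump a r n K x \<noteq> 0} \<subseteq> cball a r"
    using bump_outside[OF assms(1,2)] by (force simp: not_le)
  then have "closure {x. bump a r n K x \<noteq> 0} \<subseteq> cball a r" by (rule closure_minimal) auto
  then show ?thesis using assms(3) bump_C_order
    by (auto simp: test_functions_def compact_eq_bounded_closed intro: bounded_subset[OF bounded_cball])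
qed

section \<open>Polynomial functions of three variables\<close>

lemma real_polynomial_differentiable:
  "real_polynomial_function (f :: real^3 \<Rightarrow> real) \<Longrightarrow> f differentiable (at x)"
  by (rule differentiable_at_real_polynomial_function)

lemma partial_deriv_linear:
  fixes f :: "real^3 \<Rightarrow> real"
  assumes "bounded_linear f"
  shows "partial_deriv i f = (\<lambda>x. f (axis i 1))"
  using partial_deriv_eqI[OF bounded_linear_imp_has_derivative[OF assms]] by auto

lemma real_polynomial_partial_deriv:
  "real_polynomial_function f \<Longrightarrow> real_polynomial_function (partial_deriv i f)"
  by (induction f rule: real_polynomial_function.induct)
     (auto simp: partial_deriv_linear partial_deriv_const partial_deriv_add partial_deriv_mult
        real_polynomial_differentiable real_polynomial_function.intros)

lemma partial_deriv_commute:
  "real_polynomial_function f \<Longrightarrow>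
    partial_deriv i (partial_deriv j f) = partial_deriv j (partial_deriv i f)"
proof (induction f rule: real_polynomial_function.induct)
  case (mult f g)
  note rp = mult.hyps real_polynomial_partial_deriv[OF mult.hyps(1)] real_polynomial_partial_deriv[OF mult.hyps(2)]
  show ?case using mult.IH
    by (auto simp: partial_deriv_add partial_deriv_mult rp real_polynomial_differentiable
         real_polynomial_function.intros)
qed (auto simp: partial_deriv_linear partial_deriv_const partial_deriv_add
        real_polynomial_differentiable real_polynomial_partial_deriv)

lemma real_polynomial_continuous:
  "real_polynomial_function (f :: real^3 \<Rightarrow> real) \<Longrightarrow> continuous_on S f"
  by (meson continuous_at_imp_continuous_on differentiable_imp_continuous_within real_polynomial_differentiable)

lemma real_polynomial_C_order: "real_polynomial_function f \<Longrightarrow> C_order m f"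
  by (induction m arbitrary: f)
     (auto simp: real_polynomial_continuous real_polynomial_differentiable real_polynomial_partial_deriv)

lemma real_polynomial_coord: "real_polynomial_function (\<lambda>x::real^3. x $ i)"
  by (intro real_polynomial_function.intros(1) bounded_linear_vec_nth)

section \<open>Iterated integrals over the unit cube\<close>

text \<open>The eight parametrizations of the side \<open>\<xi>\<^sub>l = c\<close> of the cube by the unit square: the first
  parameter runs along the axis \<open>i\<close>, the second along the remaining axis, and \<open>a\<close>, \<open>b\<close> say whether
  they run backwards. For \<open>c\<close> ranging over an interval they also describe the cube as a product.\<close>
definition chart :: "3 \<Rightarrow> real \<Rightarrow> 3 \<Rightarrow> bool \<Rightarrow> bool \<Rightarrow> real \<Rightarrow> real \<Rightarrow> real^3" where
  "chart l c i a b s t =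
     (\<chi> m. if m = l then c else if m = i then (if a then 1 - s else s) else (if b then 1 - t else t))"

abbreviation fpt :: "3 \<Rightarrow> real \<Rightarrow> real \<Rightarrow> real \<Rightarrow> real^3" where
  "fpt l c s t \<equiv> chart l c (l + 1) False False s t"

abbreviation square :: "(real \<times> real) set" where "square \<equiv> cbox (0,0) (1,1)"

lemma three_cases: fixes l :: 3 obtains "l = 1" | "l = 2" | "l = 3"
  using exhaust_3 by blast

lemma axis_fpt_3:
  "l + 1 \<noteq> (l::3)" "l + 2 \<noteq> l" "l + 1 \<noteq> l + 2" "m = l \<or> m = l + 1 \<or> m = l + 2"
  by (cases l rule: three_cases; cases m rule: three_cases; simp)+

lemma three_num: "(4::3) = 1" "(5::3) = 2" by simp_all

lemma forall_axis: "(\<forall>m. Q m) \<longleftrightarrow> Q l \<and> Q (l + 1) \<and> Q (l + 2)" for l :: 3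
  by (cases l rule: three_cases) (simp_all add: forall_3 three_num conj_ac)

lemma fpt_nth: "fpt l c s t $ l = c" "fpt l c s t $ (l + 1) = s" "fpt l c s t $ (l + 2) = t"
  using axis_fpt_3[of l] by (auto simp: chart_def)

lemma continuous_on_chart [continuous_intros]:
  assumes "continuous_on S f" "continuous_on S g" "continuous_on S h"
  shows "continuous_on S (\<lambda>x. chart l (f x) i a b (g x) (h x))"
proof -
  have "continuous_on S (\<lambda>x. if m = l then f x else if m = i then (if a then 1 - g x else g x)
     else (if b then 1 - h x else h x))" for m
    by (cases "m = l"; cases "m = i"; cases a; cases b) (auto intro!: continuous_intros assms)
  then show ?thesis unfolding chart_def by (intro continuous_on_vec_lambda)
qed

lemma unit_cube_cbox: "unit_cube = cbox 0 (\<chi> i. 1)"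
  by (auto simp: mem_box_cart)

lemma box_Pair: "box (a, c) (b, d) = Sigma (box a b) (\<lambda>_. box c d)"
  by (auto simp: mem_box Basis_prod_def ball_Un)

lemma emeasure_box_triple:
  fixes a b a' b' a'' b'' :: real
  assumes "a \<le> b" "a' \<le> b'" "a'' \<le> b''"
  shows "emeasure lborel (box (a, a', a'') (b, b', b'')) = ennreal ((b - a) * ((b' - a') * (b'' - a'')))"
proof -
  have "emeasure lborel (box (a, a', a'') (b, b', b'')) =
     emeasure (lborel \<Otimes>\<^sub>M (lborel \<Otimes>\<^sub>M lborel)) (Sigma (box a b) (\<lambda>_. Sigma (box a' b') (\<lambda>_. box a'' b'')))"
    by (simp add: lborel_prod box_Pair)
  also have "\<dots> = emeasure lborel (box a b) * emeasure (lborel \<Otimes>\<^sub>M lborel) (Sigma (box a' b') (\<lambda>_. box a'' b''))"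
    unfolding lborel_prod[symmetric, where 'a = real and 'b = real]
    by (intro lborel_pair.emeasure_pair_measure_Times) auto
  also have "emeasure (lborel \<Otimes>\<^sub>M lborel) (Sigma (box a' b') (\<lambda>_. box a'' b'')) =
      emeasure lborel (box a' b') * emeasure lborel (box a'' b'')"
    by (intro lborel.emeasure_pair_measure_Times) auto
  finally show ?thesis using assms by (simp add: ennreal_mult)
qed

text \<open>Reading off the coordinates in the order \<open>l\<close>, \<open>l + 1\<close>, \<open>l + 2\<close> preserves the volume of boxes.
  This makes Fubini's theorem for product types available with any coordinate integrated first.\<close>
lemma lborel_eq_distr_fpt:
  "lborel = distr (lborel :: (real \<times> real \<times> real) measure) borel (\<lambda>(c, s, t). fpt l c s t)"
proof (rule lborel_eqI)
  let ?f = "\<lambda>(c, s, t). fpt l c s t"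
  have m: "?f \<in> borel_measurable borel"
    by (intro borel_measurable_continuous_onI) (auto simp: split_beta intro!: continuous_intros)
  fix a b :: "real^3"
  assume ab: "\<And>i. i \<in> Basis \<Longrightarrow> a \<bullet> i \<le> b \<bullet> i"
  have ab': "a $ i \<le> b $ i" for i using ab[of "axis i 1"] by (auto simp: inner_axis axis_in_Basis_iff)
  have pre: "?f -` box a b = box (a$l, a$(l+1), a$(l+2)) (b$l, b$(l+1), b$(l+2))"
  proof (intro set_eqI)
    fix x :: "real \<times> real \<times> real"
    obtain c s t where x: "x = (c, s, t)" by (cases x)
    have "(\<forall>m. a $ m < fpt l c s t $ m \<and> fpt l c s t $ m < b $ m) \<longleftrightarrow>
      (a $ l < c \<and> c < b $ l) \<and> (a $ (l+1) < s \<and> s < b $ (l+1)) \<and> (a $ (l+2) < t \<and> t < b $ (l+2))"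
      by (subst forall_axis[of _ l]) (simp only: fpt_nth)
    then show "x \<in> ?f -` box a b \<longleftrightarrow> x \<in> box (a$l, a$(l+1), a$(l+2)) (b$l, b$(l+1), b$(l+2))"
      by (auto simp: x mem_box_cart box_Pair mem_box)
  qed
  have "emeasure (distr lborel borel ?f) (box a b) = emeasure lborel (?f -` box a b)"
    using m by (subst emeasure_distr) (auto simp: space_lborel)
  also have "\<dots> = ennreal ((b$l - a$l) * ((b$(l+1) - a$(l+1)) * (b$(l+2) - a$(l+2))))"
    unfolding pre by (intro emeasure_box_triple ab')
  also have "(b$l - a$l) * ((b$(l+1) - a$(l+1)) * (b$(l+2) - a$(l+2))) = prod ((\<bullet>) (b - a)) Basis"
  proof -
    have "prod ((\<bullet>) (b - a)) Basis = (\<Prod>i\<in>UNIV. (b - a) $ i)"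
      by (simp add: Basis_vec_def UNION_singleton_eq_range prod.reindex inj_on_def axis_eq_axis inner_axis)
    also have "(UNIV :: 3 set) = {l, l+1, l+2}" using axis_fpt_3(4) by auto
    finally show ?thesis using axis_fpt_3[of l] by simp
  qed
  finally show "emeasure (distr lborel borel ?f) (box a b) = ennreal (prod ((\<bullet>) (b - a)) Basis)" .
qed simp

lemma integral_unit_cube_iterated:
  fixes u :: "real^3 \<Rightarrow> real"
  assumes cont: "continuous_on UNIV u"
  shows "integral unit_cube u =
    integral square (\<lambda>(s, t). integral {0..1} (\<lambda>c. u (fpt l c s t)))"
proof -
  let ?f = "\<lambda>(c, s, t). fpt l c s t"
  have m: "?f \<in> borel_measurable borel"
    by (intro borel_measurable_continuous_onI) (auto simp: split_beta intro!: continuous_intros)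
  have um: "u \<in> borel_measurable borel" using cont by (rule borel_measurable_continuous_onI)
  have "integral unit_cube u = (LINT x:unit_cube|lborel. u x)"
    unfolding unit_cube_cbox
    unfolding set_integrable_def
    by (intro set_borel_integral_eq_integral(2)[symmetric], unfold set_integrable_def)
       (intro borel_integrable_compact continuous_on_subset[OF cont]; simp)
  also have "\<dots> = (\<integral>x. indicator unit_cube x *\<^sub>R u x \<partial>distr lborel borel ?f)"
    by (subst lborel_eq_distr_fpt[of l]) (simp add: set_lebesgue_integral_def)
  also have "\<dots> = (\<integral>x. indicator unit_cube (?f x) *\<^sub>R u (?f x) \<partial>lborel)"
    using m um by (intro integral_distr) (auto simp: unit_cube_cbox)
  also have "\<dots> = (LINT x:cbox (0,0,0) (1,1,1)|lborel. u (?f x))"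
  proof -
    have "?f x \<in> unit_cube \<longleftrightarrow> x \<in> cbox (0,0,0) (1,1,1)" for x
    proof -
      obtain c s t where x: "x = (c, s, t)" by (cases x)
      have "(\<forall>m. 0 \<le> fpt l c s t $ m \<and> fpt l c s t $ m \<le> 1) \<longleftrightarrow>
        (0 \<le> c \<and> c \<le> 1) \<and> (0 \<le> s \<and> s \<le> 1) \<and> (0 \<le> t \<and> t \<le> 1)"
        by (subst forall_axis[of _ l]) (simp only: fpt_nth)
      then show ?thesis by (auto simp: x cbox_Pair_eq)
    qed
    then show ?thesis unfolding set_lebesgue_integral_def
      by (intro Bochner_Integration.integral_cong) (auto simp: indicator_def)
  qed
  also have "\<dots> = integral (cbox (0,0,0) (1,1,1)) (\<lambda>x. u (?f x))"
    unfolding set_integrable_def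
    by (intro set_borel_integral_eq_integral(2), unfold set_integrable_def)
       (intro borel_integrable_compact; auto simp: split_beta
         intro!: continuous_intros continuous_on_compose2[OF cont])
  also have "\<dots> = integral (cbox 0 1) (\<lambda>c. integral square (\<lambda>y. u (?f (c, y))))"
    by (rule integral_prod_continuous)
       (auto simp: split_beta intro!: continuous_intros continuous_on_compose2[OF cont])
  also have "\<dots> = integral square (\<lambda>y. integral (cbox 0 1) (\<lambda>c. u (?f (c, y))))"
    by (rule integral_swap_continuous)
       (auto simp: split_beta intro!: continuous_intros continuous_on_compose2[OF cont])
  finally show ?thesis by (simp add: case_prod_unfold)
qed

lemma integral_unit_cube_partial_deriv:
  assumes "C_order 1 u"
  shows "integral unit_cube (partial_deriv l u) =
    integral square (\<lambda>(s, t). u (fpt l 1 s t) - u (fpt l 0 s t))"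
proof -
  have cont: "continuous_on UNIV (partial_deriv l u)" and d: "u differentiable (at x)" for x
    using assms by auto
  have "integral {0..1} (\<lambda>c. partial_deriv l u (fpt l c s t)) = u (fpt l 1 s t) - u (fpt l 0 s t)" for s t
  proof (rule integral_unique, rule fundamental_theorem_of_calculus)
    fix c :: real
    have f: "fpt l c s t = fpt l 0 s t + c *\<^sub>R axis l 1" for c
      by (auto simp: chart_def vec_eq_iff axis_def)
    have "((\<lambda>c. fpt l 0 s t + c *\<^sub>R axis l 1) has_derivative (\<lambda>h. h *\<^sub>R axis l 1)) (at c)"
      by (auto intro!: derivative_eq_intros)
    then have "((\<lambda>c. fpt l c s t) has_derivative (\<lambda>h. h *\<^sub>R axis l 1)) (at c)"
      by (simp only: f[symmetric])
    from has_derivative_compose[OF this has_derivative_grad[OF d]]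
    have "((\<lambda>c. u (fpt l c s t)) has_vector_derivative partial_deriv l u (fpt l c s t)) (at c)"
      by (simp add: has_vector_derivative_def grad_def inner_axis inner_axis')
    then show "((\<lambda>c. u (fpt l c s t)) has_vector_derivative partial_deriv l u (fpt l c s t)) (at c within {0..1})"
      by (rule has_vector_derivative_at_within)
  qed auto
  then show ?thesis by (simp add: integral_unit_cube_iterated[OF cont, of l])
qed

section \<open>Integration by parts on one element\<close>

definition poly_map :: "(real^3 \<Rightarrow> real^3) \<Rightarrow> bool" where
  "poly_map F \<longleftrightarrow> (\<forall>j. real_polynomial_function (\<lambda>\<xi>. F \<xi> $ j))"

definition tangent :: "(real^3 \<Rightarrow> real^3) \<Rightarrow> 3 \<Rightarrow> real^3 \<Rightarrow> real^3" where
  "tangent F l \<xi> = (\<chi> j. partial_deriv l (\<lambda>\<xi>. F \<xi> $ j) \<xi>)"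

text \<open>By Nanson's formula this is the area vector that \<open>F\<close> produces from the sides \<open>\<xi>\<^sub>l = c\<close>; it is
  also a column of the cofactor matrix of the Jacobian matrix.\<close>
definition area :: "(real^3 \<Rightarrow> real^3) \<Rightarrow> 3 \<Rightarrow> real^3 \<Rightarrow> real^3" where
  "area F l \<xi> = tangent F (l + 1) \<xi> \<times> tangent F (l + 2) \<xi>"

definition jdet :: "(real^3 \<Rightarrow> real^3) \<Rightarrow> real^3 \<Rightarrow> real" where
  "jdet F \<xi> = det (jacobian F (at \<xi>))"

lemma poly_map_derivative:
  assumes "poly_map F"
  shows "(F has_derivative (\<lambda>v. \<Sum>l\<in>UNIV. v$l *\<^sub>R tangent F l \<xi>)) (at \<xi>)"
proof -
  have "((\<lambda>\<xi>. F \<xi> $ j) has_derivative (\<lambda>v. grad (\<lambda>\<xi>. F \<xi> $ j) \<xi> \<bullet> v)) (at \<xi>)" for j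
    using assms by (intro has_derivative_grad real_polynomial_differentiable) (auto simp: poly_map_def)
  then have "(F has_derivative (\<lambda>v. \<chi> j. grad (\<lambda>\<xi>. F \<xi> $ j) \<xi> \<bullet> v)) (at \<xi>)"
    by (subst has_derivative_componentwise_within) (auto simp: Basis_vec_def inner_axis)
  moreover have "(\<lambda>v. \<chi> j. grad (\<lambda>\<xi>. F \<xi> $ j) \<xi> \<bullet> v) = (\<lambda>v. \<Sum>l\<in>UNIV. v$l *\<^sub>R tangent F l \<xi>)"
    by (auto simp: fun_eq_iff vec_eq_iff inner_vec_def grad_def tangent_def mult.commute)
  ultimately show ?thesis by simp
qed

lemma jacobian_tangent:
  assumes "poly_map F"
  shows "jacobian F (at \<xi>) $ j $ l = tangent F l \<xi> $ j"
proof -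
  have "frechet_derivative F (at \<xi>) = (\<lambda>v. \<Sum>l\<in>UNIV. v$l *\<^sub>R tangent F l \<xi>)"
    using frechet_derivative_at[OF poly_map_derivative[OF assms]] by simp
  then show ?thesis by (simp add: jacobian_def matrix_def axis_def if_distrib[of "\<lambda>c. c * _"] cong: if_cong)
qed

lemma jdet_tangent_area:
  assumes "poly_map F" shows "jdet F \<xi> = tangent F l \<xi> \<bullet> area F l \<xi>"
  by (cases l rule: three_cases)
     (simp_all add: jdet_def det_3 jacobian_tangent[OF assms] area_def three_num
        cross3_simps inner_vec_def sum_3 algebra_simps)

text \<open>The area vectors form, up to the determinant, the basis dual to the tangents. With \<open>p\<close> the
  gradient of a function, this transforms a directional derivative to local coordinates without
  inverting the Jacobian matrix.\<close>
lemma jdet_expansion: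
  assumes "poly_map F"
  shows "jdet F \<xi> * (a \<bullet> p) = (\<Sum>l\<in>UNIV. (p \<bullet> tangent F l \<xi>) * (a \<bullet> area F l \<xi>))"
proof -
  have "(c1 \<bullet> (c2 \<times> c3)) * (a \<bullet> p) =
    (p \<bullet> c1) * (a \<bullet> (c2 \<times> c3)) + (p \<bullet> c2) * (a \<bullet> (c3 \<times> c1)) + (p \<bullet> c3) * (a \<bullet> (c1 \<times> c2))" for c1 c2 c3 :: "real^3"
    by (simp add: cross3_simps inner_vec_def sum_3 algebra_simps)
  then show ?thesis
    by (simp add: jdet_tangent_area[OF assms, of _ 1] sum_3 area_def three_num)
qed

lemma poly_map_tangent: "poly_map F \<Longrightarrow> poly_map (tangent F l)"
  by (auto simp: poly_map_def tangent_def real_polynomial_partial_deriv)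

lemma real_polynomial_function_minus_mult:
  "real_polynomial_function f \<Longrightarrow> real_polynomial_function g \<Longrightarrow> real_polynomial_function h \<Longrightarrow>
   real_polynomial_function k \<Longrightarrow> real_polynomial_function (\<lambda>x. f x * g x - h x * k x)"
  by (rule real_polynomial_function_diff; rule real_polynomial_function.intros(4))

lemma poly_map_area: "poly_map F \<Longrightarrow> poly_map (area F l)"
  using poly_map_tangent[of F "l + 1"] poly_map_tangent[of F "l + 2"]
  unfolding poly_map_def forall_3
  by (auto simp: area_def cross3_def intro!: real_polynomial_function_minus_mult)

lemma real_polynomial_inner:
  "poly_map f \<Longrightarrow> poly_map g \<Longrightarrow> real_polynomial_function (\<lambda>\<xi>. f \<xi> \<bullet> g \<xi>)"
  unfolding poly_map_def inner_vec_def by (intro real_polynomial_function_sum) (auto intro: real_polynomial_function.intros)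

lemma poly_map_continuous: "poly_map F \<Longrightarrow> continuous_on S F"
  using poly_map_derivative by (meson continuous_at_imp_continuous_on has_derivative_continuous)

lemma jdet_polynomial: "poly_map F \<Longrightarrow> real_polynomial_function (jdet F)"
  using real_polynomial_inner[OF poly_map_tangent[of F 1] poly_map_area[of F 1]]
    ext[of "jdet F", OF jdet_tangent_area[of F _ 1]] by simp

text \<open>Second derivatives commute and the cross product is antisymmetric, so the six terms cancel in
  pairs.\<close>
lemma piola:
  assumes "poly_map F"
  shows "(\<Sum>l\<in>UNIV. partial_deriv l (\<lambda>\<xi>. area F l \<xi> $ j) \<xi>) = 0"
proof -
  let ?D = "\<lambda>l j. partial_deriv l (\<lambda>\<xi>. F \<xi> $ j)"
  have rp: "real_polynomial_function (?D l j)" for l j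
    using assms by (auto simp: poly_map_def intro: real_polynomial_partial_deriv)
  have c: "partial_deriv i (?D l j) = partial_deriv l (?D i j)" for i l j
    using assms by (intro partial_deriv_commute) (auto simp: poly_map_def)
  have d: "partial_deriv l (\<lambda>\<xi>. f \<xi> * g \<xi> - h \<xi> * k \<xi>) \<xi> =
     partial_deriv l f \<xi> * g \<xi> + f \<xi> * partial_deriv l g \<xi> - (partial_deriv l h \<xi> * k \<xi> + h \<xi> * partial_deriv l k \<xi>)"
    if "real_polynomial_function f" "real_polynomial_function g" "real_polynomial_function h" "real_polynomial_function k"
    for f g h k l
  proof -
    note dd = that[THEN real_polynomial_differentiable]
    have "((\<lambda>\<xi>. f \<xi> * g \<xi> - h \<xi> * k \<xi>) has_derivative
       (\<lambda>v. (f \<xi> * (grad g \<xi> \<bullet> v) + (grad f \<xi> \<bullet> v) * g \<xi>) - (h \<xi> * (grad k \<xi> \<bullet> v) + (grad h \<xi> \<bullet> v) * k \<xi>))) (at \<xi>)"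
      by (intro has_derivative_diff has_derivative_mult has_derivative_grad dd)
    from partial_deriv_eqI[OF this, of l] show ?thesis by (simp add: grad_def inner_axis)
  qed
  have "\<forall>j. (\<Sum>l\<in>UNIV. partial_deriv l (\<lambda>\<xi>. area F l \<xi> $ j) \<xi>) = 0"
    unfolding forall_3
    by (auto simp: sum_3 area_def cross3_def tangent_def three_num d rp)
       (simp_all add: c[of 2 1] c[of 3 1] c[of 3 2] algebra_simps)
  then show ?thesis by blast
qed

text \<open>The divergence of the Piola transform of \<open>g\<close>; divided by the Jacobian determinant it is the
  divergence in the physical coordinates.\<close>
definition fdiv :: "(real^3 \<Rightarrow> real^3) \<Rightarrow> (real^3 \<Rightarrow> real^3) \<Rightarrow> real^3 \<Rightarrow> real" where
  "fdiv F g \<xi> = (\<Sum>l\<in>UNIV. partial_deriv l (\<lambda>\<xi>. g \<xi> \<bullet> area F l \<xi>) \<xi>)"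

definition face_flux :: "(real^3 \<Rightarrow> real^3) \<Rightarrow> (real^3 \<Rightarrow> real^3) \<Rightarrow> (real^3 \<Rightarrow> real) \<Rightarrow> 3 \<Rightarrow> real \<Rightarrow> real" where
  "face_flux F g \<phi> l c = integral square (\<lambda>(s, t).
     \<phi> (F (fpt l c s t)) * (g (fpt l c s t) \<bullet> area F l (fpt l c s t)))"

definition flux :: "(real^3 \<Rightarrow> real^3) \<Rightarrow> (real^3 \<Rightarrow> real^3) \<Rightarrow> (real^3 \<Rightarrow> real) \<Rightarrow> real" where
  "flux F g \<phi> = (\<Sum>l\<in>UNIV. face_flux F g \<phi> l 1 - face_flux F g \<phi> l 0)"

lemma fdiv_polynomial:
  assumes "poly_map F" "poly_map g" shows "real_polynomial_function (fdiv F g)"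
  unfolding fdiv_def[abs_def]
  by (intro real_polynomial_function_sum real_polynomial_partial_deriv real_polynomial_inner poly_map_area assms) auto

lemma fdiv_const:
  assumes "poly_map F" shows "fdiv F (\<lambda>\<xi>. v) \<xi> = 0"
proof -
  have rp: "real_polynomial_function (\<lambda>\<xi>. area F l \<xi> $ j)" for l j
    using poly_map_area[OF assms] by (auto simp: poly_map_def)
  have "partial_deriv l (\<lambda>\<xi>. v \<bullet> area F l \<xi>) \<xi> = (\<Sum>j\<in>UNIV. v $ j * partial_deriv l (\<lambda>\<xi>. area F l \<xi> $ j) \<xi>)" for l
  proof -
    have "((\<lambda>\<xi>. \<Sum>j\<in>UNIV. v $ j * area F l \<xi> $ j) has_derivative
       (\<lambda>h. \<Sum>j\<in>UNIV. v $ j * (grad (\<lambda>\<xi>. area F l \<xi> $ j) \<xi> \<bullet> h))) (at \<xi>)"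
      by (intro has_derivative_sum has_derivative_mult_right has_derivative_grad real_polynomial_differentiable rp)
    from partial_deriv_eqI[OF this, of l]
    have "partial_deriv l (\<lambda>\<xi>. \<Sum>j\<in>UNIV. v $ j * area F l \<xi> $ j) \<xi> =
      (\<Sum>j\<in>UNIV. v $ j * partial_deriv l (\<lambda>\<xi>. area F l \<xi> $ j) \<xi>)"
      by (simp add: grad_def inner_axis)
    then show ?thesis by (simp add: inner_vec_def)
  qed
  then have "fdiv F (\<lambda>\<xi>. v) \<xi> = (\<Sum>l\<in>UNIV. \<Sum>j\<in>UNIV. v $ j * partial_deriv l (\<lambda>\<xi>. area F l \<xi> $ j) \<xi>)"
    by (simp add: fdiv_def)
  also have "\<dots> = (\<Sum>j\<in>UNIV. v $ j * (\<Sum>l\<in>UNIV. partial_deriv l (\<lambda>\<xi>. area F l \<xi> $ j) \<xi>))"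
    by (subst sum.swap) (simp add: sum_distrib_left)
  finally show ?thesis by (simp add: piola[OF assms])
qed

text \<open>The integrand on the left is \<open>\<Sum>\<^sub>l \<partial>\<^sub>l (\<phi> \<circ> F) (g \<bullet> area\<^sub>l)\<close> by \<open>jdet_expansion\<close>. Adding the
  second integral completes the product rule, and each summand is then integrated along its own
  coordinate.\<close>
lemma cube_integration_by_parts:
  assumes F: "poly_map F" and g: "poly_map g" and \<phi>: "C_order 1 \<phi>"
  shows "integral unit_cube (\<lambda>\<xi>. jdet F \<xi> * (g \<xi> \<bullet> grad \<phi> (F \<xi>))) +
         integral unit_cube (\<lambda>\<xi>. \<phi> (F \<xi>) * fdiv F g \<xi>) = flux F g \<phi>"
proof -
  let ?\<psi> = "\<lambda>\<xi>. \<phi> (F \<xi>)"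
  let ?h = "\<lambda>l \<xi>. g \<xi> \<bullet> area F l \<xi>"
  have d\<phi>: "\<phi> differentiable (at x)" for x using \<phi> by simp
  have cphi: "continuous_on S \<phi>" and cgrad: "continuous_on S (grad \<phi>)" for S
    using \<phi> C_order_continuous[OF \<phi>] grad_continuous[of 0 \<phi>] by (auto intro: continuous_on_subset)
  have cF: "continuous_on S F" for S using F by (rule poly_map_continuous)
  have c1: "continuous_on S ?\<psi>" "continuous_on S (\<lambda>\<xi>. grad \<phi> (F \<xi>))" for S
    using continuous_on_compose2[OF cphi[of UNIV] cF] continuous_on_compose2[OF cgrad[of UNIV] cF] by auto
  have dpsi: "(?\<psi> has_derivative (\<lambda>v. grad \<phi> (F \<xi>) \<bullet> (\<Sum>l\<in>UNIV. v$l *\<^sub>R tangent F l \<xi>))) (at \<xi>)" for \<xi>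
    using has_derivative_compose[OF poly_map_derivative[OF F] has_derivative_grad[OF d\<phi>]] .
  have pd: "partial_deriv l ?\<psi> = (\<lambda>\<xi>. grad \<phi> (F \<xi>) \<bullet> tangent F l \<xi>)" for l
    using partial_deriv_eqI[OF dpsi, of l]
    by (auto simp: axis_def if_distrib[of "\<lambda>c. c *\<^sub>R _"] cong: if_cong)
  have "C_order 1 ?\<psi>"
    using dpsi c1 poly_map_continuous[OF poly_map_tangent[OF F]]
    by (auto simp: pd differentiable_def intro!: continuous_intros)
  moreover have rph: "real_polynomial_function (?h l)" for l
    by (intro real_polynomial_inner poly_map_area F g)
  ultimately have C: "C_order 1 (\<lambda>\<xi>. ?\<psi> \<xi> * ?h l \<xi>)" for l
    by (rule C_order_mult[OF _ real_polynomial_C_order])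
  have prod: "partial_deriv l (\<lambda>\<xi>. ?\<psi> \<xi> * ?h l \<xi>) =
     (\<lambda>\<xi>. (grad \<phi> (F \<xi>) \<bullet> tangent F l \<xi>) * ?h l \<xi> + ?\<psi> \<xi> * partial_deriv l (?h l) \<xi>)" for l
  proof -
    have "?\<psi> differentiable (at \<xi>)" for \<xi> using dpsi by (auto simp: differentiable_def)
    from partial_deriv_mult[OF this real_polynomial_differentiable[OF rph], of l l]
    show ?thesis unfolding pd .
  qed
  have int: "(\<lambda>\<xi>. h \<xi>) integrable_on unit_cube" if "continuous_on UNIV h" for h :: "real^3 \<Rightarrow> real"
    unfolding unit_cube_cbox using that by (intro integrable_continuous) (auto intro: continuous_on_subset)
  have ch: "continuous_on S (?h l)" "continuous_on S (partial_deriv l (?h l))" "continuous_on S (tangent F l)" for l S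
    using real_polynomial_continuous[OF rph] real_polynomial_continuous[OF real_polynomial_partial_deriv[OF rph]]
       poly_map_continuous[OF poly_map_tangent[OF F]] by auto
  have "flux F g \<phi> = (\<Sum>l\<in>UNIV. integral unit_cube (partial_deriv l (\<lambda>\<xi>. ?\<psi> \<xi> * ?h l \<xi>)))"
    unfolding flux_def face_flux_def
  proof (rule sum.cong[OF refl])
    fix l :: 3
    have sq: "(\<lambda>(s, t). ?\<psi> (fpt l c s t) * ?h l (fpt l c s t)) integrable_on square" for c
    proof -
      have "continuous_on square (\<lambda>x. fpt l c (fst x) (snd x))"
        by (intro continuous_intros)
      then show ?thesis
        by (intro integrable_continuous)
           (auto simp: split_beta intro!: continuous_intros continuous_on_compose2[OF c1(1)[of UNIV]]
               continuous_on_compose2[OF ch(1)[of UNIV]] continuous_on_compose2[OF cphi[of UNIV]] continuous_on_compose2[OF cF[of UNIV]]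
               poly_map_continuous[OF g, THEN continuous_on_compose2[where t = UNIV]]
               poly_map_continuous[OF poly_map_area[OF F], THEN continuous_on_compose2[where t = UNIV]])
    qed
    show "integral square (\<lambda>(s, t). ?\<psi> (fpt l 1 s t) * ?h l (fpt l 1 s t)) -
       integral square (\<lambda>(s, t). ?\<psi> (fpt l 0 s t) * ?h l (fpt l 0 s t)) =
       integral unit_cube (partial_deriv l (\<lambda>\<xi>. ?\<psi> \<xi> * ?h l \<xi>))"
      unfolding integral_unit_cube_partial_deriv[OF C]
      by (subst Henstock_Kurzweil_Integration.integral_diff[symmetric, OF sq sq]) (simp add: case_prod_unfold)
  qed
  also have "\<dots> = integral unit_cube (\<lambda>\<xi>. \<Sum>l\<in>UNIV. partial_deriv l (\<lambda>\<xi>. ?\<psi> \<xi> * ?h l \<xi>) \<xi>)"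
    unfolding prod
    by (rule integral_sum[symmetric]) (auto intro!: int continuous_intros c1 ch)
  also have "\<dots> = integral unit_cube (\<lambda>\<xi>. jdet F \<xi> * (g \<xi> \<bullet> grad \<phi> (F \<xi>)) + ?\<psi> \<xi> * fdiv F g \<xi>)"
    by (simp add: prod jdet_expansion[OF F] fdiv_def sum.distrib sum_distrib_left)
  also have "\<dots> = integral unit_cube (\<lambda>\<xi>. jdet F \<xi> * (g \<xi> \<bullet> grad \<phi> (F \<xi>))) +
         integral unit_cube (\<lambda>\<xi>. \<phi> (F \<xi>) * fdiv F g \<xi>)"
    by (intro Henstock_Kurzweil_Integration.integral_add int)
       (auto intro!: continuous_intros c1 poly_map_continuous[OF g]
          real_polynomial_continuous[OF jdet_polynomial[OF F]] real_polynomial_continuous[OF fdiv_polynomial[OF F g]])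
  finally show ?thesis by simp
qed

section \<open>Integrals over one element\<close>

definition hexmap :: "(real^3 \<Rightarrow> real^3) \<Rightarrow> bool" where
  "hexmap F \<longleftrightarrow> poly_map F \<and> inj_on F unit_cube \<and> (\<forall>\<xi>\<in>unit_cube. jdet F \<xi> \<noteq> 0)"

abbreviation open_cube :: "(real^3) set" where "open_cube \<equiv> box 0 (\<chi> i. 1)"

definition orient :: "(real^3 \<Rightarrow> real^3) \<Rightarrow> real" where
  "orient F = sgn (jdet F 0)"

lemma sgn_eq_of_connected:
  fixes f :: "'a::topological_space \<Rightarrow> real"
  assumes "connected S" "continuous_on S f" "\<And>x. x \<in> S \<Longrightarrow> f x \<noteq> 0" "x \<in> S" "y \<in> S"
  shows "sgn (f x) = sgn (f y)"
proof (rule ccontr)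
  assume "sgn (f x) \<noteq> sgn (f y)"
  moreover have "f x \<noteq> 0" "f y \<noteq> 0" using assms by auto
  ultimately have "(f x < 0 \<and> 0 < f y) \<or> (f y < 0 \<and> 0 < f x)" by (auto simp: sgn_if split: if_splits)
  moreover have "connected (f ` S)" using assms by (intro connected_continuous_image)
  ultimately have "0 \<in> f ` S"
    using assms(4,5) connected_contains_Icc[of "f ` S" "f x" "f y"] connected_contains_Icc[of "f ` S" "f y" "f x"]
    by (fastforce simp: subset_eq)
  then show False using assms(3) by auto
qed

lemma hexmap_poly: "hexmap F \<Longrightarrow> poly_map F" by (simp add: hexmap_def)

lemma hexmap_orient:
  assumes "hexmap F" "\<xi> \<in> unit_cube"
  shows "\<bar>jdet F \<xi>\<bar> = orient F * jdet F \<xi>"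
proof -
  have "sgn (jdet F \<xi>) = sgn (jdet F 0)"
  proof (rule sgn_eq_of_connected[of unit_cube "jdet F" \<xi> 0])
    show "connected unit_cube" unfolding unit_cube_cbox by (intro convex_connected convex_box)
    show "continuous_on unit_cube (jdet F)"
      using assms by (intro real_polynomial_continuous jdet_polynomial) (simp add: hexmap_def)
  qed (use assms in \<open>auto simp: hexmap_def\<close>)
  then show ?thesis by (simp add: orient_def abs_sgn mult.commute)
qed

lemma orient_cases: assumes "hexmap F" shows "orient F = 1 \<or> orient F = -1"
proof -
  have "0 \<in> unit_cube" by simp
  then have "jdet F 0 \<noteq> 0" using assms by (auto simp: hexmap_def)
  then show ?thesis by (auto simp: orient_def sgn_if)
qed

lemma compact_hex: "hexmap F \<Longrightarrow> compact (F ` unit_cube)"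
  unfolding unit_cube_cbox by (intro compact_continuous_image poly_map_continuous hexmap_poly compact_cbox)

lemma continuous_on_hex:
  assumes "hexmap F" "continuous_on unit_cube q" "\<And>\<xi>. \<xi> \<in> unit_cube \<Longrightarrow> f (F \<xi>) = q \<xi>"
  shows "continuous_on (F ` unit_cube) f"
proof -
  have inv: "\<forall>\<xi>\<in>unit_cube. inv_into unit_cube F (F \<xi>) = \<xi>"
    using assms(1) by (auto simp: hexmap_def)
  have c: "continuous_on (F ` unit_cube) (inv_into unit_cube F)"
    using inv by (intro continuous_on_inv poly_map_continuous hexmap_poly assms(1)) (simp_all only: unit_cube_cbox compact_cbox)
  have "continuous_on (F ` unit_cube) (\<lambda>x. q (inv_into unit_cube F x))"
  proof (rule continuous_on_compose2[OF assms(2) c])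
    show "inv_into unit_cube F ` F ` unit_cube \<subseteq> unit_cube"
    proof (rule image_subsetI)
      fix x assume "x \<in> F ` unit_cube"
      then obtain \<xi> where "\<xi> \<in> unit_cube" "x = F \<xi>" by blast
      then show "inv_into unit_cube F x \<in> unit_cube" using bspec[OF inv, of \<xi>] by (simp only:)
    qed
  qed
  then show ?thesis
    by (rule continuous_on_eq) (use inv assms(3) in auto)
qed

lemma integral_hex:
  assumes F: "hexmap F" and h: "continuous_on (F ` unit_cube) h"
  shows "integral (F ` unit_cube) h = orient F * integral unit_cube (\<lambda>\<xi>. jdet F \<xi> * h (F \<xi>))"
proof -
  have pF: "poly_map F" using F by (rule hexmap_poly)
  let ?F' = "\<lambda>\<xi> v. \<Sum>l\<in>UNIV. v$l *\<^sub>R tangent F l \<xi>"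
  have det: "det (matrix (?F' \<xi>)) = jdet F \<xi>" for \<xi>
    using frechet_derivative_at[OF poly_map_derivative[OF pF, of \<xi>]] by (simp add: jdet_def jacobian_def)
  let ?f = "\<lambda>x. vec (h x) :: real^1"
  have chF: "continuous_on unit_cube (\<lambda>\<xi>. h (F \<xi>))"
    using continuous_on_compose2[OF h poly_map_continuous[OF pF]] by auto
  have cj: "continuous_on unit_cube (jdet F)"
    using pF by (intro real_polynomial_continuous jdet_polynomial)
  have cdet: "continuous_on unit_cube (\<lambda>\<xi>. \<bar>jdet F \<xi>\<bar> *\<^sub>R ?f (F \<xi>))"
    using chF cj by (auto simp: vec_def intro!: continuous_intros continuous_on_vec_lambda)
  have ai: "(\<lambda>\<xi>. \<bar>jdet F \<xi>\<bar> *\<^sub>R ?f (F \<xi>)) absolutely_integrable_on unit_cube"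
    using cdet unfolding unit_cube_cbox by (rule absolutely_integrable_continuous)
  have "(\<lambda>\<xi>. \<bar>det (matrix (?F' \<xi>))\<bar> *\<^sub>R ?f (F \<xi>)) absolutely_integrable_on unit_cube \<and>
      integral unit_cube (\<lambda>\<xi>. \<bar>det (matrix (?F' \<xi>))\<bar> *\<^sub>R ?f (F \<xi>)) = integral unit_cube (\<lambda>\<xi>. \<bar>jdet F \<xi>\<bar> *\<^sub>R ?f (F \<xi>))
    \<longleftrightarrow> ?f absolutely_integrable_on F ` unit_cube \<and>
      integral (F ` unit_cube) ?f = integral unit_cube (\<lambda>\<xi>. \<bar>jdet F \<xi>\<bar> *\<^sub>R ?f (F \<xi>))"
    using F by (intro has_absolute_integral_change_of_variables_compact)
      (auto simp: hexmap_def unit_cube_cbox intro!: has_derivative_at_withinI poly_map_derivative)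
  then have "?f absolutely_integrable_on F ` unit_cube"
      "integral (F ` unit_cube) ?f = integral unit_cube (\<lambda>\<xi>. \<bar>jdet F \<xi>\<bar> *\<^sub>R ?f (F \<xi>))"
    unfolding det using ai by auto
  moreover have "integral (F ` unit_cube) ?f $ 1 = integral (F ` unit_cube) (\<lambda>x. ?f x $ 1)"
    using calculation(1) by (intro integral_component_eq_cart[symmetric] set_lebesgue_integral_eq_integral(1))
  moreover have "integral unit_cube (\<lambda>\<xi>. \<bar>jdet F \<xi>\<bar> *\<^sub>R ?f (F \<xi>)) $ 1 = integral unit_cube (\<lambda>\<xi>. (\<bar>jdet F \<xi>\<bar> *\<^sub>R ?f (F \<xi>)) $ 1)"
    using ai by (intro integral_component_eq_cart[symmetric] set_lebesgue_integral_eq_integral(1))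
  ultimately have "integral (F ` unit_cube) h = integral unit_cube (\<lambda>\<xi>. \<bar>jdet F \<xi>\<bar> * h (F \<xi>))"
    by simp
  also have "\<dots> = integral unit_cube (\<lambda>\<xi>. orient F * (jdet F \<xi> * h (F \<xi>)))"
    by (rule Henstock_Kurzweil_Integration.integral_cong) (simp add: hexmap_orient[OF F])
  finally show ?thesis by simp
qed

text \<open>Here \<open>f\<close> and \<open>d\<close> live on the hexahedron and \<open>g\<close> in local coordinates; the function \<open>d\<close> is the
  divergence of \<open>f\<close>. The orientation enters because the change of variables involves the absolute
  value of the determinant.\<close>
lemma element_integration_by_parts:
  assumes F: "hexmap F" and g: "poly_map g" and \<phi>: "C_order 1 \<phi>"
    and f: "\<And>\<xi>. \<xi> \<in> unit_cube \<Longrightarrow> f (F \<xi>) = g \<xi>"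
    and d: "\<And>\<xi>. \<xi> \<in> unit_cube \<Longrightarrow> d (F \<xi>) = fdiv F g \<xi> / jdet F \<xi>"
  shows "integral (F ` unit_cube) (\<lambda>x. f x \<bullet> grad \<phi> x) + integral (F ` unit_cube) (\<lambda>x. \<phi> x * d x)
    = orient F * flux F g \<phi>"
    and "continuous_on (F ` unit_cube) f" and "continuous_on (F ` unit_cube) d"
proof -
  have pF: "poly_map F" using F by (rule hexmap_poly)
  have nz: "\<xi> \<in> unit_cube \<Longrightarrow> jdet F \<xi> \<noteq> 0" for \<xi> using F by (auto simp: hexmap_def)
  show cf: "continuous_on (F ` unit_cube) f"
    using f by (rule continuous_on_hex[OF F poly_map_continuous[OF g]])
  have "continuous_on unit_cube (\<lambda>\<xi>. fdiv F g \<xi> / jdet F \<xi>)"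
    using nz by (intro continuous_on_divide real_polynomial_continuous fdiv_polynomial jdet_polynomial pF g) auto
  then show cd: "continuous_on (F ` unit_cube) d"
    using d by (rule continuous_on_hex[OF F])
  have cphi: "continuous_on S \<phi>" "continuous_on S (grad \<phi>)" for S
    using C_order_continuous[OF \<phi>] grad_continuous[of 0 \<phi>] \<phi> by (auto intro: continuous_on_subset)
  have "integral (F ` unit_cube) (\<lambda>x. f x \<bullet> grad \<phi> x) =
     orient F * integral unit_cube (\<lambda>\<xi>. jdet F \<xi> * (f (F \<xi>) \<bullet> grad \<phi> (F \<xi>)))"
    by (intro integral_hex[OF F] continuous_intros cf cphi)
  also have "integral unit_cube (\<lambda>\<xi>. jdet F \<xi> * (f (F \<xi>) \<bullet> grad \<phi> (F \<xi>))) =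
     integral unit_cube (\<lambda>\<xi>. jdet F \<xi> * (g \<xi> \<bullet> grad \<phi> (F \<xi>)))"
    by (intro Henstock_Kurzweil_Integration.integral_cong) (simp add: f)
  finally have 1: "integral (F ` unit_cube) (\<lambda>x. f x \<bullet> grad \<phi> x) = orient F * \<dots>" .
  have "integral (F ` unit_cube) (\<lambda>x. \<phi> x * d x) =
     orient F * integral unit_cube (\<lambda>\<xi>. jdet F \<xi> * (\<phi> (F \<xi>) * d (F \<xi>)))"
    by (intro integral_hex[OF F] continuous_intros cd cphi)
  also have "integral unit_cube (\<lambda>\<xi>. jdet F \<xi> * (\<phi> (F \<xi>) * d (F \<xi>))) =
     integral unit_cube (\<lambda>\<xi>. \<phi> (F \<xi>) * fdiv F g \<xi>)"
    by (intro Henstock_Kurzweil_Integration.integral_cong) (use nz d in simp)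
  finally have 2: "integral (F ` unit_cube) (\<lambda>x. \<phi> x * d x) = orient F * \<dots>" .
  show "integral (F ` unit_cube) (\<lambda>x. f x \<bullet> grad \<phi> x) + integral (F ` unit_cube) (\<lambda>x. \<phi> x * d x)
    = orient F * flux F g \<phi>"
    unfolding 1 2 cube_integration_by_parts[OF pF g \<phi>, symmetric] by (simp add: algebra_simps)
qed

lemma open_cube_subset: "open_cube \<subseteq> unit_cube"
  unfolding unit_cube_cbox by (rule box_subset_cbox)

lemma open_hex_interior:
  assumes "hexmap F" shows "open (F ` open_cube)"
proof (rule invariance_of_domain)
  show "inj_on F open_cube" using assms open_cube_subset by (auto simp: hexmap_def intro: inj_on_subset)
qed (use assms in \<open>auto intro: poly_map_continuous hexmap_poly\<close>)

lemma negligible_hex_boundary: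
  assumes "hexmap F" shows "negligible (F ` (unit_cube - open_cube))"
proof (rule negligible_differentiable_image_negligible)
  show "negligible (unit_cube - open_cube)"
    unfolding unit_cube_cbox by (rule negligible_frontier_interval)
  show "F differentiable_on (unit_cube - open_cube)"
    using poly_map_derivative[OF hexmap_poly[OF assms]]
    by (meson differentiable_at_imp_differentiable_on differentiable_def)
qed simp

lemma indicator_hex:
  fixes f :: "real^3 \<Rightarrow> 'b::euclidean_space"
  assumes F: "hexmap F" and f: "continuous_on (F ` unit_cube) f"
    and \<Omega>: "\<Omega> \<in> sets lebesgue" "F ` open_cube \<subseteq> \<Omega>"
  shows "integrable (lebesgue_on \<Omega>) (\<lambda>x. indicator (F ` open_cube) x *\<^sub>R f x)"
    and "(\<integral>x. indicator (F ` open_cube) x *\<^sub>R f x \<partial>lebesgue_on \<Omega>) = integral (F ` unit_cube) f"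
proof -
  let ?O = "F ` open_cube" and ?H = "F ` unit_cube"
  have OH: "?O \<subseteq> ?H" using open_cube_subset by auto
  have O: "?O \<in> sets lebesgue" using open_hex_interior[OF F] by (auto intro!: sets_completionI_sets borel_open)
  have "set_integrable lborel ?H f"
    unfolding set_integrable_def by (rule borel_integrable_compact[OF compact_hex[OF F] f])
  then have "set_integrable lebesgue ?H f"
    unfolding set_integrable_def using integrable_completion
    by (metis (no_types, lifting) borel_measurable_integrable measurable_lborel1)
  then have aiO: "f absolutely_integrable_on ?O"
    by (rule set_integrable_subset) (use O OH in auto)
  have e: "indicator \<Omega> x *\<^sub>R (indicator ?O x *\<^sub>R f x) = indicator ?O x *\<^sub>R f x" for x
    using \<Omega>(2) by (auto simp: indicator_def)
  show "integrable (lebesgue_on \<Omega>) (\<lambda>x. indicator ?O x *\<^sub>R f x)"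
    using aiO \<Omega>(1) by (subst integrable_restrict_space) (simp_all add: e set_integrable_def del: scaleR_scaleR)
  have "(\<integral>x. indicator ?O x *\<^sub>R f x \<partial>lebesgue_on \<Omega>) = (LINT x:?O|lebesgue. f x)"
    using \<Omega>(1) by (subst integral_restrict_space) (simp_all add: e set_lebesgue_integral_def del: scaleR_scaleR)
  also have "\<dots> = integral ?O f" using aiO by (rule set_lebesgue_integral_eq_integral(2))
  also have "\<dots> = integral ?H f"
  proof (rule integral_subset_negligible)
    have "?H - ?O \<subseteq> F ` (unit_cube - open_cube)" by auto
    then show "negligible (?H - ?O)" using negligible_hex_boundary[OF F] by (rule negligible_subset[rotated])
  qed (rule OH)
  finally show "(\<integral>x. indicator ?O x *\<^sub>R f x \<partial>lebesgue_on \<Omega>) = integral ?H f" .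
qed

section \<open>Convex planar quadrilaterals\<close>

definition quad :: "real^3 \<Rightarrow> real^3 \<Rightarrow> real^3 \<Rightarrow> real^3 \<Rightarrow> real \<Rightarrow> real \<Rightarrow> real^3" where
  "quad A B C D s t = ((1-s)*(1-t)) *\<^sub>R A + (s*(1-t)) *\<^sub>R B + (s*t) *\<^sub>R C + ((1-s)*t) *\<^sub>R D"

text \<open>The cross product of the two partial derivatives of \<open>quad\<close>.\<close>
definition quad_area :: "real^3 \<Rightarrow> real^3 \<Rightarrow> real^3 \<Rightarrow> real^3 \<Rightarrow> real \<Rightarrow> real \<Rightarrow> real^3" where
  "quad_area A B C D s t = ((1-t) *\<^sub>R (B-A) + t *\<^sub>R (C-D)) \<times> ((1-s) *\<^sub>R (D-A) + s *\<^sub>R (C-B))"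

text \<open>For a unit normal \<open>n\<close> of the plane of the triangle this is twice its signed area.\<close>
definition tri :: "real^3 \<Rightarrow> real^3 \<Rightarrow> real^3 \<Rightarrow> real^3 \<Rightarrow> real" where
  "tri n X Y Z = n \<bullet> ((Y - X) \<times> (Z - X))"

definition convex_quad :: "real^3 \<Rightarrow> real^3 \<Rightarrow> real^3 \<Rightarrow> real^3 \<Rightarrow> real^3 \<Rightarrow> bool" where
  "convex_quad n A B C D \<longleftrightarrow> tri n A B C > 0 \<and> tri n B C D > 0 \<and> tri n C D A > 0 \<and> tri n D A B > 0"

lemma tri_rotate: "tri n Y Z X = tri n X Y Z" and tri_swap: "tri n Y X Z = - tri n X Y Z"
  by (simp_all add: tri_def cross3_simps inner_vec_def sum_3 algebra_simps)

lemma tri_degenerate: "tri n X X Z = 0" "tri n X Y X = 0" "tri n X Y Y = 0"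
  by (simp_all add: tri_def cross3_simps inner_vec_def sum_3 algebra_simps)

lemma convex_quad_rotate: "convex_quad n A B C D \<Longrightarrow> convex_quad n B C D A"
  by (auto simp: convex_quad_def)

lemma tri_affine:
  assumes "u + v + w = 1"
  shows "tri n X Y (u *\<^sub>R P + v *\<^sub>R Q + w *\<^sub>R R) = u * tri n X Y P + v * tri n X Y Q + w * tri n X Y R"
proof -
  have w: "w = 1 - u - v" using assms by simp
  show ?thesis unfolding w by (simp add: tri_def cross3_simps inner_vec_def sum_3 algebra_simps)
qed

text \<open>The affine function \<open>X \<mapsto> tri n A B X\<close> vanishes at \<open>A\<close> and \<open>B\<close> and is positive at the other two
  corners, so a convex combination of \<open>B\<close>, \<open>C\<close>, \<open>D\<close> that equals \<open>A\<close> could only involve \<open>B\<close>.\<close>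
lemma convex_quad_corner_extreme:
  assumes "convex_quad n A B C D"
  shows "A extreme_point_of (convex hull {A, B, C, D})"
proof -
  have "A \<notin> convex hull {B, C, D}"
  proof
    assume "A \<in> convex hull {B, C, D}"
    then obtain u v w where uvw: "0 \<le> u" "0 \<le> v" "0 \<le> w" "u + v + w = 1" "A = u *\<^sub>R B + v *\<^sub>R C + w *\<^sub>R D"
      by (auto simp: convex_hull_3)
    have "u * tri n A B B + v * tri n A B C + w * tri n A B D = tri n A B (u *\<^sub>R B + v *\<^sub>R C + w *\<^sub>R D)"
      using uvw(4) by (rule tri_affine[symmetric])
    also have "\<dots> = 0" unfolding uvw(5)[symmetric] by (simp add: tri_degenerate)
    finally have "v * tri n A B C + w * tri n A B D = 0" by (simp add: tri_degenerate)
    moreover have "tri n A B C > 0" "tri n A B D > 0"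
      using assms tri_rotate[of n A B D] by (auto simp: convex_quad_def)
    ultimately have "v = 0" "w = 0" using uvw(2,3)
      by (smt (verit) mult_nonneg_nonneg mult_pos_pos)+
    with uvw have "A = B" by simp
    with assms show False by (simp add: convex_quad_def tri_degenerate)
  qed
  then show ?thesis using extreme_point_of_convex_hull_insert[of "{B, C, D}" A] by simp
qed

lemma convex_quad_extreme_points:
  assumes "convex_quad n A B C D"
  shows "{x. x extreme_point_of (convex hull {A, B, C, D})} = {A, B, C, D}"
proof -
  note c = assms convex_quad_rotate[OF assms] convex_quad_rotate[OF convex_quad_rotate[OF assms]]
    convex_quad_rotate[OF convex_quad_rotate[OF convex_quad_rotate[OF assms]]]
  have "{B, C, D, A} = {A, B, C, D}" "{C, D, A, B} = {A, B, C, D}" "{D, A, B, C} = {A, B, C, D}" by auto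
  then have "x extreme_point_of (convex hull {A, B, C, D})" if "x \<in> {A, B, C, D}" for x
    using that c[THEN convex_quad_corner_extreme] by auto
  moreover have "x \<in> {A, B, C, D}" if "x extreme_point_of (convex hull {A, B, C, D})" for x
    using extreme_point_of_convex_hull[OF that] .
  ultimately show ?thesis by blast
qed

lemma quad_corners: "quad A B C D 0 0 = A" "quad A B C D 1 0 = B" "quad A B C D 1 1 = C" "quad A B C D 0 1 = D"
  by (simp_all add: quad_def)

lemma quad_convex_hull:
  "convex hull {quad A B C D s t | s t. s \<in> {0..1} \<and> t \<in> {0..1}} = convex hull {A, B, C, D}" (is "convex hull ?S = _")
proof (rule antisym)
  have "quad A B C D s t \<in> convex hull {A, B, C, D}" if "s \<in> {0..1}" "t \<in> {0..1}" for s t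
  proof -
    have e: "quad A B C D s t = (1-t) *\<^sub>R ((1-s) *\<^sub>R A + s *\<^sub>R B) + t *\<^sub>R ((1-s) *\<^sub>R D + s *\<^sub>R C)"
      by (simp add: quad_def algebra_simps scaleR_add_right)
    have c: "convex (convex hull {A, B, C, D})" by simp
    have "(1-s) *\<^sub>R A + s *\<^sub>R B \<in> convex hull {A, B, C, D}" "(1-s) *\<^sub>R D + s *\<^sub>R C \<in> convex hull {A, B, C, D}"
      by (rule convexD[OF c]; use that in \<open>simp add: hull_inc\<close>)+
    then show ?thesis unfolding e by (rule convexD[OF c]) (use that in auto)
  qed
  then show "convex hull ?S \<subseteq> convex hull {A, B, C, D}" by (intro hull_minimal) auto
  have "{A, B, C, D} \<subseteq> ?S"
  proof -
    have "quad A B C D 0 0 \<in> ?S" "quad A B C D 1 0 \<in> ?S" "quad A B C D 1 1 \<in> ?S" "quad A B C D 0 1 \<in> ?S"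
      by force+
    then show ?thesis by (simp add: quad_corners)
  qed
  then show "convex hull {A, B, C, D} \<subseteq> convex hull ?S" by (rule hull_mono)
qed

text \<open>Among the 24 ways to list four corners, only the eight symmetries of the square give all four
  turns the same orientation: in any other order two consecutive turns run against each other. The
  scalar \<open>e\<close> allows for normals of opposite direction.\<close>
lemma convex_quad_symmetry:
  fixes K K' :: "bool \<Rightarrow> bool \<Rightarrow> real^3"
  assumes K: "convex_quad n (K False False) (K True False) (K True True) (K False True)"
    and K': "convex_quad (e *\<^sub>R n) (K' False False) (K' True False) (K' True True) (K' False True)"
    and eq: "{K False False, K True False, K True True, K False True} =
             {K' False False, K' True False, K' True True, K' False True}"
  shows "(\<exists>a b. \<forall>x y. K x y = K' (x \<noteq> a) (y \<noteq> b)) \<or> (\<exists>a b. \<forall>x y. K x y = K' (y \<noteq> b) (x \<noteq> a))"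
proof -
  define A B C D where "A = K False False" "B = K True False" "C = K True True" "D = K False True"
  define A' B' C' D' where "A' = K' False False" "B' = K' True False" "C' = K' True True" "D' = K' False True"
  note defs = A_B_C_D_def A'_B'_C'_D'_def
  have e: "tri (e *\<^sub>R n) X Y Z = e * tri n X Y Z" for X Y Z by (simp add: tri_def)
  have pos: "tri n A' B' C' > 0" "tri n B' C' D' > 0" "tri n C' D' A' > 0" "tri n D' A' B' > 0"
    if "e > 0" using K' that by (auto simp: convex_quad_def e defs zero_less_mult_iff)
  have neg: "tri n A' B' C' < 0" "tri n B' C' D' < 0" "tri n C' D' A' < 0" "tri n D' A' B' < 0"
    if "e < 0" using K' that by (auto simp: convex_quad_def e defs zero_less_mult_iff)
  have "e \<noteq> 0" using K' by (auto simp: convex_quad_def e)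
  have c: "tri n A B C > 0" "tri n B C D > 0" "tri n C D A > 0" "tri n D A B > 0"
    using K by (auto simp: convex_quad_def defs)
  then have r: "tri n B C A > 0" "tri n C D B > 0" "tri n D A C > 0" "tri n A B D > 0"
     "tri n C A B > 0" "tri n D B C > 0" "tri n A C D > 0" "tri n B D A > 0"
    by (metis tri_rotate)+
  have s: "tri n B A C < 0" "tri n C B D < 0" "tri n D C A < 0" "tri n A D B < 0"
     "tri n C B A < 0" "tri n D C B < 0" "tri n A D C < 0" "tri n B A D < 0"
     "tri n A C B < 0" "tri n B D C < 0" "tri n C A D < 0" "tri n D B A < 0"
    using c r tri_swap by (metis neg_less_0_iff_less)+
  have dist: "A \<noteq> B" "A \<noteq> C" "A \<noteq> D" "B \<noteq> C" "B \<noteq> D" "C \<noteq> D"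
    using c by (auto simp: tri_degenerate)
  have set: "{A, B, C, D} = {A', B', C', D'}" using eq by (simp only: defs)
  then have in': "A' \<in> {A, B, C, D}" "B' \<in> {A, B, C, D}" "C' \<in> {A, B, C, D}" "D' \<in> {A, B, C, D}" by auto
  have dist': "A' \<noteq> B'" "A' \<noteq> C'" "A' \<noteq> D'" "B' \<noteq> C'" "B' \<noteq> D'" "C' \<noteq> D'"
    using K' by (auto simp: convex_quad_def defs tri_degenerate)
  note signs = c r s c[THEN less_not_sym] r[THEN less_not_sym] s[THEN less_not_sym]
  have cases: "(A = A' \<and> C = C' \<and> ((B = B' \<and> D = D') \<or> (B = D' \<and> D = B'))) \<or>
        (A = C' \<and> C = A' \<and> ((B = B' \<and> D = D') \<or> (B = D' \<and> D = B'))) \<or>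
        (A = B' \<and> C = D' \<and> ((B = C' \<and> D = A') \<or> (B = A' \<and> D = C'))) \<or>
        (A = D' \<and> C = B' \<and> ((B = C' \<and> D = A') \<or> (B = A' \<and> D = C')))"
  proof -
    have perms: "(A' = A \<and> B' = B \<and> C' = C \<and> D' = D) \<or>
      (A' = A \<and> B' = B \<and> C' = D \<and> D' = C) \<or>
      (A' = A \<and> B' = C \<and> C' = B \<and> D' = D) \<or>
      (A' = A \<and> B' = C \<and> C' = D \<and> D' = B) \<or>
      (A' = A \<and> B' = D \<and> C' = B \<and> D' = C) \<or>
      (A' = A \<and> B' = D \<and> C' = C \<and> D' = B) \<or>
      (A' = B \<and> B' = A \<and> C' = C \<and> D' = D) \<or>
      (A' = B \<and> B' = A \<and> C' = D \<and> D' = C) \<or>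
      (A' = B \<and> B' = C \<and> C' = A \<and> D' = D) \<or>
      (A' = B \<and> B' = C \<and> C' = D \<and> D' = A) \<or>
      (A' = B \<and> B' = D \<and> C' = A \<and> D' = C) \<or>
      (A' = B \<and> B' = D \<and> C' = C \<and> D' = A) \<or>
      (A' = C \<and> B' = A \<and> C' = B \<and> D' = D) \<or>
      (A' = C \<and> B' = A \<and> C' = D \<and> D' = B) \<or>
      (A' = C \<and> B' = B \<and> C' = A \<and> D' = D) \<or>
      (A' = C \<and> B' = B \<and> C' = D \<and> D' = A) \<or>
      (A' = C \<and> B' = D \<and> C' = A \<and> D' = B) \<or>
      (A' = C \<and> B' = D \<and> C' = B \<and> D' = A) \<or>
      (A' = D \<and> B' = A \<and> C' = B \<and> D' = C) \<or>
      (A' = D \<and> B' = A \<and> C' = C \<and> D' = B) \<or>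
      (A' = D \<and> B' = B \<and> C' = A \<and> D' = C) \<or>
      (A' = D \<and> B' = B \<and> C' = C \<and> D' = A) \<or>
      (A' = D \<and> B' = C \<and> C' = A \<and> D' = B) \<or>
      (A' = D \<and> B' = C \<and> C' = B \<and> D' = A)"
      using in' dist' by (elim insertE emptyE) simp_all
    then show ?thesis
    proof (cases "e > 0")
      case True
      show ?thesis
        using perms pos[OF True] signs by (elim disjE conjE) simp_all
    next
      case False
      with \<open>e \<noteq> 0\<close> have "e < 0" by simp
      show ?thesis
        using perms neg[OF \<open>e < 0\<close>] signs by (elim disjE conjE) simp_all
    qed
  qed
  have all: "(\<forall>x y. P x y) \<longleftrightarrow> P False False \<and> P True False \<and> P True True \<and> P False True" for P :: "bool \<Rightarrow> bool \<Rightarrow> bool"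
    by (metis (full_types))
  show ?thesis
    using cases unfolding ex_bool_eq all defs by (auto simp only: simp_thms)
qed

section \<open>Faces of trilinear hexahedra\<close>

definition upd :: "real^3 \<Rightarrow> 3 \<Rightarrow> real \<Rightarrow> real^3" where
  "upd \<xi> m r = (\<chi> j. if j = m then r else \<xi> $ j)"

definition trilinear :: "(real^3 \<Rightarrow> real^3) \<Rightarrow> bool" where
  "trilinear F \<longleftrightarrow> (\<forall>\<xi> m r. F (upd \<xi> m r) = (1 - r) *\<^sub>R F (upd \<xi> m 0) + r *\<^sub>R F (upd \<xi> m 1))"

definition local_face :: "3 \<Rightarrow> real \<Rightarrow> (real^3) set" where
  "local_face l c = {\<xi> \<in> unit_cube. \<xi> $ l = c}"

lemma chart_upd:
  assumes "i \<noteq> l" "j \<noteq> l" "j \<noteq> i"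
  shows "chart l c i a b s t = upd (chart l c i a b s' t) i (if a then 1 - s else s)"
    and "chart l c i a b s t = upd (chart l c i a b s t') j (if b then 1 - t else t)"
proof -
  have "m = l \<or> m = i \<or> m = j" for m
    using assms by (cases m rule: three_cases; cases l rule: three_cases; cases i rule: three_cases; cases j rule: three_cases) simp_all
  then show "chart l c i a b s t = upd (chart l c i a b s' t) i (if a then 1 - s else s)"
    "chart l c i a b s t = upd (chart l c i a b s t') j (if b then 1 - t else t)"
    using assms by (auto simp: chart_def upd_def vec_eq_iff)
qed

lemma third_axis: assumes "i \<noteq> (l::3)" obtains j where "j \<noteq> l" "j \<noteq> i"
  using assms that[of 1] that[of 2] that[of 3]
  by (cases l rule: three_cases; cases i rule: three_cases) simp_all

text \<open>On a face a trilinear map is affine in each of the two remaining coordinates, hence it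
  interpolates the corners bilinearly.\<close>
lemma trilinear_chart:
  assumes "trilinear F" "i \<noteq> l"
  shows "F (chart l c i a b s t) = quad (F (chart l c i a b 0 0)) (F (chart l c i a b 1 0))
           (F (chart l c i a b 1 1)) (F (chart l c i a b 0 1)) s t"
proof -
  obtain j where j: "j \<noteq> l" "j \<noteq> i" using third_axis[OF assms(2)] .
  let ?G = "\<lambda>s t. F (chart l c i a b s t)"
  have flip: "F (upd \<xi> m (if a then 1 - r else r)) = (1 - r) *\<^sub>R F (upd \<xi> m (if a then 1 - 0 else 0)) + r *\<^sub>R F (upd \<xi> m (if a then 1 - 1 else 1))"
    for \<xi> m a r
    using assms(1)[unfolded trilinear_def, rule_format, of \<xi> m "if a then 1 - r else r"]
    by (cases a) (auto simp: algebra_simps)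
  have s: "?G s t = (1 - s) *\<^sub>R ?G 0 t + s *\<^sub>R ?G 1 t" for s t
    using flip[of "chart l c i a b 0 t" i a s]
    unfolding chart_upd(1)[OF assms(2) j, of c a b _ t 0, symmetric] .
  have t: "?G s t = (1 - t) *\<^sub>R ?G s 0 + t *\<^sub>R ?G s 1" for s t
    using flip[of "chart l c i a b s 0" j b t]
    unfolding chart_upd(2)[OF assms(2) j, of c a b s _ 0, symmetric] .
  have "?G s t = (1 - s) *\<^sub>R ((1 - t) *\<^sub>R ?G 0 0 + t *\<^sub>R ?G 0 1) + s *\<^sub>R ((1 - t) *\<^sub>R ?G 1 0 + t *\<^sub>R ?G 1 1)"
    by (simp only: s[of s t] t[of 0 t] t[of 1 t])
  moreover have "(1 - s) *\<^sub>R ((1 - t) *\<^sub>R A + t *\<^sub>R D) + s *\<^sub>R ((1 - t) *\<^sub>R B + t *\<^sub>R C) = quad A B C D s t"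
    for A B C D by (simp add: quad_def algebra_simps)
  ultimately show ?thesis by (simp only:)
qed

lemma chart_in_face:
  assumes "i \<noteq> l" "c \<in> {0, 1}" "s \<in> {0..1}" "t \<in> {0..1}"
  shows "chart l c i a b s t \<in> local_face l c"
  using assms by (auto simp: local_face_def chart_def)

lemma local_face_fpt:
  assumes "c \<in> {0, 1}"
  shows "local_face l c = {fpt l c s t | s t. s \<in> {0..1} \<and> t \<in> {0..1}}"
proof
  show "{fpt l c s t | s t. s \<in> {0..1} \<and> t \<in> {0..1}} \<subseteq> local_face l c"
    using chart_in_face[OF axis_fpt_3(1) assms] by blast
  show "local_face l c \<subseteq> {fpt l c s t | s t. s \<in> {0..1} \<and> t \<in> {0..1}}"
  proof
    fix \<xi> assume "\<xi> \<in> local_face l c"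
    then have \<xi>: "\<And>m. 0 \<le> \<xi> $ m \<and> \<xi> $ m \<le> 1" "\<xi> $ l = c" by (auto simp: local_face_def)
    have "\<forall>m. \<xi> $ m = fpt l c (\<xi> $ (l+1)) (\<xi> $ (l+2)) $ m"
      by (subst forall_axis[of _ l]) (simp only: fpt_nth \<xi>)
    then have "\<xi> = fpt l c (\<xi> $ (l+1)) (\<xi> $ (l+2))" unfolding vec_eq_iff .
    then show "\<xi> \<in> {fpt l c s t | s t. s \<in> {0..1} \<and> t \<in> {0..1}}"
      by (intro CollectI exI[of _ "\<xi> $ (l+1)"] exI[of _ "\<xi> $ (l+2)"] conjI) (assumption, simp_all only: atLeastAtMost_iff \<xi>)
  qed
qed

lemma chart_fpt:
  "chart l c (l + 1) a b s t = fpt l c (if a then 1 - s else s) (if b then 1 - t else t)"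
  "chart l c (l + 2) a b s t = fpt l c (if b then 1 - t else t) (if a then 1 - s else s)"
  using axis_fpt_3(1-3)[of l]
  by (simp_all only: vec_eq_iff) (subst forall_axis[of _ l], force simp: chart_def)+

lemma area_fpt:
  assumes F: "poly_map F" "trilinear F"
  shows "area F l (fpt l c s t) =
    quad_area (F (fpt l c 0 0)) (F (fpt l c 1 0)) (F (fpt l c 1 1)) (F (fpt l c 0 1)) s t"
proof -
  let ?Q = "quad (F (fpt l c 0 0)) (F (fpt l c 1 0)) (F (fpt l c 1 1)) (F (fpt l c 0 1))"
  let ?A = "F (fpt l c 0 0)" and ?B = "F (fpt l c 1 0)" and ?C = "F (fpt l c 1 1)" and ?D = "F (fpt l c 0 1)"
  have Q: "F (fpt l c s t) = ?Q s t" for s t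
    by (rule trilinear_chart[OF F(2)]) (rule axis_fpt_3)
  have T: "(\<Sum>k\<in>UNIV. (h *\<^sub>R axis m 1 :: real^3) $ k *\<^sub>R tangent F k \<xi>) = h *\<^sub>R tangent F m \<xi>" for h m \<xi>
    by (simp add: axis_def if_distrib[of "\<lambda>c. _ * c"] if_distrib[of "\<lambda>c. c *\<^sub>R _"] cong: if_cong)
  have f1: "fpt l c x t = fpt l c 0 t + x *\<^sub>R axis (l+1) 1" for x
    using axis_fpt_3(1-3)[of l]
    by (simp only: vec_eq_iff) (subst forall_axis[of _ l], force simp: chart_def axis_def)
  have f2: "fpt l c s x = fpt l c s 0 + x *\<^sub>R axis (l+2) 1" for x
    using axis_fpt_3(1-3)[of l]
    by (simp only: vec_eq_iff) (subst forall_axis[of _ l], force simp: chart_def axis_def)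
  have "((\<lambda>x. fpt l c 0 t + x *\<^sub>R axis (l+1) 1) has_derivative (\<lambda>h. h *\<^sub>R axis (l+1) 1)) (at s)"
    by (auto intro!: derivative_eq_intros)
  from has_derivative_compose[OF this poly_map_derivative[OF F(1)]]
  have d1: "((\<lambda>x. F (fpt l c x t)) has_derivative (\<lambda>h. h *\<^sub>R tangent F (l+1) (fpt l c s t))) (at s)"
    unfolding T f1[symmetric] .
  have "((\<lambda>x. fpt l c s 0 + x *\<^sub>R axis (l+2) 1) has_derivative (\<lambda>h. h *\<^sub>R axis (l+2) 1)) (at t)"
    by (auto intro!: derivative_eq_intros)
  from has_derivative_compose[OF this poly_map_derivative[OF F(1)]]
  have d2: "((\<lambda>x. F (fpt l c s x)) has_derivative (\<lambda>h. h *\<^sub>R tangent F (l+2) (fpt l c s t))) (at t)"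
    unfolding T f2[symmetric] .
  have "((\<lambda>x. ?Q x t) has_derivative (\<lambda>h. h *\<^sub>R ((1-t) *\<^sub>R (?B-?A) + t *\<^sub>R (?C-?D)))) (at s)"
    unfolding quad_def by (auto intro!: derivative_eq_intros simp: algebra_simps)
  then have "((\<lambda>x. F (fpt l c x t)) has_derivative (\<lambda>h. h *\<^sub>R ((1-t) *\<^sub>R (?B-?A) + t *\<^sub>R (?C-?D)))) (at s)"
    by (subst ext[of "\<lambda>x. F (fpt l c x t)" "\<lambda>x. ?Q x t", OF Q])
  with d1 have "(\<lambda>h. h *\<^sub>R tangent F (l+1) (fpt l c s t)) = (\<lambda>h. h *\<^sub>R ((1-t) *\<^sub>R (?B-?A) + t *\<^sub>R (?C-?D)))"
    by (rule has_derivative_unique)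
  from fun_cong[OF this, of 1] have t1: "tangent F (l+1) (fpt l c s t) = (1-t) *\<^sub>R (?B-?A) + t *\<^sub>R (?C-?D)" by simp
  have "((\<lambda>x. ?Q s x) has_derivative (\<lambda>h. h *\<^sub>R ((1-s) *\<^sub>R (?D-?A) + s *\<^sub>R (?C-?B)))) (at t)"
    unfolding quad_def by (auto intro!: derivative_eq_intros simp: algebra_simps)
  then have "((\<lambda>x. F (fpt l c s x)) has_derivative (\<lambda>h. h *\<^sub>R ((1-s) *\<^sub>R (?D-?A) + s *\<^sub>R (?C-?B)))) (at t)"
    by (subst ext[of "\<lambda>x. F (fpt l c s x)" "\<lambda>x. ?Q s x", OF Q])
  with d2 have "(\<lambda>h. h *\<^sub>R tangent F (l+2) (fpt l c s t)) = (\<lambda>h. h *\<^sub>R ((1-s) *\<^sub>R (?D-?A) + s *\<^sub>R (?C-?B)))"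
    by (rule has_derivative_unique)
  from fun_cong[OF this, of 1] have t2: "tangent F (l+2) (fpt l c s t) = (1-s) *\<^sub>R (?D-?A) + s *\<^sub>R (?C-?B)" by simp
  show ?thesis by (simp add: area_def quad_area_def t1 t2)
qed

lemma orthogonal_cross_parallel:
  fixes n X Y :: "real^3"
  assumes "norm n = 1" "n \<bullet> X = 0" "n \<bullet> Y = 0"
  shows "X \<times> Y = (n \<bullet> (X \<times> Y)) *\<^sub>R n"
proof -
  have "n \<bullet> n = 1" using assms(1) by (simp add: norm_eq_1)
  moreover have "n \<times> (n \<times> (X \<times> Y)) = 0" using assms by (simp add: Lagrange[of n X Y])
  ultimately show ?thesis by (simp add: Lagrange[of n n])
qed

lemma quad_area_normal:
  assumes "norm n = 1" "n \<bullet> (B - A) = 0" "n \<bullet> (C - B) = 0" "n \<bullet> (D - A) = 0"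
  shows "quad_area A B C D s t = (n \<bullet> quad_area A B C D s t) *\<^sub>R n"
proof -
  have "n \<bullet> (C - D) = 0" using assms by (simp add: inner_diff_right)
  then show ?thesis unfolding quad_area_def
    using assms by (intro orthogonal_cross_parallel) (simp_all add: inner_add_right)
qed

text \<open>The face is planar, so its area vector is a multiple of the normal; the factor cannot change its
  sign since a zero of it would be a zero of the Jacobian determinant.\<close>
lemma face_area:
  assumes F: "hexmap F" "trilinear F" and c: "c \<in> {0, 1}"
    and n: "norm n = 1" "orthogonal_to_set n (F ` local_face l c)"
    and st: "s \<in> {0..1}" "t \<in> {0..1}"
  shows "area F l (fpt l c s t) = (n \<bullet> area F l (fpt l c s t)) *\<^sub>R n"
    and "n \<bullet> area F l (fpt l c s t) \<noteq> 0"
    and "sgn (n \<bullet> area F l (fpt l c s t)) = sgn (n \<bullet> area F l (fpt l c 0 0))"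
proof -
  have pF: "poly_map F" using F(1) by (rule hexmap_poly)
  have "F (fpt l c s t) \<in> F ` local_face l c" if "s \<in> {0..1}" "t \<in> {0..1}" for s t
    using chart_in_face[OF axis_fpt_3(1) c that] by blast
  then have o: "n \<bullet> (F (fpt l c s t) - F (fpt l c s' t')) = 0"
    if "s \<in> {0..1}" "t \<in> {0..1}" "s' \<in> {0..1}" "t' \<in> {0..1}" for s t s' t'
    using n(2) that unfolding orthogonal_to_set_def by blast
  have 1: "area F l (fpt l c s t) = (n \<bullet> area F l (fpt l c s t)) *\<^sub>R n" for s t
    unfolding area_fpt[OF pF F(2)] by (intro quad_area_normal n(1) o) auto
  then show "area F l (fpt l c s t) = (n \<bullet> area F l (fpt l c s t)) *\<^sub>R n" .
  have 2: "n \<bullet> area F l (fpt l c s t) \<noteq> 0" if "s \<in> {0..1}" "t \<in> {0..1}" for s t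
  proof
    assume "n \<bullet> area F l (fpt l c s t) = 0"
    with 1[of s t] have "area F l (fpt l c s t) = 0" by simp
    then have "jdet F (fpt l c s t) = 0" using jdet_tangent_area[OF pF, of _ l] by simp
    moreover have "fpt l c s t \<in> unit_cube"
      using chart_in_face[OF axis_fpt_3(1) c that] unfolding local_face_def by blast
    ultimately show False using F(1) unfolding hexmap_def by blast
  qed
  then show "n \<bullet> area F l (fpt l c s t) \<noteq> 0" using st .
  let ?f = "\<lambda>x. n \<bullet> area F l (fpt l c (fst x) (snd x))"
  have "sgn (?f (s, t)) = sgn (?f (0, 0))"
  proof (rule sgn_eq_of_connected[of square])
    show "connected square" by (intro convex_connected convex_box)
    show "continuous_on square ?f"
      by (intro continuous_intros poly_map_continuous[OF poly_map_area[OF pF], THEN continuous_on_compose2[where t = UNIV]]) auto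
  qed (use 2 st in \<open>auto simp: cbox_Pair_eq\<close>)
  then show "sgn (n \<bullet> area F l (fpt l c s t)) = sgn (n \<bullet> area F l (fpt l c 0 0))" by simp
qed

lemma quad_area_corners:
  "n \<bullet> quad_area A B C D 0 0 = tri n D A B" "n \<bullet> quad_area A B C D 1 0 = tri n A B C"
  "n \<bullet> quad_area A B C D 1 1 = tri n B C D" "n \<bullet> quad_area A B C D 0 1 = tri n C D A"
  by (simp_all add: quad_area_def tri_def cross3_simps inner_vec_def sum_3 algebra_simps)

lemma tri_scaleR: "tri (e *\<^sub>R n) X Y Z = e * tri n X Y Z"
  by (simp add: tri_def)

lemma face_convex_quad:
  assumes F: "hexmap F" "trilinear F" and c: "c \<in> {0, 1}"
    and n: "norm n = 1" "orthogonal_to_set n (F ` local_face l c)"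
  shows "convex_quad (sgn (n \<bullet> area F l (fpt l c 0 0)) *\<^sub>R n)
     (F (fpt l c 0 0)) (F (fpt l c 1 0)) (F (fpt l c 1 1)) (F (fpt l c 0 1))"
proof -
  let ?e = "sgn (n \<bullet> area F l (fpt l c 0 0))"
  have pF: "poly_map F" using F(1) by (rule hexmap_poly)
  have pos: "?e * (n \<bullet> area F l (fpt l c s t)) > 0" if "s \<in> {0..1}" "t \<in> {0..1}" for s t
    using face_area[OF F c n that] by (metis abs_sgn mult.commute zero_less_abs_iff)
  show ?thesis
    using pos[of 0 0] pos[of 1 0] pos[of 1 1] pos[of 0 1]
    unfolding area_fpt[OF pF F(2), of l c 0 0] area_fpt[OF pF F(2), of l c 1 0]
      area_fpt[OF pF F(2), of l c 1 1] area_fpt[OF pF F(2), of l c 0 1] convex_quad_def quad_area_corners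
    by (simp add: tri_scaleR)
qed

lemma trilinear_face_hull:
  assumes "trilinear F" "c \<in> {0, 1}"
  shows "convex hull (F ` local_face l c) =
     convex hull {F (fpt l c 0 0), F (fpt l c 1 0), F (fpt l c 1 1), F (fpt l c 0 1)}"
proof -
  have "F ` local_face l c = {quad (F (fpt l c 0 0)) (F (fpt l c 1 0)) (F (fpt l c 1 1)) (F (fpt l c 0 1)) s t | s t.
     s \<in> {0..1} \<and> t \<in> {0..1}}"
    unfolding local_face_fpt[OF assms(2)] trilinear_chart[OF assms(1) axis_fpt_3(1), of l c False False _ _, symmetric]
    by blast
  then show ?thesis by (simp only: quad_convex_hull)
qed

text \<open>Two elements with a common face parametrize it in the same way, up to a symmetry of the square,
  because a bilinear map is determined by its corners and the corners are the extreme points of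
  the convex hull of the face.\<close>
lemma face_matching:
  assumes F: "hexmap F" "trilinear F" and c: "c \<in> {0, 1}"
    and F': "hexmap F'" "trilinear F'" and c': "c' \<in> {0, 1}"
    and n: "norm n = 1" "orthogonal_to_set n S"
    and S: "S = F ` local_face l c" "S = F' ` local_face l' c'"
  obtains i a b where "i \<noteq> l'" "\<And>s t. F' (chart l' c' i a b s t) = F (fpt l c s t)"
proof -
  define K where "K = (\<lambda>x y. F (fpt l c (of_bool x) (of_bool y)))"
  define K' where "K' = (\<lambda>x y. F' (fpt l' c' (of_bool x) (of_bool y)))"
  define e where "e = sgn (n \<bullet> area F l (fpt l c 0 0))"
  define e' where "e' = sgn (n \<bullet> area F' l' (fpt l' c' 0 0))"
  have nS: "orthogonal_to_set n (F ` local_face l c)" "orthogonal_to_set n (F' ` local_face l' c')"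
    using n(2) S by (simp_all only:)
  have q: "convex_quad (e *\<^sub>R n) (K False False) (K True False) (K True True) (K False True)"
    using face_convex_quad[OF F c n(1) nS(1)] unfolding K_def e_def of_bool_eq .
  have q': "convex_quad (e' *\<^sub>R n) (K' False False) (K' True False) (K' True True) (K' False True)"
    using face_convex_quad[OF F' c' n(1) nS(2)] unfolding K'_def e'_def of_bool_eq .
  have "e \<noteq> 0" using q by (auto simp: convex_quad_def tri_def)
  then have "e * e = 1" by (auto simp: e_def sgn_if split: if_splits)
  then have en: "e' *\<^sub>R n = (e' * e) *\<^sub>R (e *\<^sub>R n)" by (simp add: mult.assoc)
  have q'': "convex_quad ((e' * e) *\<^sub>R (e *\<^sub>R n)) (K' False False) (K' True False) (K' True True) (K' False True)"
    using q' by (simp only: en)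
  have hull: "convex hull {K False False, K True False, K True True, K False True} =
     convex hull {K' False False, K' True False, K' True True, K' False True}"
    using trilinear_face_hull[OF F(2) c, of l] trilinear_face_hull[OF F'(2) c', of l']
    unfolding K_def K'_def of_bool_eq S(1)[symmetric] S(2)[symmetric] by simp
  have "{K False False, K True False, K True True, K False True} =
     {K' False False, K' True False, K' True True, K' False True}"
    using convex_quad_extreme_points[OF q] convex_quad_extreme_points[OF q'] unfolding hull by simp
  from convex_quad_symmetry[OF q q'' this]
  obtain i a b where i: "i \<noteq> l'" and corner: "\<And>x y. F' (chart l' c' i a b (of_bool x) (of_bool y)) = K x y"
  proof (elim disjE exE)
    fix a b assume *: "\<forall>x y. K x y = K' (x \<noteq> a) (y \<noteq> b)"
    have "F' (chart l' c' (l' + 1) a b (of_bool x) (of_bool y)) = K x y" for x y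
      unfolding chart_fpt(1)[of l' c' a b] *[rule_format, of x y] K'_def
      by (cases a; cases b; cases x; cases y) simp_all
    then show thesis using that axis_fpt_3(1)[of l'] by blast
  next
    fix a b assume *: "\<forall>x y. K x y = K' (y \<noteq> b) (x \<noteq> a)"
    have "F' (chart l' c' (l' + 2) a b (of_bool x) (of_bool y)) = K x y" for x y
      unfolding chart_fpt(2)[of l' c' a b] *[rule_format, of x y] K'_def
      by (cases a; cases b; cases x; cases y) simp_all
    then show thesis using that axis_fpt_3(2)[of l'] by blast
  qed
  note corners = corner[of False False] corner[of True False] corner[of True True] corner[of False True]
  have "F' (chart l' c' i a b s t) = F (fpt l c s t)" for s t
  proof -
    have "F' (chart l' c' i a b s t) = quad (F' (chart l' c' i a b 0 0)) (F' (chart l' c' i a b 1 0))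
           (F' (chart l' c' i a b 1 1)) (F' (chart l' c' i a b 0 1)) s t"
      by (rule trilinear_chart[OF F'(2) i])
    also have "\<dots> = quad (K False False) (K True False) (K True True) (K False True) s t"
      using corners by (simp only: of_bool_eq)
    also have "\<dots> = F (fpt l c s t)"
      unfolding K_def of_bool_eq by (rule trilinear_chart[OF F(2) axis_fpt_3(1), symmetric])
    finally show ?thesis .
  qed
  with i show thesis by (rule that)
qed

section \<open>Flux through a face in an arbitrary chart\<close>

lemma integral_square_flip1:
  fixes h :: "real \<Rightarrow> real \<Rightarrow> real"
  assumes "continuous_on UNIV (\<lambda>x. h (fst x) (snd x))"
  shows "integral square (\<lambda>(s, t). h (1 - s) t) = integral square (\<lambda>(s, t). h s t)"
proof -
  have r: "integral {0..1} (\<lambda>s. f (1 - s)) = integral {0..1} f" for f :: "real \<Rightarrow> real"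
  proof -
    have "integral {0..1} f = integral {-1..-(0::real)} (\<lambda>s. f (- s))"
      by (rule Henstock_Kurzweil_Integration.integral_reflect_real[symmetric])
    also have "\<dots> = integral {0..1} (\<lambda>s. f (- (s + - 1)))"
      using integral_shift_Icc_real[of 0 1 "\<lambda>s. f (- s)" "-1"] by (simp add: o_def)
    finally show ?thesis by simp
  qed
  have c: "continuous_on square (\<lambda>(s, t). h (f s) t)" if "continuous_on UNIV f" for f
    unfolding case_prod_unfold
    by (rule continuous_on_compose2[OF assms, of _ "\<lambda>x. (f (fst x), snd x)", simplified])
       (auto intro!: continuous_intros continuous_on_compose2[OF that])
  show ?thesis
    using c[of "\<lambda>s. 1 - s"] c[of "\<lambda>s. s"] r[of "\<lambda>s. integral {0..1} (h s)"]
    by (simp add: integral_prod_continuous continuous_intros)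
qed

lemma integral_square_swap:
  fixes h :: "real \<Rightarrow> real \<Rightarrow> real"
  assumes "continuous_on UNIV (\<lambda>x. h (fst x) (snd x))"
  shows "integral square (\<lambda>(s, t). h t s) = integral square (\<lambda>(s, t). h s t)"
proof -
  have "continuous_on square (\<lambda>(s, t). h s t)"
    using assms by (auto simp: case_prod_unfold intro: continuous_on_subset)
  from integral_swap_2dim[OF this] show ?thesis by simp
qed

lemma chart_flip: "chart l c i True b s t = chart l c i False b (1 - s) t"
  by (simp add: chart_def)

lemma chart_swap: "chart l c (l + 1) a b s t = chart l c (l + 2) b a t s"
  unfolding chart_fpt(1)[of l c a b] chart_fpt(2)[of l c b a] ..

text \<open>Reversing the first parameter and exchanging both parameters generate all symmetries of the
  square.\<close>
lemma chart_symmetry_induct: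
  assumes "i \<noteq> (l::3)"
    and base: "P (l + 1) False False"
    and flip: "\<And>i b. P i False b \<Longrightarrow> P i True b"
    and swap: "\<And>a b. P (l + 1) a b \<longleftrightarrow> P (l + 2) b a"
  shows "P i a b"
proof -
  have F: "P i a b" if "P i False b" for i a b using that flip by (cases a) auto
  have "P (l + 2) False False" using base swap by blast
  then have "P (l + 1) False b" for b using F swap by blast
  then have 1: "P (l + 1) a b" for a b using F by blast
  then have "P (l + 2) a b" for a b using swap by blast
  with 1 show ?thesis using assms(1) axis_fpt_3(4)[of i l] by blast
qed

lemma integral_square_chart:
  fixes h :: "real^3 \<Rightarrow> real"
  assumes "continuous_on UNIV h" "i \<noteq> l"
  shows "integral square (\<lambda>(s, t). h (chart l c i a b s t)) = integral square (\<lambda>(s, t). h (fpt l c s t))"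
proof (rule chart_symmetry_induct[OF assms(2), where P = "\<lambda>i a b. integral square (\<lambda>(s, t). h (chart l c i a b s t)) =
      integral square (\<lambda>(s, t). h (fpt l c s t))"])
  have c: "continuous_on UNIV (\<lambda>x. h (chart l c i a b (fst x) (snd x)))" for i a b
    by (rule continuous_on_compose2[OF assms(1)]) (auto intro!: continuous_intros)
  show "integral square (\<lambda>(s, t). h (chart l c i True b s t)) = integral square (\<lambda>(s, t). h (fpt l c s t))"
    if "integral square (\<lambda>(s, t). h (chart l c i False b s t)) = integral square (\<lambda>(s, t). h (fpt l c s t))" for i b
    using integral_square_flip1[OF c[of i False b]] that unfolding chart_flip[of l c i b] by (rule trans)
  show "integral square (\<lambda>(s, t). h (chart l c (l + 1) a b s t)) = integral square (\<lambda>(s, t). h (fpt l c s t)) \<longleftrightarrow>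
     integral square (\<lambda>(s, t). h (chart l c (l + 2) b a s t)) = integral square (\<lambda>(s, t). h (fpt l c s t))" for a b
    using integral_square_swap[OF c[of "l+2" b a]] unfolding chart_swap[of l c a b] by (simp only:)
qed rule

lemma quad_area_symmetry:
  "quad_area B A D C s t = - quad_area A B C D (1 - s) t"
  "quad_area A D C B s t = - quad_area A B C D t s"
  by (simp_all add: quad_area_def cross_minus_left cross_minus_right[symmetric])
     (simp_all add: cross3_simps vec_eq_iff forall_3 algebra_simps)

lemma quad_area_chart:
  assumes "poly_map F" "trilinear F" "i \<noteq> l"
  shows "\<bar>n \<bullet> area F l (chart l c i a b s t)\<bar> =
     \<bar>n \<bullet> quad_area (F (chart l c i a b 0 0)) (F (chart l c i a b 1 0))
           (F (chart l c i a b 1 1)) (F (chart l c i a b 0 1)) s t\<bar>"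
proof -
  define P where "P i a b \<longleftrightarrow> (\<forall>s t. \<bar>n \<bullet> area F l (chart l c i a b s t)\<bar> =
     \<bar>n \<bullet> quad_area (F (chart l c i a b 0 0)) (F (chart l c i a b 1 0))
           (F (chart l c i a b 1 1)) (F (chart l c i a b 0 1)) s t\<bar>)" for i a b
  have "P i a b"
  proof (rule chart_symmetry_induct[OF assms(3), where P = P])
    show "P (l + 1) False False" by (simp add: P_def area_fpt[OF assms(1,2)])
    show "P i True b" if "P i False b" for i b
    proof -
      have sym: "quad_area B A D C s t = - quad_area A B C D (1 - s) t" for A B C D s t by (rule quad_area_symmetry)
      show ?thesis using that unfolding P_def chart_flip[of l c i b]
        sym[of "F (chart l c i False b (1 - 0) 0)" "F (chart l c i False b (1 - 1) 0)"]
        by (simp add: inner_minus_right)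
    qed
    have sym: "quad_area A D C B s t = - quad_area A B C D t s" for A B C D s t by (rule quad_area_symmetry)
    show "P (l + 1) a b \<longleftrightarrow> P (l + 2) b a" for a b
      unfolding P_def chart_swap[of l c a b] sym[of _ _ _ "F (chart l c (l + 2) b a 1 0)"]
      by (auto simp: inner_minus_right)
  qed
  then show ?thesis unfolding P_def by blast
qed

section \<open>Elements of a grid\<close>

lemma poly_Q_component:
  assumes "poly_Q k q" "bounded_linear f" shows "poly_Q k (\<lambda>\<xi>. f (q \<xi>))"
proof -
  interpret bounded_linear f by fact
  from assms(1) obtain C where "\<And>\<xi>. q \<xi> = (\<Sum>a\<le>k. \<Sum>b\<le>k. \<Sum>c\<le>k. ((\<xi>$1)^a * (\<xi>$2)^b * (\<xi>$3)^c) *\<^sub>R C a b c)"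
    unfolding poly_Q_def by blast
  then show ?thesis unfolding poly_Q_def
    by (intro exI[of _ "\<lambda>a b c. f (C a b c)"]) (simp add: sum scaleR)
qed

lemma poly_Q_real_polynomial:
  assumes "poly_Q k (q :: real^3 \<Rightarrow> real)" shows "real_polynomial_function q"
proof -
  from assms obtain C where "q = (\<lambda>\<xi>. \<Sum>a\<le>k. \<Sum>b\<le>k. \<Sum>c\<le>k. ((\<xi>$1)^a * (\<xi>$2)^b * (\<xi>$3)^c) * C a b c)"
    unfolding poly_Q_def by (auto simp: fun_eq_iff)
  moreover have "real_polynomial_function (\<lambda>\<xi>::real^3. ((\<xi>$1)^a * (\<xi>$2)^b * (\<xi>$3)^c) * d)" for a b c d
    by (intro real_polynomial_function.intros(2,4) real_polynomial_function_power real_polynomial_coord)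
  ultimately show ?thesis by (auto intro!: real_polynomial_function_sum)
qed

lemma poly_Q_poly_map: "poly_Q k F \<Longrightarrow> poly_map F"
  using poly_Q_real_polynomial[OF poly_Q_component[OF _ bounded_linear_vec_nth]] by (auto simp: poly_map_def)

lemma poly_Q_trilinear:
  assumes "poly_Q 1 F" shows "trilinear F"
proof -
  have two: "{..(1::nat)} = {0, 1}" by auto
  from assms obtain C where C: "\<And>\<xi>. F \<xi> = (\<Sum>a\<le>1. \<Sum>b\<le>1. \<Sum>c\<le>1. ((\<xi>$1)^a * (\<xi>$2)^b * (\<xi>$3)^c) *\<^sub>R C a b c)"
    unfolding poly_Q_def by blast
  show ?thesis unfolding trilinear_def
  proof (intro allI)
    fix \<xi> m r
    show "F (upd \<xi> m r) = (1 - r) *\<^sub>R F (upd \<xi> m 0) + r *\<^sub>R F (upd \<xi> m 1)"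
      by (cases m rule: three_cases)
         (simp_all add: C two upd_def algebra_simps)
  qed
qed

lemma hexahedronD:
  assumes "hexahedron H F"
  shows "hexmap F" "trilinear F" "H = F ` unit_cube"
  using assms poly_Q_poly_map poly_Q_trilinear by (auto simp: hexahedron_def hexmap_def jdet_def)

definition face_index :: "(3 * real) set" where
  "face_index = Sigma UNIV (\<lambda>_. {0, 1})"

abbreviation hex_face :: "(real^3 \<Rightarrow> real^3) \<Rightarrow> 3 * real \<Rightarrow> (real^3) set" where
  "hex_face F lc \<equiv> F ` local_face (fst lc) (snd lc)"

lemma finite_face_index: "finite face_index" by (simp add: face_index_def)

lemma hex_faces_eq: "hex_faces F = hex_face F ` face_index"
  unfolding hex_faces_def face_index_def local_face_def by (auto simp: image_iff) blast+

lemma fpt_unit_cube: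
  assumes "c \<in> {0, 1}" "s \<in> {0..1}" "t \<in> {0..1}" "i \<noteq> l"
  shows "chart l c i a b s t \<in> unit_cube"
  using chart_in_face[OF assms(4,1-3)] unfolding local_face_def by blast

text \<open>Points in the relative interior of a face determine the face, because the parametrization is
  injective.\<close>
lemma hex_face_inner_unique:
  assumes "hexmap F" "c \<in> {0, 1}" "s \<in> {0<..<1}" "t \<in> {0<..<1}" "c' \<in> {0, 1}"
    and "F (fpt l c s t) \<in> F ` local_face l' c'"
  shows "l' = l" "c' = c"
proof -
  obtain \<xi> where \<xi>: "\<xi> \<in> local_face l' c'" "F \<xi> = F (fpt l c s t)" using assms(6) by auto
  have "\<xi> \<in> unit_cube" using \<xi>(1) unfolding local_face_def by blast
  moreover have "fpt l c s t \<in> unit_cube"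
    using assms by (intro fpt_unit_cube axis_fpt_3) auto
  moreover have "inj_on F unit_cube" using assms(1) by (simp add: hexmap_def)
  ultimately have e: "\<xi> = fpt l c s t" using \<xi>(2) by (meson inj_onD)
  have c: "fpt l c s t $ l' = c'" using \<xi>(1) unfolding e local_face_def by blast
  show "l' = l"
    using c fpt_nth[of l c s t] axis_fpt_3(4)[of l' l] assms(3,4,5) by auto
  with c show "c' = c" by (simp add: fpt_nth)
qed

lemma inj_hex_face:
  assumes "hexmap F" shows "inj_on (hex_face F) face_index"
proof (rule inj_onI)
  fix x y assume x: "x \<in> face_index" and y: "y \<in> face_index" and eq: "hex_face F x = hex_face F y"
  have x': "snd x \<in> {0, 1}" and y': "snd y \<in> {0, 1}" using x y by (auto simp: face_index_def)
  have "fpt (fst x) (snd x) (1/2) (1/2) \<in> local_face (fst x) (snd x)"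
    by (rule chart_in_face[OF axis_fpt_3(1) x']) auto
  then have "F (fpt (fst x) (snd x) (1/2) (1/2)) \<in> hex_face F y" unfolding eq[symmetric] by blast
  from hex_face_inner_unique[OF assms x' _ _ y' this] show "x = y" by (simp add: prod_eq_iff)
qed

text \<open>The contribution of one element to the flux through the set \<open>S\<close>. The sum has one term if \<open>S\<close> is
  a face of the element and is empty otherwise, so that no index of the face has to be chosen.\<close>
definition element_face_flux ::
    "grid_vectors \<Rightarrow> (real^3 \<Rightarrow> real^3) \<Rightarrow> (real^3 \<Rightarrow> real^3) \<Rightarrow> (real^3 \<Rightarrow> real) \<Rightarrow> (real^3) set \<Rightarrow> real" where
  "element_face_flux D F g \<phi> S =
     (\<Sum>lc \<in> {lc \<in> face_index. hex_face F lc = S}. orient F * (2 * snd lc - 1) * face_flux F g \<phi> (fst lc) (snd lc))"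

lemma flux_sum_faces:
  assumes "finite \<S>" "hex_faces F \<subseteq> \<S>"
  shows "orient F * flux F g \<phi> = (\<Sum>S\<in>\<S>. element_face_flux D F g \<phi> S)"
proof -
  have "(\<Sum>S\<in>\<S>. element_face_flux D F g \<phi> S) =
     (\<Sum>lc\<in>face_index. orient F * (2 * snd lc - 1) * face_flux F g \<phi> (fst lc) (snd lc))"
    unfolding element_face_flux_def using assms by (intro sum.group finite_face_index) (auto simp: hex_faces_eq)
  also have "\<dots> = (\<Sum>l\<in>UNIV. \<Sum>c\<in>{0, 1}. orient F * (2 * c - 1) * face_flux F g \<phi> l c)"
    unfolding face_index_def by (subst sum.Sigma) (auto simp: case_prod_unfold)
  also have "\<dots> = orient F * flux F g \<phi>"
    by (simp add: flux_def sum_distrib_left algebra_simps)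
  finally show ?thesis by simp
qed

text \<open>The integrand of the flux is rewritten with the area element, which is the same in all charts;
  only a sign is left over from the orientation of the standard chart.\<close>
lemma face_flux_chart:
  assumes F: "hexmap F" "trilinear F" and c: "c \<in> {0, 1}" and i: "i \<noteq> l"
    and n: "norm n = 1" "orthogonal_to_set n (F ` local_face l c)"
    and g: "poly_map g" and \<phi>: "continuous_on UNIV \<phi>"
  shows "face_flux F g \<phi> l c = sgn (n \<bullet> area F l (fpt l c 0 0)) *
    integral square (\<lambda>(s, t). \<phi> (F (chart l c i a b s t)) * (g (chart l c i a b s t) \<bullet> n) *
      \<bar>n \<bullet> quad_area (F (chart l c i a b 0 0)) (F (chart l c i a b 1 0))
           (F (chart l c i a b 1 1)) (F (chart l c i a b 0 1)) s t\<bar>)"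
proof -
  have pF: "poly_map F" using F(1) by (rule hexmap_poly)
  let ?e = "sgn (n \<bullet> area F l (fpt l c 0 0))"
  define h where "h \<xi> = \<phi> (F \<xi>) * (g \<xi> \<bullet> n) * \<bar>n \<bullet> area F l \<xi>\<bar>" for \<xi>
  have ch: "continuous_on UNIV h"
    unfolding h_def
    by (intro continuous_intros continuous_on_compose2[OF \<phi> poly_map_continuous[OF pF]]
         poly_map_continuous[OF g] poly_map_continuous[OF poly_map_area[OF pF]]) auto
  have "face_flux F g \<phi> l c = integral square (\<lambda>x. ?e * (\<lambda>(s, t). h (fpt l c s t)) x)"
    unfolding face_flux_def
  proof (rule Henstock_Kurzweil_Integration.integral_cong)
    fix x assume "x \<in> square"
    then obtain s t where x: "x = (s, t)" and st: "s \<in> {0..1}" "t \<in> {0..1}"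
      by (cases x) (auto simp: cbox_Pair_eq)
    have a: "area F l (fpt l c s t) = (n \<bullet> area F l (fpt l c s t)) *\<^sub>R n"
      using face_area(1)[OF F c n st] .
    have "n \<bullet> area F l (fpt l c s t) = ?e * \<bar>n \<bullet> area F l (fpt l c s t)\<bar>"
      using face_area(3)[OF F c n st] by (metis mult_sgn_abs)
    then have "g (fpt l c s t) \<bullet> area F l (fpt l c s t) = ?e * \<bar>n \<bullet> area F l (fpt l c s t)\<bar> * (g (fpt l c s t) \<bullet> n)"
      using a by (metis inner_scaleR_right)
    then show "(case x of (s, t) \<Rightarrow> \<phi> (F (fpt l c s t)) * (g (fpt l c s t) \<bullet> area F l (fpt l c s t))) =
       ?e * (case x of (s, t) \<Rightarrow> h (fpt l c s t))"
      by (simp add: x h_def)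
  qed
  also have "\<dots> = ?e * integral square (\<lambda>(s, t). h (fpt l c s t))" by simp
  also have "integral square (\<lambda>(s, t). h (fpt l c s t)) = integral square (\<lambda>(s, t). h (chart l c i a b s t))"
    by (rule integral_square_chart[OF ch i, symmetric])
  finally show ?thesis unfolding h_def quad_area_chart[OF pF F(2) i] .
qed

section \<open>Cancellation of fluxes in a grid\<close>

lemma scaled_cube_hexmap:
  fixes a :: "real^3" and R :: real
  assumes R: "R > 0"
  shows "hexmap (\<lambda>\<xi>. a + R *\<^sub>R \<xi>)"
proof -
  let ?F = "\<lambda>\<xi>::real^3. a + R *\<^sub>R \<xi>"
  have rp: "poly_map ?F"
    unfolding poly_map_def
    by (auto intro!: real_polynomial_function.intros(2-4) real_polynomial_coord)
  have pd: "partial_deriv l (\<lambda>\<xi>. a $ j + R * \<xi> $ j) \<xi> = R * axis l 1 $ j" for l j \<xi>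
    by (rule partial_deriv_eqI[where f' = "\<lambda>h. R * h $ j"])
       (auto intro!: derivative_eq_intros bounded_linear.has_derivative[OF bounded_linear_vec_nth])
  have "tangent ?F l \<xi> = R *\<^sub>R axis l 1" for l \<xi>
    by (simp add: tangent_def vec_eq_iff pd)
  then have "jdet ?F \<xi> = R ^ 3" for \<xi>
    unfolding jdet_tangent_area[OF rp, of \<xi> 1]
    by (simp add: area_def cross3_simps inner_vec_def sum_3 axis_def three_num power3_eq_cube)
  then show ?thesis using R rp by (auto simp: hexmap_def inj_on_def)
qed

text \<open>A large cube around the support is itself an element, with a scaling as its map; the function
  vanishes on all its faces.\<close>
lemma integral_grad_compact_support:
  assumes \<phi>: "C_order 1 \<phi>" and supp: "bounded S" "\<And>x. x \<notin> S \<Longrightarrow> \<phi> x = 0 \<and> grad \<phi> x = 0"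
  shows "((\<lambda>x. n \<bullet> grad \<phi> x) has_integral 0) UNIV"
proof -
  obtain B where B: "B > 0" "\<And>x. x \<in> S \<Longrightarrow> norm x < B" using supp(1) unfolding bounded_pos_less by blast
  define a :: "real^3" where "a = (\<chi> i. - B)"
  let ?F = "\<lambda>\<xi>::real^3. a + (2 * B) *\<^sub>R \<xi>"
  have F: "hexmap ?F" using B by (intro scaled_cube_hexmap) simp
  have coord: "\<bar>x $ i\<bar> < B" if "x \<in> S" for x i using B(2)[OF that] component_le_norm_cart[of x i] by linarith
  have img: "S \<subseteq> ?F ` unit_cube"
  proof
    fix x assume "x \<in> S"
    then have "0 \<le> (x $ i + B) / (2 * B) \<and> (x $ i + B) / (2 * B) \<le> 1" for i
      using coord[of x i] B(1) by (simp add: abs_less_iff)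
    then have "(1 / (2 * B)) *\<^sub>R (x - a) \<in> unit_cube" by (simp add: a_def)
    moreover have "x = ?F ((1 / (2 * B)) *\<^sub>R (x - a))" using B(1) by simp
    ultimately show "x \<in> ?F ` unit_cube" by blast
  qed
  have "face_flux ?F (\<lambda>\<xi>. n) \<phi> l c = 0" if "c \<in> {0, 1}" for l c
  proof -
    have "\<phi> (?F (fpt l c s t)) = 0" for s t
    proof -
      have "?F (fpt l c s t) $ l = 2 * B * c - B" by (simp add: a_def fpt_nth)
      then have "\<bar>?F (fpt l c s t) $ l\<bar> = B" using that B(1) by auto
      with coord[of "?F (fpt l c s t)" l] have "?F (fpt l c s t) \<notin> S" by linarith
      then show ?thesis using supp(2) by blast
    qed
    then show ?thesis by (simp add: face_flux_def case_prod_unfold)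
  qed
  then have "flux ?F (\<lambda>\<xi>. n) \<phi> = 0" by (simp add: flux_def)
  moreover have "integral (?F ` unit_cube) (\<lambda>x. n \<bullet> grad \<phi> x) + integral (?F ` unit_cube) (\<lambda>x. \<phi> x * 0)
    = orient ?F * flux ?F (\<lambda>\<xi>. n) \<phi>"
    by (rule element_integration_by_parts(1)[OF F _ \<phi>])
       (auto simp: fdiv_const[OF hexmap_poly[OF F]] poly_map_def real_polynomial_function.intros(2))
  ultimately have "integral (?F ` unit_cube) (\<lambda>x. n \<bullet> grad \<phi> x) = 0" by simp
  moreover have "(\<lambda>x. n \<bullet> grad \<phi> x) integrable_on (?F ` unit_cube)"
  proof -
    have "continuous_on (?F ` unit_cube) (\<lambda>x. n \<bullet> grad \<phi> x)"
      using grad_continuous[of 0 \<phi>] \<phi> by (auto intro!: continuous_intros intro: continuous_on_subset)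
    then have "set_integrable lborel (?F ` unit_cube) (\<lambda>x. n \<bullet> grad \<phi> x)"
      unfolding set_integrable_def by (rule borel_integrable_compact[OF compact_hex[OF F]])
    then show ?thesis by (rule set_borel_integral_eq_integral(1))
  qed
  ultimately have "((\<lambda>x. n \<bullet> grad \<phi> x) has_integral 0) (?F ` unit_cube)"
    by (simp add: has_integral_integrable_integral)
  moreover have "n \<bullet> grad \<phi> x = 0" if "x \<notin> ?F ` unit_cube" for x
    using subsetD[OF img, of x] that supp(2)[of x] by (metis inner_zero_right)
  ultimately show ?thesis
    by (rule has_integral_on_superset) (assumption | rule subset_UNIV)+
qed

lemma test_function_outside:
  assumes "\<phi> \<in> test_functions \<Omega>" "x \<notin> \<Omega>"
  shows "\<phi> x = 0" "grad \<phi> x = 0"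
proof -
  let ?K = "closure {x. \<phi> x \<noteq> 0}"
  have x: "x \<in> - ?K" using assms by (auto simp: test_functions_def)
  have z: "0 = \<phi> y" if "y \<in> - ?K" for y
    using that closure_subset[of "{x. \<phi> x \<noteq> 0}"] by auto
  show "\<phi> x = 0" using z[OF x] by simp
  have "((\<lambda>x. 0) has_derivative (\<lambda>h. 0)) (at x)" by (rule has_derivative_const)
  then have "(\<phi> has_derivative (\<lambda>h. 0)) (at x)"
    by (rule has_derivative_transform_within_open[OF _ _ x z]) auto
  then have "partial_deriv i \<phi> x = 0" for i using partial_deriv_eqI[of \<phi> "\<lambda>h. 0"] by blast
  then show "grad \<phi> x = 0" by (simp add: grad_def vec_eq_iff)
qed

lemma test_function_C1: "\<phi> \<in> test_functions \<Omega> \<Longrightarrow> C_order 1 \<phi>"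
  by (simp only: test_functions_def mem_Collect_eq)

locale hex_grid =
  fixes \<Omega> :: "(real^3) set" and T \<Phi> and D :: grid_vectors
  assumes open_\<Omega>: "open \<Omega>" and bounded_\<Omega>: "bounded \<Omega>"
    and grid: "conforming_grid \<Omega> T \<Phi>"
    and face_vecs: "face_vectors T \<Phi> D"
begin

abbreviation "elem_open H \<equiv> \<Phi> H ` open_cube"

lemma finite_T: "finite T" and \<Omega>_eq: "\<Omega> = interior (\<Union>T)"
  using grid by (auto simp: conforming_grid_def)

lemma hexD:
  assumes "H \<in> T"
  shows "hexmap (\<Phi> H)" "trilinear (\<Phi> H)" "H = \<Phi> H ` unit_cube"
  using grid assms hexahedronD by (auto simp: conforming_grid_def)

lemma finite_grid_faces: "finite (grid_faces T \<Phi>)"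
  using finite_T by (simp add: grid_faces_def hex_faces_eq finite_face_index)

lemma elem_open_subset: "H \<in> T \<Longrightarrow> elem_open H \<subseteq> H"
  using hexD(3) open_cube_subset by blast

lemma elem_open_\<Omega>: "H \<in> T \<Longrightarrow> elem_open H \<subseteq> \<Omega>"
  unfolding \<Omega>_eq by (intro interior_maximal open_hex_interior hexD) (use elem_open_subset in auto)

text \<open>Vertices, edges and faces of an element are images of points of the cube with a coordinate in
  \<open>{0, 1}\<close>.\<close>
lemma intersection_in_boundary:
  assumes "H \<in> T" "H' \<in> T" "H \<noteq> H'"
  shows "H \<inter> H' \<subseteq> \<Phi> H ` (unit_cube - open_cube)"
proof -
  have sub: "\<Phi> H ` A \<subseteq> \<Phi> H ` (unit_cube - open_cube)"
    if "\<And>\<xi>. \<xi> \<in> A \<Longrightarrow> \<xi> \<in> unit_cube \<and> (\<exists>j. \<xi> $ j \<in> {0, 1})" for A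
  proof (intro image_mono subsetI DiffI)
    fix \<xi> assume "\<xi> \<in> A"
    from that[OF this] obtain j where j: "\<xi> \<in> unit_cube" "\<xi> $ j \<in> {0, 1}" by blast
    show "\<xi> \<in> unit_cube" by (rule j)
    show "\<xi> \<notin> open_cube"
    proof
      assume "\<xi> \<in> open_cube"
      then have "0 < \<xi> $ j \<and> \<xi> $ j < 1" by (simp add: mem_box_cart)
      with j(2) show False by auto
    qed
  qed
  consider "H \<inter> H' = {}" | V where "V \<in> hex_vertices (\<Phi> H)" "H \<inter> H' = {V}"
    | "H \<inter> H' \<in> hex_edges (\<Phi> H)" | "H \<inter> H' \<in> hex_faces (\<Phi> H)"
    using grid assms unfolding conforming_grid_def by blast
  then show ?thesis
  proof cases
    case (2 V)
    then obtain \<xi> where xi: "V = \<Phi> H \<xi>" "\<forall>i. \<xi> $ i \<in> {0, 1}" unfolding hex_vertices_def by blast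
    have "\<Phi> H ` {\<xi>} \<subseteq> \<Phi> H ` (unit_cube - open_cube)"
    proof (rule sub)
      fix \<eta> assume "\<eta> \<in> {\<xi>}"
      then have "\<eta> = \<xi>" by simp
      moreover have "0 \<le> \<xi> $ i \<and> \<xi> $ i \<le> 1" for i using xi(2)[rule_format, of i] by auto
      ultimately show "\<eta> \<in> unit_cube \<and> (\<exists>j. \<eta> $ j \<in> {0, 1})" using xi(2) by blast
    qed
    then show ?thesis using 2 xi by simp
  next
    case 3
    then obtain i v where v: "\<forall>j. v $ j \<in> {0::real, 1}" and e: "H \<inter> H' = \<Phi> H ` {\<xi> \<in> unit_cube. \<forall>j. j \<noteq> i \<longrightarrow> \<xi> $ j = v $ j}"
      unfolding hex_edges_def by blast
    show ?thesis unfolding e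
    proof (rule sub)
      fix \<xi> assume "\<xi> \<in> {\<xi> \<in> unit_cube. \<forall>j. j \<noteq> i \<longrightarrow> \<xi> $ j = v $ j}"
      then show "\<xi> \<in> unit_cube \<and> (\<exists>j. \<xi> $ j \<in> {0, 1})"
        using v[rule_format, of "i + 1"] axis_fpt_3(1)[of i] by (intro conjI exI[of _ "i + 1"]) auto
    qed
  next
    case 4
    then obtain i c where c: "c \<in> {0, 1::real}" and e: "H \<inter> H' = \<Phi> H ` {\<xi> \<in> unit_cube. \<xi> $ i = c}"
      unfolding hex_faces_def by blast
    show ?thesis unfolding e using c by (intro sub) blast
  qed auto
qed

lemma negligible_intersection:
  "H \<in> T \<Longrightarrow> H' \<in> T \<Longrightarrow> H \<noteq> H' \<Longrightarrow> negligible (H \<inter> H')"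
  by (rule negligible_subset[OF negligible_hex_boundary[OF hexD(1)] intersection_in_boundary])

lemma elem_open_disjoint:
  assumes "H \<in> T" "H' \<in> T" "H \<noteq> H'"
  shows "elem_open H \<inter> H' = {}"
proof -
  have "inj_on (\<Phi> H) unit_cube" using hexD(1)[OF assms(1)] by (simp add: hexmap_def)
  then have "elem_open H \<inter> \<Phi> H ` (unit_cube - open_cube) = \<Phi> H ` (open_cube \<inter> (unit_cube - open_cube))"
    by (rule inj_on_image_Int[symmetric]) (rule open_cube_subset, rule Diff_subset)
  also have "open_cube \<inter> (unit_cube - open_cube) = {}" by (rule Diff_disjoint)
  finally show ?thesis using intersection_in_boundary[OF assms] elem_open_subset[OF assms(1)] by blast
qed

lemma sum_integral_grad:
  assumes "\<phi> \<in> test_functions \<Omega>"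
  shows "(\<Sum>H\<in>T. integral H (\<lambda>x. n \<bullet> grad \<phi> x)) = 0"
proof -
  let ?h = "\<lambda>x. n \<bullet> grad \<phi> x"
  have C: "C_order 1 \<phi>" using assms by (rule test_function_C1)
  have "?h integrable_on H" if "H \<in> T" for H
  proof -
    have "continuous_on (\<Phi> H ` unit_cube) ?h"
      using grad_continuous[of 0 \<phi>] C by (auto intro!: continuous_intros intro: continuous_on_subset)
    then have "set_integrable lborel (\<Phi> H ` unit_cube) ?h"
      unfolding set_integrable_def by (rule borel_integrable_compact[OF compact_hex[OF hexD(1)[OF that]]])
    then show ?thesis using hexD(3)[OF that] by (metis set_borel_integral_eq_integral(1))
  qed
  then have "(?h has_integral (\<Sum>H\<in>T. integral H ?h)) (\<Union>T)"
    by (intro has_integral_Union finite_T) (auto simp: pairwise_def negligible_intersection integrable_integral)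
  moreover have "grad \<phi> x = 0" if "x \<notin> \<Union>T" for x
    using that interior_subset[of "\<Union>T"] unfolding \<Omega>_eq[symmetric] by (intro test_function_outside(2)[OF assms]) auto
  then have "?h x = 0" if "x \<notin> \<Union>T" for x using that by simp
  ultimately have "(?h has_integral (\<Sum>H\<in>T. integral H ?h)) UNIV"
    by (metis has_integral_on_superset subset_UNIV)
  moreover have "(?h has_integral 0) UNIV"
    using test_function_outside[OF assms] by (intro integral_grad_compact_support[OF C bounded_\<Omega>]) auto
  ultimately show ?thesis by (rule has_integral_unique)
qed

lemma hex_faces_iff: "S \<in> hex_faces F \<longleftrightarrow> (\<exists>l c. c \<in> {0, 1} \<and> S = F ` local_face l c)"
  unfolding hex_faces_def local_face_def by blast

lemma face_index_of:
  assumes "S \<in> grid_faces T \<Phi>"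
  obtains H l c where "H \<in> T" "c \<in> {0, 1}" "S = \<Phi> H ` local_face l c"
  using assms unfolding grid_faces_def UN_iff hex_faces_iff by blast

lemma at_face_iff: "H \<in> at_face T \<Phi> S \<longleftrightarrow> H \<in> T \<and> (\<exists>l c. c \<in> {0, 1} \<and> S = \<Phi> H ` local_face l c)"
  unfolding at_face_def mem_Collect_eq hex_faces_iff ..

lemma face_normal_D:
  assumes "S \<in> grid_faces T \<Phi>"
  shows "norm (face_normal D S) = 1" "orthogonal_to_set (face_normal D S) S"
  using face_vecs assms by (auto simp: face_vectors_def)

text \<open>All elements at a face see it through one parametrization \<open>Q\<close>, by \<open>face_matching\<close>. In it their
  fluxes are one and the same integral, up to a sign \<open>\<sigma>\<close> (which is set to zero for the elements
  that do not have the face).\<close>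
lemma face_structure:
  assumes S: "S \<in> grid_faces T \<Phi>"
  obtains Q w \<sigma> H l c where
    "H \<in> T" "c \<in> {0, 1}" "S = \<Phi> H ` local_face l c" "\<And>s t. Q s t = \<Phi> H (fpt l c s t)"
    "continuous_on UNIV (\<lambda>x. w (fst x) (snd x) :: real)"
    "\<And>s t. s \<in> {0..1} \<Longrightarrow> t \<in> {0..1} \<Longrightarrow> w s t > 0"
    "\<And>H'. H' \<in> at_face T \<Phi> S \<Longrightarrow> \<sigma> H' \<noteq> (0::real)"
    "\<And>H'. H' \<in> T - at_face T \<Phi> S \<Longrightarrow> \<sigma> H' = 0"
    "\<And>H' g f \<phi>. H' \<in> T \<Longrightarrow> poly_map g \<Longrightarrow> (\<And>\<xi>. \<xi> \<in> unit_cube \<Longrightarrow> f (\<Phi> H' \<xi>) = g \<xi>) \<Longrightarrow> continuous_on UNIV \<phi> \<Longrightarrow>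
       element_face_flux D (\<Phi> H') g \<phi> S =
         \<sigma> H' * integral square (\<lambda>(s, t). \<phi> (Q s t) * (f (Q s t) \<bullet> face_normal D S) * w s t)"
proof -
  obtain H l c where H: "H \<in> T" and c: "c \<in> {0, 1}" and SH: "S = \<Phi> H ` local_face l c"
    using face_index_of[OF S] .
  let ?n = "face_normal D S"
  note n = face_normal_D[OF S]
  define Q where "Q s t = \<Phi> H (fpt l c s t)" for s t
  define w where "w s t = \<bar>?n \<bullet> quad_area (Q 0 0) (Q 1 0) (Q 1 1) (Q 0 1) s t\<bar>" for s t
  define \<sigma> where "\<sigma> H' = (\<Sum>lc \<in> {lc \<in> face_index. hex_face (\<Phi> H') lc = S}.
     orient (\<Phi> H') * (2 * snd lc - 1) * sgn (?n \<bullet> area (\<Phi> H') (fst lc) (fpt (fst lc) (snd lc) 0 0)))" for H'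
  have pH: "poly_map (\<Phi> H)" using hexD(1)[OF H] by (rule hexmap_poly)
  have wa: "w s t = \<bar>?n \<bullet> area (\<Phi> H) l (fpt l c s t)\<bar>" for s t
    unfolding w_def Q_def using quad_area_chart[OF pH hexD(2)[OF H] axis_fpt_3(1)] by simp
  have nH: "orthogonal_to_set ?n (\<Phi> H ` local_face l c)" using n(2) SH by simp
  have sig0: "\<sigma> H' = 0" if "H' \<in> T - at_face T \<Phi> S" for H'
  proof -
    have "{lc \<in> face_index. hex_face (\<Phi> H') lc = S} = {}"
      using that unfolding at_face_def hex_faces_eq by blast
    then show ?thesis by (simp only: \<sigma>_def sum.empty)
  qed
  have at: "\<exists>l' c'. c' \<in> {0, 1} \<and> S = \<Phi> H' ` local_face l' c' \<and> {lc \<in> face_index. hex_face (\<Phi> H') lc = S} = {(l', c')}"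
    if H': "H' \<in> at_face T \<Phi> S" for H'
  proof -
    from H' obtain l' c' where lc: "H' \<in> T" "c' \<in> {0, 1}" "S = \<Phi> H' ` local_face l' c'"
      unfolding at_face_iff by blast
    have "(l', c') \<in> face_index" using lc by (auto simp: face_index_def)
    then have "{lc \<in> face_index. hex_face (\<Phi> H') lc = S} = {(l', c')}"
      using inj_onD[OF inj_hex_face[OF hexD(1)[OF lc(1)]], of _ "(l', c')"] unfolding lc(3) by auto
    with lc show ?thesis by blast
  qed
  have signz: "\<sigma> H' \<noteq> 0" if H': "H' \<in> at_face T \<Phi> S" for H'
  proof -
    obtain l' c' where lc: "c' \<in> {0, 1}" "S = \<Phi> H' ` local_face l' c'" "{lc \<in> face_index. hex_face (\<Phi> H') lc = S} = {(l', c')}"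
      using at[OF H'] by blast
    have HT: "H' \<in> T" using H' by (simp add: at_face_def)
    have "?n \<bullet> area (\<Phi> H') l' (fpt l' c' 0 0) \<noteq> 0"
      using n lc by (intro face_area(2)[OF hexD(1,2)[OF HT]]) auto
    moreover have "orient (\<Phi> H') \<noteq> 0" using orient_cases[OF hexD(1)[OF HT]] by auto
    moreover have "2 * c' - 1 \<noteq> 0" using lc(1) by auto
    ultimately show ?thesis unfolding \<sigma>_def lc(3) by (simp add: sgn_zero_iff)
  qed
  have fluxeq: "element_face_flux D (\<Phi> H') g \<phi> S =
         \<sigma> H' * integral square (\<lambda>(s, t). \<phi> (Q s t) * (f (Q s t) \<bullet> ?n) * w s t)"
    if H': "H' \<in> T" and g: "poly_map g" and f: "\<And>\<xi>. \<xi> \<in> unit_cube \<Longrightarrow> f (\<Phi> H' \<xi>) = g \<xi>" and \<phi>: "continuous_on UNIV \<phi>"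
    for H' g f \<phi>
  proof (cases "H' \<in> at_face T \<Phi> S")
    case False
    then have "{lc \<in> face_index. hex_face (\<Phi> H') lc = S} = {}"
      using H' unfolding at_face_def hex_faces_eq by blast
    then show ?thesis by (simp only: \<sigma>_def element_face_flux_def sum.empty mult_zero_left)
  next
    case True
    obtain l' c' where c': "c' \<in> {0, 1}" and S': "S = \<Phi> H' ` local_face l' c'"
      and single: "{lc \<in> face_index. hex_face (\<Phi> H') lc = S} = {(l', c')}"
      using at[OF True] by blast
    obtain i a b where i: "i \<noteq> l'" and m: "\<And>s t. \<Phi> H' (chart l' c' i a b s t) = \<Phi> H (fpt l c s t)"
      using face_matching[OF hexD(1,2)[OF H] c hexD(1,2)[OF H'] c' n SH S'] by blast
    have nH': "orthogonal_to_set ?n (\<Phi> H' ` local_face l' c')" using n(2) S' by simp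
    have "face_flux (\<Phi> H') g \<phi> l' c' = sgn (?n \<bullet> area (\<Phi> H') l' (fpt l' c' 0 0)) *
       integral square (\<lambda>(s, t). \<phi> (Q s t) * (g (chart l' c' i a b s t) \<bullet> ?n) * w s t)"
      using face_flux_chart[OF hexD(1,2)[OF H'] c' i n(1) nH' g \<phi>, of a b]
      unfolding m w_def Q_def .
    also have "integral square (\<lambda>(s, t). \<phi> (Q s t) * (g (chart l' c' i a b s t) \<bullet> ?n) * w s t) =
        integral square (\<lambda>(s, t). \<phi> (Q s t) * (f (Q s t) \<bullet> ?n) * w s t)"
    proof (rule Henstock_Kurzweil_Integration.integral_cong)
      fix x assume "x \<in> square"
      then obtain s t where x: "x = (s, t)" and st: "s \<in> {0..1}" "t \<in> {0..1}" by (cases x) (auto simp: cbox_Pair_eq)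
      have "f (Q s t) = g (chart l' c' i a b s t)"
        unfolding Q_def m[symmetric] by (rule f) (rule fpt_unit_cube[OF c' st i])
      then show "(case x of (s, t) \<Rightarrow> \<phi> (Q s t) * (g (chart l' c' i a b s t) \<bullet> ?n) * w s t) =
          (case x of (s, t) \<Rightarrow> \<phi> (Q s t) * (f (Q s t) \<bullet> ?n) * w s t)" by (simp add: x)
    qed
    finally show ?thesis unfolding element_face_flux_def \<sigma>_def single by simp
  qed
  have wpos: "w s t > 0" if "s \<in> {0..1}" "t \<in> {0..1}" for s t
    unfolding wa using face_area(2)[OF hexD(1,2)[OF H] c n(1) nH that] by simp
  have wcont: "continuous_on UNIV (\<lambda>x. w (fst x) (snd x))"
    unfolding wa
    by (intro continuous_intros poly_map_continuous[OF poly_map_area[OF pH], THEN continuous_on_compose2[where t = UNIV]]) auto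
  show thesis by (rule that[OF H c SH Q_def wcont wpos signz sig0 fluxeq])
qed

end

lemma element_face_flux_eq_0:
  assumes "\<And>x. x \<in> S \<Longrightarrow> \<phi> x = 0"
  shows "element_face_flux D F g \<phi> S = 0"
  unfolding element_face_flux_def
proof (rule sum.neutral, rule ballI)
  fix lc assume "lc \<in> {lc \<in> face_index. hex_face F lc = S}"
  then have c: "snd lc \<in> {0, 1}" and S: "S = hex_face F lc" by (auto simp: face_index_def)
  have "face_flux F g \<phi> (fst lc) (snd lc) = integral square (\<lambda>x. 0)"
    unfolding face_flux_def
  proof (rule Henstock_Kurzweil_Integration.integral_cong)
    fix x assume "x \<in> square"
    then obtain s t where x: "x = (s, t)" and st: "s \<in> {0..1}" "t \<in> {0..1}" by (cases x) (auto simp: cbox_Pair_eq)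
    have "F (fpt (fst lc) (snd lc) s t) \<in> S"
      unfolding S by (rule imageI) (rule chart_in_face[OF axis_fpt_3(1) c st])
    then have "\<phi> (F (fpt (fst lc) (snd lc) s t)) = 0" by (rule assms)
    then show "(case x of (s, t) \<Rightarrow> \<phi> (F (fpt (fst lc) (snd lc) s t)) *
          (g (fpt (fst lc) (snd lc) s t) \<bullet> area F (fst lc) (fpt (fst lc) (snd lc) s t))) = 0"
      by (simp add: x)
  qed
  then show "orient F * (2 * snd lc - 1) * face_flux F g \<phi> (fst lc) (snd lc) = 0" by simp
qed

lemma poly_map_const: "poly_map (\<lambda>\<xi>. v)"
  by (simp add: poly_map_def real_polynomial_function.intros(2))

context hex_grid
begin

text \<open>Two elements meet in a whole face, an edge or a vertex. A point in the relative interior of \<open>S\<close>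
  lies on no edge and no vertex of its element, so another element through that point has \<open>S\<close> as a
  face too.\<close>
lemma grid_face_inner_unique:
  assumes H: "H \<in> T" and c: "c \<in> {0, 1}" and S: "S = \<Phi> H ` local_face l c"
    and st: "s \<in> {0<..<1}" "t \<in> {0<..<1}"
    and S': "S' \<in> grid_faces T \<Phi>" "\<Phi> H (fpt l c s t) \<in> S'"
  shows "S' = S"
proof -
  obtain H' l' c' where H': "H' \<in> T" and c': "c' \<in> {0, 1}" and S'H: "S' = \<Phi> H' ` local_face l' c'"
    using face_index_of[OF S'(1)] .
  let ?x = "\<Phi> H (fpt l c s t)" and ?\<xi> = "fpt l c s t"
  have xi: "?\<xi> \<in> unit_cube" using st by (intro fpt_unit_cube[OF c] axis_fpt_3) auto
  have inj: "inj_on (\<Phi> H) unit_cube" using hexD(1)[OF H] by (simp add: hexmap_def)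
  have Sg: "S \<in> grid_faces T \<Phi>" unfolding grid_faces_def UN_iff hex_faces_iff using H c S by blast
  have frac: "?\<xi> $ (l+1) \<notin> {0, 1}" "?\<xi> $ (l+2) \<notin> {0, 1}" using st by (simp_all add: fpt_nth)
  show ?thesis
  proof (cases "H = H'")
    case True
    have "l' = l" "c' = c"
      using hex_face_inner_unique[OF hexD(1)[OF H] c st c', of l l'] S'(2) unfolding S'H True by blast+
    then show ?thesis by (simp only: S S'H True)
  next
    case False
    have "local_face l' c' \<subseteq> unit_cube" unfolding local_face_def by blast
    then have "?x \<in> H'" using S'(2) hexD(3)[OF H'] unfolding S'H by blast
    then have x: "?x \<in> H \<inter> H'" using xi hexD(3)[OF H] by blast
    consider V where "V \<in> hex_vertices (\<Phi> H)" "H \<inter> H' = {V}"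
      | "H \<inter> H' \<in> hex_edges (\<Phi> H)" | "H \<inter> H' \<in> hex_faces (\<Phi> H)" "H \<inter> H' \<in> hex_faces (\<Phi> H')"
      using grid H H' False x unfolding conforming_grid_def by blast
    then show ?thesis
    proof cases
      case (1 V)
      then obtain \<xi> where \<xi>: "\<forall>i. \<xi> $ i \<in> {0, 1}" "?x = \<Phi> H \<xi>" unfolding hex_vertices_def using x by blast
      have "0 \<le> \<xi> $ i \<and> \<xi> $ i \<le> 1" for i using \<xi>(1)[rule_format, of i] by auto
      then have "\<xi> \<in> unit_cube" by blast
      then have "?\<xi> = \<xi>" using inj xi \<xi>(2) by (meson inj_onD)
      then show ?thesis using frac(1) \<xi>(1) by metis
    next
      case 2
      then obtain i v where v: "\<forall>j. v $ j \<in> {0::real, 1}" and e: "H \<inter> H' = \<Phi> H ` {\<xi> \<in> unit_cube. \<forall>j. j \<noteq> i \<longrightarrow> \<xi> $ j = v $ j}"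
        unfolding hex_edges_def by blast
      then obtain \<xi> where \<xi>: "\<xi> \<in> unit_cube" "\<forall>j. j \<noteq> i \<longrightarrow> \<xi> $ j = v $ j" "?x = \<Phi> H \<xi>" using x by blast
      have "?\<xi> = \<xi>" using inj xi \<xi>(1,3) by (meson inj_onD)
      then show ?thesis using frac v \<xi>(2) axis_fpt_3(3)[of l] by metis
    next
      case 3
      obtain l2 c2 where 2: "c2 \<in> {0, 1}" "H \<inter> H' = \<Phi> H ` local_face l2 c2"
        using 3(1) unfolding hex_faces_iff by blast
      obtain l3 c3 where 3: "c3 \<in> {0, 1}" "H \<inter> H' = \<Phi> H' ` local_face l3 c3"
        using 3(2) unfolding hex_faces_iff by blast
      have "l2 = l" "c2 = c"
        using hex_face_inner_unique[OF hexD(1)[OF H] c st 2(1), of l l2] x unfolding 2(2) by blast+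
      then have SS: "S = \<Phi> H' ` local_face l3 c3" using 2 3 S by simp
      obtain i a b where i: "i \<noteq> l3" and m: "\<And>s t. \<Phi> H' (chart l3 c3 i a b s t) = \<Phi> H (fpt l c s t)"
        using face_matching[OF hexD(1,2)[OF H] c hexD(1,2)[OF H'] 3(1) face_normal_D[OF Sg] S SS] by blast
      have "\<exists>s' t'. s' \<in> {0<..<1} \<and> t' \<in> {0<..<1} \<and> chart l3 c3 i a b s t = fpt l3 c3 s' t'"
      proof (cases "i = l3 + 1")
        case True
        show ?thesis unfolding True chart_fpt(1)[of l3 c3 a b] using st
          by (intro exI[of _ "if a then 1 - s else s"] exI[of _ "if b then 1 - t else t"]) auto
      next
        case False
        then have "i = l3 + 2" using i axis_fpt_3(4)[of i l3] by blast
        show ?thesis unfolding \<open>i = l3 + 2\<close> chart_fpt(2)[of l3 c3 a b] using st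
          by (intro exI[of _ "if b then 1 - t else t"] exI[of _ "if a then 1 - s else s"]) auto
      qed
      then obtain s' t' where st': "s' \<in> {0<..<1}" "t' \<in> {0<..<1}" "chart l3 c3 i a b s t = fpt l3 c3 s' t'"
        by blast
      have "\<Phi> H' (fpt l3 c3 s' t') \<in> \<Phi> H' ` local_face l' c'"
        using S'(2) unfolding S'H m[symmetric] st'(3) .
      from hex_face_inner_unique[OF hexD(1)[OF H'] 3(1) st'(1,2) c' this]
      show ?thesis by (simp only: SS S'H)
    qed
  qed
qed

lemma isolating_ball:
  assumes H: "H \<in> T" and c: "c \<in> {0, 1}" and S: "S = \<Phi> H ` local_face l c"
    and st: "s \<in> {0<..<1}" "t \<in> {0<..<1}" and x: "\<Phi> H (fpt l c s t) \<in> \<Omega>"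
  obtains r where "r > 0" "cball (\<Phi> H (fpt l c s t)) r \<subseteq> \<Omega>"
    "\<And>S'. S' \<in> grid_faces T \<Phi> \<Longrightarrow> S' \<noteq> S \<Longrightarrow> S' \<inter> cball (\<Phi> H (fpt l c s t)) r = {}"
proof -
  let ?x = "\<Phi> H (fpt l c s t)"
  let ?C = "\<Union>(grid_faces T \<Phi> - {S})"
  have "closed S'" if S': "S' \<in> grid_faces T \<Phi>" for S'
  proof -
    obtain H' l' c' where H': "H' \<in> T" "S' = \<Phi> H' ` local_face l' c'"
      using face_index_of[OF S'] by metis
    have "local_face l' c' = unit_cube \<inter> {\<xi>. \<xi> $ l' = c'}" unfolding local_face_def by blast
    moreover have "closed {\<xi> :: real^3. \<xi> $ l' = c'}" by (intro closed_Collect_eq continuous_intros)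
    ultimately have "compact (local_face l' c')" unfolding unit_cube_cbox by (metis compact_Int_closed compact_cbox)
    then have "compact S'" unfolding H'(2)
      by (intro compact_continuous_image poly_map_continuous hexmap_poly hexD H')
    then show ?thesis by (rule compact_imp_closed)
  qed
  then have "closed ?C" using finite_grid_faces by (intro closed_Union) auto
  then have "open (\<Omega> - ?C)" using open_\<Omega> by (rule open_Diff[rotated])
  moreover have "?x \<in> \<Omega> - ?C" using x grid_face_inner_unique[OF H c S st] by blast
  ultimately obtain r where "r > 0" "cball ?x r \<subseteq> \<Omega> - ?C" using open_contains_cball by blast
  then show thesis by (intro that[of r]) blast+
qed

lemma test_flux_sum:
  assumes "\<phi> \<in> test_functions \<Omega>"
  shows "(\<Sum>H\<in>T. orient (\<Phi> H) * flux (\<Phi> H) (\<lambda>\<xi>. v) \<phi>) = 0"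
proof -
  have "orient (\<Phi> H) * flux (\<Phi> H) (\<lambda>\<xi>. v) \<phi> = integral H (\<lambda>x. v \<bullet> grad \<phi> x)" if "H \<in> T" for H
    using element_integration_by_parts(1)[OF hexD(1)[OF that] poly_map_const test_function_C1[OF assms], of "\<lambda>x. v" v "\<lambda>x. 0"]
      hexD(3)[OF that] fdiv_const[OF hexmap_poly[OF hexD(1)[OF that]]] by simp
  then have "(\<Sum>H\<in>T. orient (\<Phi> H) * flux (\<Phi> H) (\<lambda>\<xi>. v) \<phi>) = (\<Sum>H\<in>T. integral H (\<lambda>x. v \<bullet> grad \<phi> x))"
    by (intro sum.cong) auto
  then show ?thesis using sum_integral_grad[OF assms] by simp
qed

lemma flux_faces: "H \<in> T \<Longrightarrow> orient (\<Phi> H) * flux (\<Phi> H) g \<phi> = (\<Sum>S\<in>grid_faces T \<Phi>. element_face_flux D (\<Phi> H) g \<phi> S)"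
  by (rule flux_sum_faces[OF finite_grid_faces]) (auto simp: grid_faces_def)

lemma flux_isolated:
  assumes "H \<in> T" "S \<in> grid_faces T \<Phi>"
    and "\<And>S' x. S' \<in> grid_faces T \<Phi> \<Longrightarrow> S' \<noteq> S \<Longrightarrow> x \<in> S' \<Longrightarrow> \<phi> x = 0"
  shows "orient (\<Phi> H) * flux (\<Phi> H) g \<phi> = element_face_flux D (\<Phi> H) g \<phi> S"
proof -
  have "(\<Sum>S'\<in>grid_faces T \<Phi>. element_face_flux D (\<Phi> H) g \<phi> S') = (\<Sum>S'\<in>{S}. element_face_flux D (\<Phi> H) g \<phi> S')"
    using assms by (intro sum.mono_neutral_right finite_grid_faces) (auto intro!: element_face_flux_eq_0)
  then show ?thesis by (simp add: flux_faces[OF assms(1)])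
qed

lemma bump_face_integral_pos:
  assumes Q: "continuous_on UNIV (\<lambda>x. Q (fst x) (snd x))"
    and w: "continuous_on UNIV (\<lambda>x. w (fst x) (snd x) :: real)" "\<And>s t. s \<in> {0..1} \<Longrightarrow> t \<in> {0..1} \<Longrightarrow> w s t > 0"
    and st: "s \<in> {0<..<1}" "t \<in> {0<..<1}" and r: "r > 0"
  shows "integral square (\<lambda>(s', t'). bump (Q s t) r n K (Q s' t') * w s' t') \<noteq> 0"
proof
  let ?f = "\<lambda>x. bump (Q s t) r n K (Q (fst x) (snd x)) * w (fst x) (snd x)"
  assume "integral square (\<lambda>(s', t'). bump (Q s t) r n K (Q s' t') * w s' t') = 0"
  then have 0: "integral square ?f = 0" by (simp add: case_prod_unfold)
  have cb: "continuous_on UNIV (bump (Q s t) r n K)" using C_order_continuous[OF bump_C_order] .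
  have c: "continuous_on square ?f"
    by (intro continuous_intros continuous_on_compose2[OF cb Q] continuous_on_subset[OF w(1)]
        continuous_on_subset[OF continuous_on_compose2[OF cb Q]]) auto
  have ne: "box (0, 0) (1, 1) \<noteq> ({} :: (real * real) set)" by (auto simp: box_Pair)
  have "\<forall>x\<in>square. ?f x = 0"
    using integral_cbox_eq_0_iff[OF c ne] 0 w(2) by (force simp: cbox_Pair_eq bump_nonneg less_imp_le)
  moreover have "(s, t) \<in> square" using st by (auto simp: cbox_Pair_eq)
  ultimately have "?f (s, t) = 0" by blast
  then show False using bump_center[OF r, of "Q s t" n K] w(2)[of s t] st by auto
qed

text \<open>The constant field \<open>n\<close> has total flux zero against a bump around the given point. If the bump is
  supported away from the other faces, this total is the sum of the signs times a positive
  integral.\<close>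
lemma face_signs_cancel:
  assumes S: "S \<in> grid_faces T \<Phi>"
    and H: "H \<in> T" and c: "c \<in> {0, 1}" and SH: "S = \<Phi> H ` local_face l c"
    and Q: "\<And>s t. Q s t = \<Phi> H (fpt l c s t)"
    and w: "continuous_on UNIV (\<lambda>x. w (fst x) (snd x) :: real)" "\<And>s t. s \<in> {0..1} \<Longrightarrow> t \<in> {0..1} \<Longrightarrow> w s t > 0"
    and flux: "\<And>H' g f \<phi>. H' \<in> T \<Longrightarrow> poly_map g \<Longrightarrow> (\<And>\<xi>. \<xi> \<in> unit_cube \<Longrightarrow> f (\<Phi> H' \<xi>) = g \<xi>) \<Longrightarrow> continuous_on UNIV \<phi> \<Longrightarrow>
       element_face_flux D (\<Phi> H') g \<phi> S =
         \<sigma> H' * integral square (\<lambda>(s, t). \<phi> (Q s t) * (f (Q s t) \<bullet> face_normal D S) * w s t)"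
    and st: "s \<in> {0<..<1}" "t \<in> {0<..<1}" and x: "Q s t \<in> \<Omega>"
  shows "(\<Sum>H'\<in>T. \<sigma> H') = 0"
proof -
  let ?n = "face_normal D S"
  obtain r where r: "r > 0" "cball (Q s t) r \<subseteq> \<Omega>"
    and iso: "\<And>S'. S' \<in> grid_faces T \<Phi> \<Longrightarrow> S' \<noteq> S \<Longrightarrow> S' \<inter> cball (Q s t) r = {}"
    using isolating_ball[OF H c SH st] x unfolding Q by blast
  define \<phi> where "\<phi> = bump (Q s t) r ?n 0"
  have test: "\<phi> \<in> test_functions \<Omega>" unfolding \<phi>_def by (rule bump_test) (use r in auto)
  have nn: "?n \<bullet> ?n = 1" using face_normal_D(1)[OF S] by (simp add: norm_eq_1)
  have cphi: "continuous_on UNIV \<phi>" unfolding \<phi>_def by (rule C_order_continuous[OF bump_C_order])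
  have zero: "\<phi> x = 0" if "S' \<in> grid_faces T \<Phi>" "S' \<noteq> S" "x \<in> S'" for S' x
    unfolding \<phi>_def using iso[OF that(1,2)] that(3) r(1) by (intro bump_outside) (auto simp: disjoint_iff)
  have cQ: "continuous_on UNIV (\<lambda>x. Q (fst x) (snd x))"
    unfolding Q by (intro poly_map_continuous[OF hexmap_poly[OF hexD(1)[OF H]], THEN continuous_on_compose2[where t = UNIV]] continuous_intros) auto
  have "0 = (\<Sum>H'\<in>T. orient (\<Phi> H') * flux (\<Phi> H') (\<lambda>\<xi>. ?n) \<phi>)" using test_flux_sum[OF test] by simp
  also have "\<dots> = (\<Sum>H'\<in>T. \<sigma> H' * integral square (\<lambda>(s', t'). \<phi> (Q s' t') * w s' t'))"
  proof (rule sum.cong[OF refl])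
    fix H' assume "H' \<in> T"
    have "orient (\<Phi> H') * flux (\<Phi> H') (\<lambda>\<xi>. ?n) \<phi> = element_face_flux D (\<Phi> H') (\<lambda>\<xi>. ?n) \<phi> S"
      by (rule flux_isolated[OF \<open>H' \<in> T\<close> S zero])
    also have "\<dots> = \<sigma> H' * integral square (\<lambda>(s', t'). \<phi> (Q s' t') * w s' t')"
      using flux[OF \<open>H' \<in> T\<close> poly_map_const, of "\<lambda>x. ?n" ?n \<phi>] cphi by (simp add: nn)
    finally show "orient (\<Phi> H') * flux (\<Phi> H') (\<lambda>\<xi>. ?n) \<phi> = \<sigma> H' * integral square (\<lambda>(s', t'). \<phi> (Q s' t') * w s' t')" .
  qed
  also have "\<dots> = (\<Sum>H'\<in>T. \<sigma> H') * integral square (\<lambda>(s', t'). \<phi> (Q s' t') * w s' t')"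
    by (rule sum_distrib_right[symmetric])
  finally show ?thesis
    using bump_face_integral_pos[OF cQ w st r(1), of ?n 0] unfolding \<phi>_def by simp
qed

text \<open>Exchanging the sums over elements and faces leaves, for each face, the sum of the signs times
  one integral. Either the sum of the signs vanishes, or the relative interior of the face lies
  outside the domain and the test function vanishes on it.\<close>
lemma normal_continuous_flux:
  assumes \<phi>: "\<phi> \<in> test_functions \<Omega>"
    and g: "\<And>H. H \<in> T \<Longrightarrow> poly_map (g H)"
    and f: "\<And>H \<xi>. H \<in> T \<Longrightarrow> \<xi> \<in> unit_cube \<Longrightarrow> f H (\<Phi> H \<xi>) = g H \<xi>"
    and trace: "\<And>S H H' x. S \<in> grid_faces T \<Phi> \<Longrightarrow> H \<in> at_face T \<Phi> S \<Longrightarrow> H' \<in> at_face T \<Phi> S \<Longrightarrow> x \<in> S \<Longrightarrow>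
        f H x \<bullet> face_normal D S = f H' x \<bullet> face_normal D S"
  shows "(\<Sum>H\<in>T. orient (\<Phi> H) * flux (\<Phi> H) (g H) \<phi>) = 0"
proof -
  have cphi: "continuous_on UNIV \<phi>" using test_function_C1[OF \<phi>] by (rule C_order_continuous)
  have "(\<Sum>H\<in>T. orient (\<Phi> H) * flux (\<Phi> H) (g H) \<phi>) =
     (\<Sum>H\<in>T. \<Sum>S\<in>grid_faces T \<Phi>. element_face_flux D (\<Phi> H) (g H) \<phi> S)"
    by (intro sum.cong refl flux_faces)
  also have "\<dots> = (\<Sum>S\<in>grid_faces T \<Phi>. \<Sum>H\<in>T. element_face_flux D (\<Phi> H) (g H) \<phi> S)"
    by (rule sum.swap)
  also have "\<dots> = 0"
  proof (rule sum.neutral, rule ballI)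
    fix S assume S: "S \<in> grid_faces T \<Phi>"
    let ?n = "face_normal D S"
    show "(\<Sum>H\<in>T. element_face_flux D (\<Phi> H) (g H) \<phi> S) = 0"
    proof (rule face_structure[OF S])
      fix Q w \<sigma> H l c
      assume H: "H \<in> T" and c: "c \<in> {0, 1}" and SH: "S = \<Phi> H ` local_face l c"
        and Q: "\<And>s t. Q s t = \<Phi> H (fpt l c s t)"
        and w: "continuous_on UNIV (\<lambda>x. w (fst x) (snd x) :: real)" "\<And>s t. s \<in> {0..1} \<Longrightarrow> t \<in> {0..1} \<Longrightarrow> w s t > 0"
        and "\<And>H'. H' \<in> at_face T \<Phi> S \<Longrightarrow> \<sigma> H' \<noteq> 0"
        and \<sigma>0: "\<And>H'. H' \<in> T - at_face T \<Phi> S \<Longrightarrow> \<sigma> H' = 0"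
        and flux: "\<And>H' g f \<phi>. H' \<in> T \<Longrightarrow> poly_map g \<Longrightarrow> (\<And>\<xi>. \<xi> \<in> unit_cube \<Longrightarrow> f (\<Phi> H' \<xi>) = g \<xi>) \<Longrightarrow> continuous_on UNIV \<phi> \<Longrightarrow>
           element_face_flux D (\<Phi> H') g \<phi> S =
             \<sigma> H' * integral square (\<lambda>(s, t). \<phi> (Q s t) * (f (Q s t) \<bullet> face_normal D S) * w s t)"
      let ?I = "\<lambda>H'. integral square (\<lambda>(s, t). \<phi> (Q s t) * (f H' (Q s t) \<bullet> ?n) * w s t)"
      have HS: "H \<in> at_face T \<Phi> S" unfolding at_face_iff using H c SH by blast
      have "element_face_flux D (\<Phi> H') (g H') \<phi> S = \<sigma> H' * ?I H" if H': "H' \<in> T" for H'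
      proof (cases "H' \<in> at_face T \<Phi> S")
        case False
        then show ?thesis using flux[OF H' g[OF H'] f[OF H'] cphi] \<sigma>0[of H'] H' by simp
      next
        case True
        have "?I H' = ?I H"
        proof (rule Henstock_Kurzweil_Integration.integral_cong)
          fix x assume "x \<in> square"
          then obtain s t where x: "x = (s, t)" and st: "s \<in> {0..1}" "t \<in> {0..1}" by (cases x) (auto simp: cbox_Pair_eq)
          have "Q s t \<in> S" unfolding Q SH by (rule imageI) (rule chart_in_face[OF axis_fpt_3(1) c st])
          from trace[OF S True HS this]
          show "(case x of (s, t) \<Rightarrow> \<phi> (Q s t) * (f H' (Q s t) \<bullet> ?n) * w s t) =
             (case x of (s, t) \<Rightarrow> \<phi> (Q s t) * (f H (Q s t) \<bullet> ?n) * w s t)" by (simp add: x)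
        qed
        then show ?thesis using flux[OF H' g[OF H'] f[OF H'] cphi] by simp
      qed
      then have sum: "(\<Sum>H'\<in>T. element_face_flux D (\<Phi> H') (g H') \<phi> S) = (\<Sum>H'\<in>T. \<sigma> H') * ?I H"
        by (simp add: sum_distrib_right)
      show ?thesis
      proof (cases "\<exists>s t. s \<in> {0<..<1} \<and> t \<in> {0<..<1} \<and> Q s t \<in> \<Omega>")
        case True
        then obtain s t where st: "s \<in> {0<..<1}" "t \<in> {0<..<1}" "Q s t \<in> \<Omega>" by blast
        have "(\<Sum>H'\<in>T. \<sigma> H') = 0"
          by (rule face_signs_cancel[where Q = Q and w = w and s = s and t = t, OF S H c SH]) (fact Q w flux st)+
        then show ?thesis using sum by simp
      next
        case False
        have "?I H = integral (box (0,0) (1,1)) (\<lambda>(s, t). \<phi> (Q s t) * (f H (Q s t) \<bullet> ?n) * w s t)"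
          by (rule integral_open_interval[symmetric])
        also have "\<dots> = integral (box (0,0) (1,1)) (\<lambda>x :: real * real. 0)"
        proof (rule Henstock_Kurzweil_Integration.integral_cong)
          fix x :: "real * real" assume "x \<in> box (0, 0) (1, 1)"
          then obtain s t where x: "x = (s, t)" and st: "s \<in> {0<..<1}" "t \<in> {0<..<1}"
            by (cases x) (auto simp: box_Pair)
          have "\<phi> (Q s t) = 0" using False st test_function_outside(1)[OF \<phi>] by blast
          then show "(case x of (s, t) \<Rightarrow> \<phi> (Q s t) * (f H (Q s t) \<bullet> ?n) * w s t) = 0" by (simp add: x)
        qed
        finally show ?thesis using sum by simp
      qed
    qed
  qed
  finally show ?thesis .
qed

end

section \<open>Piecewise functions as distributions\<close>

lemma Lp_space_bounded:
  assumes S: "S \<in> lmeasurable" and f: "f \<in> borel_measurable (lebesgue_on S)"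
    and B: "AE x in lebesgue_on S. norm (f x) \<le> B" and p: "p \<ge> 0"
  shows "f \<in> Lp_space p S"
proof -
  interpret finite_measure "lebesgue_on S" using S by (rule finite_measure_lebesgue_on)
  have "integrable (lebesgue_on S) (\<lambda>x. norm (f x) powr p)"
  proof (rule integrable_const_bound)
    show "AE x in lebesgue_on S. norm (norm (f x) powr p) \<le> B powr p"
      using B by (rule AE_mp) (intro AE_I2 impI, simp add: powr_mono2 p)
    show "(\<lambda>x. norm (f x) powr p) \<in> borel_measurable (lebesgue_on S)"
      using f by measurable
  qed
  then show ?thesis using f by (simp add: Lp_space_def)
qed

text \<open>Pointwise \<open>norm (f x) \<le> 1 + norm (f x) powr p\<close>, and constants are integrable over a set of
  finite measure.\<close>
lemma Lp_space_integrable: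
  assumes S: "S \<in> lmeasurable" and f: "f \<in> Lp_space p S" and p: "p \<ge> 1"
  shows "integrable (lebesgue_on S) f"
proof -
  interpret finite_measure "lebesgue_on S" using S by (rule finite_measure_lebesgue_on)
  have "norm (f x) \<le> norm (1 + norm (f x) powr p)" for x
  proof -
    have n: "norm (1 + norm (f x) powr p) = 1 + norm (f x) powr p" by simp
    show ?thesis
    proof (cases "norm (f x) \<le> 1")
      case True
      then show ?thesis unfolding n using powr_ge_zero[of "norm (f x)" p] by linarith
    next
      case False
      then have "norm (f x) powr 1 \<le> norm (f x) powr p" using p by (intro powr_mono) auto
      then show ?thesis unfolding n using False by simp
    qed
  qed
  then have "AE x in lebesgue_on S. norm (f x) \<le> norm (1 + norm (f x) powr p)" by (rule AE_I2)
  moreover have "integrable (lebesgue_on S) (\<lambda>x. 1 + norm (f x) powr p)"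
    using f by (intro Bochner_Integration.integrable_add) (simp_all add: Lp_space_def)
  moreover have "f \<in> borel_measurable (lebesgue_on S)" using f by (simp add: Lp_space_def)
  ultimately show ?thesis by (rule Bochner_Integration.integrable_bound[rotated 2])
qed

lemma test_function_bounded:
  assumes "\<phi> \<in> test_functions \<Omega>" obtains B where "\<And>x. \<bar>\<phi> x\<bar> \<le> B"
proof -
  let ?K = "closure {x. \<phi> x \<noteq> 0}"
  have c: "continuous_on ?K \<phi>"
    using C_order_continuous[OF test_function_C1[OF assms]] by (rule continuous_on_subset) simp
  have "compact ?K" using assms by (simp add: test_functions_def)
  then have "bounded (\<phi> ` ?K)" using c by (intro compact_imp_bounded compact_continuous_image)
  then obtain B where B: "\<forall>x\<in>?K. \<bar>\<phi> x\<bar> \<le> B" unfolding bounded_iff by auto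
  have "\<bar>\<phi> x\<bar> \<le> max B 0" for x
  proof (cases "\<phi> x = 0")
    case False
    then have "x \<in> ?K" using closure_subset[of "{x. \<phi> x \<noteq> 0}"] by auto
    then show ?thesis using B by force
  qed auto
  then show thesis by (rule that)
qed

lemma borel_measurable_lebesgue_on_continuous:
  "continuous_on UNIV (f :: real^3 \<Rightarrow> 'b::euclidean_space) \<Longrightarrow> f \<in> borel_measurable (lebesgue_on S)"
  by (intro measurable_restrict_space1 measurable_completion) (simp add: borel_measurable_continuous_onI)

lemma test_function_times_integrable:
  fixes f :: "real^3 \<Rightarrow> 'b::euclidean_space"
  assumes \<phi>: "\<phi> \<in> test_functions \<Omega>" and f: "integrable (lebesgue_on S) f"
  shows "integrable (lebesgue_on S) (\<lambda>x. \<phi> x *\<^sub>R f x)"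
proof -
  obtain B where B: "\<And>x. \<bar>\<phi> x\<bar> \<le> B" using test_function_bounded[OF \<phi>] by blast
  have m: "\<phi> \<in> borel_measurable (lebesgue_on S)"
    using C_order_continuous[OF test_function_C1[OF \<phi>]] by (rule borel_measurable_lebesgue_on_continuous)
  show ?thesis
  proof (rule Bochner_Integration.integrable_bound)
    show "integrable (lebesgue_on S) (\<lambda>x. B *\<^sub>R f x)" using f by simp
    show "AE x in lebesgue_on S. norm (\<phi> x *\<^sub>R f x) \<le> norm (B *\<^sub>R f x)"
    proof (rule AE_I2)
      fix x
      have "\<bar>\<phi> x\<bar> * norm (f x) \<le> \<bar>B\<bar> * norm (f x)"
        by (rule mult_right_mono) (use B[of x] in linarith, rule norm_ge_zero)
      then show "norm (\<phi> x *\<^sub>R f x) \<le> norm (B *\<^sub>R f x)" by simp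
    qed
  qed (use m f in auto)
qed

text \<open>A bounded linear map can be applied to the \<open>L\<^sup>p\<close> representative and commutes with the integral.\<close>
lemma H_space_bounded_linear_mono:
  assumes \<A>: "bounded_linear \<B>" and S: "\<Omega> \<in> lmeasurable" and p: "p \<ge> 1"
  shows "H_space \<A> p \<Omega> \<subseteq> H_space (\<lambda>A. \<B> (\<A> A)) p \<Omega>"
proof
  fix P assume "P \<in> H_space \<A> p \<Omega>"
  then obtain G where P: "P \<in> Lp_space p \<Omega>" and G: "G \<in> Lp_space p \<Omega>"
    and eq: "\<And>\<phi>. \<phi> \<in> test_functions \<Omega> \<Longrightarrow> \<A> (Curl_distr \<Omega> P \<phi>) = (\<integral>x. \<phi> x *\<^sub>R G x \<partial>lebesgue_on \<Omega>)"
    unfolding H_space_def by blast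
  interpret bounded_linear \<B> by fact
  obtain K where K: "K > 0" "\<And>x. norm (\<B> x) \<le> norm x * K" using pos_bounded by blast
  have m: "(\<lambda>x. \<B> (G x)) \<in> borel_measurable (lebesgue_on \<Omega>)"
  proof -
    have "G \<in> borel_measurable (lebesgue_on \<Omega>)" using G by (simp add: Lp_space_def)
    moreover have "\<B> \<in> borel_measurable borel"
      by (intro borel_measurable_continuous_onI linear_continuous_on assms(1))
    ultimately show ?thesis by (rule measurable_compose)
  qed
  have mp: "(\<lambda>x. norm (\<B> (G x)) powr p) \<in> borel_measurable (lebesgue_on \<Omega>)"
    using m by measurable
  have "integrable (lebesgue_on \<Omega>) (\<lambda>x. norm (\<B> (G x)) powr p)"
  proof (rule Bochner_Integration.integrable_bound)
    show "integrable (lebesgue_on \<Omega>) (\<lambda>x. norm (G x) powr p * K powr p)"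
      using G by (simp add: Lp_space_def)
    have "norm (\<B> (G x)) powr p \<le> norm (G x) powr p * K powr p" for x
    proof -
      have "norm (\<B> (G x)) powr p \<le> (norm (G x) * K) powr p"
        using p K(2) by (intro powr_mono2) simp_all
      also have "\<dots> = norm (G x) powr p * K powr p" by (rule powr_mult)
      finally show ?thesis .
    qed
    then show "AE x in lebesgue_on \<Omega>. norm (norm (\<B> (G x)) powr p) \<le> norm (norm (G x) powr p * K powr p)"
      by (intro AE_I2) (simp only: real_norm_def abs_of_nonneg powr_ge_zero mult_nonneg_nonneg)
  qed (rule mp)
  then have "(\<lambda>x. \<B> (G x)) \<in> Lp_space p \<Omega>" using m by (simp add: Lp_space_def)
  moreover have "\<B> (\<A> (Curl_distr \<Omega> P \<phi>)) = (\<integral>x. \<phi> x *\<^sub>R \<B> (G x) \<partial>lebesgue_on \<Omega>)" if \<phi>: "\<phi> \<in> test_functions \<Omega>" for \<phi>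
  proof -
    have "integrable (lebesgue_on \<Omega>) (\<lambda>x. \<phi> x *\<^sub>R G x)"
      using Lp_space_integrable[OF S G p] by (rule test_function_times_integrable[OF \<phi>])
    then have "(\<integral>x. \<B> (\<phi> x *\<^sub>R G x) \<partial>lebesgue_on \<Omega>) = \<B> (\<integral>x. \<phi> x *\<^sub>R G x \<partial>lebesgue_on \<Omega>)"
      by (rule integral_bounded_linear[OF assms(1)])
    then show ?thesis by (simp only: eq[OF \<phi>] scaleR)
  qed
  ultimately show "P \<in> H_space (\<lambda>A. \<B> (\<A> A)) p \<Omega>"
    unfolding H_space_def by (intro CollectI conjI P bexI[of _ "\<lambda>x. \<B> (G x)"] ballI)
qed

lemma bounded_linear_mat_dev: "bounded_linear mat_dev"
proof -
  have "linear mat_dev"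
    by (rule linearI) (auto simp: mat_dev_def trace_def vec_eq_iff sum_3 algebra_simps add_divide_distrib mat_def)
  then show ?thesis by (rule linear_conv_bounded_linear[THEN iffD1])
qed

context hex_grid
begin

text \<open>Only the open elements are used: they are disjoint, and the rest of the domain is a null set.\<close>
definition piecewise :: "((real^3) set \<Rightarrow> real^3 \<Rightarrow> 'b::euclidean_space) \<Rightarrow> real^3 \<Rightarrow> 'b" where
  "piecewise f x = (\<Sum>H\<in>T. indicator (elem_open H) x *\<^sub>R f H x)"

lemma \<Omega>_lmeasurable: "\<Omega> \<in> lmeasurable" "\<Omega> \<in> sets lebesgue"
  using bounded_\<Omega> open_\<Omega> lmeasurable_open by (auto simp: fmeasurableD)

lemma piecewise_integral:
  assumes "\<And>H. H \<in> T \<Longrightarrow> continuous_on H (f H)"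
  shows "integrable (lebesgue_on \<Omega>) (piecewise f)"
    and "(\<integral>x. piecewise f x \<partial>lebesgue_on \<Omega>) = (\<Sum>H\<in>T. integral H (f H))"
proof -
  have c: "continuous_on (\<Phi> H ` unit_cube) (f H)" if "H \<in> T" for H using assms[OF that] hexD(3)[OF that] by simp
  have i: "integrable (lebesgue_on \<Omega>) (\<lambda>x. indicator (elem_open H) x *\<^sub>R f H x)" if "H \<in> T" for H
    by (rule indicator_hex(1)[OF hexD(1)[OF that] c[OF that] \<Omega>_lmeasurable(2) elem_open_\<Omega>[OF that]])
  have "(\<integral>x. indicator (elem_open H) x *\<^sub>R f H x \<partial>lebesgue_on \<Omega>) = integral H (f H)" if "H \<in> T" for H
    using indicator_hex(2)[OF hexD(1)[OF that] c[OF that] \<Omega>_lmeasurable(2) elem_open_\<Omega>[OF that]] hexD(3)[OF that] by simp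
  with i show "integrable (lebesgue_on \<Omega>) (piecewise f)"
    "(\<integral>x. piecewise f x \<partial>lebesgue_on \<Omega>) = (\<Sum>H\<in>T. integral H (f H))"
    unfolding piecewise_def by (auto simp: Bochner_Integration.integral_sum)
qed

lemma piecewise_on:
  assumes "H \<in> T" "x \<in> elem_open H" shows "piecewise f x = f H x"
proof -
  have "indicator (elem_open H') x *\<^sub>R f H' x = 0" if "H' \<in> T - {H}" for H'
    using elem_open_disjoint[OF assms(1), of H'] elem_open_subset[of H'] that assms(2) by (auto simp: indicator_def)
  then have "piecewise f x = (\<Sum>H'\<in>{H}. indicator (elem_open H') x *\<^sub>R f H' x)"
    unfolding piecewise_def using assms finite_T by (intro sum.mono_neutral_right) auto
  then show ?thesis using assms(2) by simp
qed

lemma piecewise_bounded: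
  assumes "\<And>H. H \<in> T \<Longrightarrow> continuous_on H (f H)"
  obtains B where "\<And>x. norm (piecewise f x) \<le> B"
proof -
  have "\<exists>B. \<forall>x\<in>H. norm (f H x) \<le> B" if "H \<in> T" for H
  proof -
    have "compact H" using compact_hex[OF hexD(1)[OF that]] hexD(3)[OF that] by simp
    then have "bounded (f H ` H)" using assms[OF that] by (intro compact_imp_bounded compact_continuous_image)
    then show ?thesis unfolding bounded_iff by blast
  qed
  then obtain B where B: "\<And>H x. H \<in> T \<Longrightarrow> x \<in> H \<Longrightarrow> norm (f H x) \<le> B H" by metis
  have "norm (piecewise f x) \<le> (\<Sum>H\<in>T. \<bar>B H\<bar>)" for x
    unfolding piecewise_def
  proof (rule sum_norm_le)
    fix H assume H: "H \<in> T"
    show "norm (indicator (elem_open H) x *\<^sub>R f H x) \<le> \<bar>B H\<bar>"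
      using B[OF H, of x] elem_open_subset[OF H] by (auto simp: indicator_def)
  qed
  then show thesis by (rule that)
qed

lemma piecewise_Lp:
  fixes f :: "(real^3) set \<Rightarrow> real^3 \<Rightarrow> real^3^3"
  assumes "\<And>H. H \<in> T \<Longrightarrow> continuous_on H (f H)" "p \<ge> 1"
  shows "piecewise f \<in> Lp_space p \<Omega>"
proof -
  obtain B where "\<And>x. norm (piecewise f x) \<le> B" using piecewise_bounded[OF assms(1)] by blast
  then show ?thesis using \<Omega>_lmeasurable(1) piecewise_integral(1)[OF assms(1)] assms(2)
    by (intro Lp_space_bounded[where B = B]) auto
qed

lemma AE_piecewise:
  assumes "\<And>H. H \<in> T \<Longrightarrow> AE x in lebesgue_on (H \<inter> \<Omega>). U x = f H x"
  shows "AE x in lebesgue_on \<Omega>. U x = piecewise f x"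
proof -
  have HL: "H \<in> sets lebesgue" if "H \<in> T" for H
  proof -
    have "compact H" using compact_hex[OF hexD(1)[OF that]] hexD(3)[OF that] by simp
    then show ?thesis by (auto intro!: sets_completionI_sets borel_closed compact_imp_closed)
  qed
  have "AE x in lebesgue. x \<in> H \<inter> \<Omega> \<longrightarrow> U x = f H x" if H: "H \<in> T" for H
  proof -
    have "H \<inter> \<Omega> \<in> sets lebesgue" using HL[OF H] \<Omega>_lmeasurable(2) by (rule sets.Int)
    then show ?thesis using assms[OF H] by (subst (asm) AE_restrict_space_iff) auto
  qed
  then have "AE x in lebesgue. \<forall>H\<in>T. x \<in> H \<inter> \<Omega> \<longrightarrow> U x = f H x"
    by (rule AE_finite_allI[OF finite_T])
  moreover have "AE x in lebesgue. \<forall>H\<in>T. x \<notin> \<Phi> H ` (unit_cube - open_cube)"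
    using negligible_hex_boundary[OF hexD(1)]
    by (intro AE_finite_allI[OF finite_T] AE_not_in) (auto simp: negligible_iff_null_sets)
  ultimately have "AE x in lebesgue. x \<in> \<Omega> \<longrightarrow> U x = piecewise f x"
  proof eventually_elim
    case (elim x)
    show ?case
    proof
      assume x: "x \<in> \<Omega>"
      then obtain H where H: "H \<in> T" "x \<in> H" unfolding \<Omega>_eq using interior_subset by blast
      then have "x \<in> elem_open H" using elim(2) hexD(3)[OF H(1)] by blast
      then have "piecewise f x = f H x" by (rule piecewise_on[OF H(1)])
      moreover have "U x = f H x" using elim(1) H x by blast
      ultimately show "U x = piecewise f x" by simp
    qed
  qed
  then show ?thesis using \<Omega>_lmeasurable(2) by (subst AE_restrict_space_iff) auto
qed

text \<open>On each element \<open>d\<close> is the divergence of \<open>f\<close>, and the fluxes left over by the integrations by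
  parts cancel.\<close>
lemma piecewise_divergence:
  assumes g: "\<And>H. H \<in> T \<Longrightarrow> poly_map (g H)"
    and f: "\<And>H \<xi>. H \<in> T \<Longrightarrow> \<xi> \<in> unit_cube \<Longrightarrow> f H (\<Phi> H \<xi>) = g H \<xi>"
    and trace: "\<And>S H H' x. S \<in> grid_faces T \<Phi> \<Longrightarrow> H \<in> at_face T \<Phi> S \<Longrightarrow> H' \<in> at_face T \<Phi> S \<Longrightarrow> x \<in> S \<Longrightarrow>
        f H x \<bullet> face_normal D S = f H' x \<bullet> face_normal D S"
  obtains d where "\<And>H. H \<in> T \<Longrightarrow> continuous_on H (d H)"
    "\<And>\<phi>. \<phi> \<in> test_functions \<Omega> \<Longrightarrow>
      (\<integral>x. piecewise (\<lambda>H x. f H x \<bullet> grad \<phi> x) x \<partial>lebesgue_on \<Omega>) = - (\<integral>x. \<phi> x * piecewise d x \<partial>lebesgue_on \<Omega>)"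
proof -
  define d where "d H x = (let \<xi> = inv_into unit_cube (\<Phi> H) x in fdiv (\<Phi> H) (g H) \<xi> / jdet (\<Phi> H) \<xi>)" for H x
  have dd: "d H (\<Phi> H \<xi>) = fdiv (\<Phi> H) (g H) \<xi> / jdet (\<Phi> H) \<xi>" if "H \<in> T" "\<xi> \<in> unit_cube" for H \<xi>
  proof -
    have "inj_on (\<Phi> H) unit_cube" using hexD(1)[OF that(1)] by (simp add: hexmap_def)
    then have "inv_into unit_cube (\<Phi> H) (\<Phi> H \<xi>) = \<xi>" using that(2) by (rule inv_into_f_f)
    then show ?thesis by (simp add: d_def)
  qed
  have C0: "C_order 1 (\<lambda>x. 0)" by (rule C_order_const)
  have cf: "continuous_on H (f H)" "continuous_on H (d H)" if "H \<in> T" for H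
    using element_integration_by_parts(2,3)[OF hexD(1)[OF that] g[OF that] C0 f[OF that] dd[OF that]] hexD(3)[OF that]
    by auto
  have "(\<integral>x. piecewise (\<lambda>H x. f H x \<bullet> grad \<phi> x) x \<partial>lebesgue_on \<Omega>) = - (\<integral>x. \<phi> x * piecewise d x \<partial>lebesgue_on \<Omega>)"
    if \<phi>: "\<phi> \<in> test_functions \<Omega>" for \<phi>
  proof -
    have C: "C_order 1 \<phi>" using \<phi> by (rule test_function_C1)
    have cphi: "continuous_on S \<phi>" "continuous_on S (grad \<phi>)" for S
      using C_order_continuous[OF C] grad_continuous[of 0 \<phi>] C by (auto intro: continuous_on_subset)
    have "(\<integral>x. piecewise (\<lambda>H x. f H x \<bullet> grad \<phi> x) x \<partial>lebesgue_on \<Omega>) = (\<Sum>H\<in>T. integral H (\<lambda>x. f H x \<bullet> grad \<phi> x))"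
      by (intro piecewise_integral(2) continuous_intros cf cphi)
    moreover have "(\<integral>x. piecewise (\<lambda>H x. \<phi> x * d H x) x \<partial>lebesgue_on \<Omega>) = (\<Sum>H\<in>T. integral H (\<lambda>x. \<phi> x * d H x))"
      by (intro piecewise_integral(2) continuous_intros cf cphi)
    moreover have "piecewise (\<lambda>H x. \<phi> x * d H x) x = \<phi> x * piecewise d x" for x
      by (simp add: piecewise_def sum_distrib_left algebra_simps)
    moreover have "(\<Sum>H\<in>T. integral H (\<lambda>x. f H x \<bullet> grad \<phi> x)) + (\<Sum>H\<in>T. integral H (\<lambda>x. \<phi> x * d H x)) =
       (\<Sum>H\<in>T. orient (\<Phi> H) * flux (\<Phi> H) (g H) \<phi>)"
      unfolding sum.distrib[symmetric]
    proof (rule sum.cong[OF refl])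
      fix H assume H: "H \<in> T"
      show "integral H (\<lambda>x. f H x \<bullet> grad \<phi> x) + integral H (\<lambda>x. \<phi> x * d H x) = orient (\<Phi> H) * flux (\<Phi> H) (g H) \<phi>"
        using element_integration_by_parts(1)[OF hexD(1)[OF H] g[OF H] C f[OF H] dd[OF H]] hexD(3)[OF H] by simp
    qed
    ultimately show ?thesis using normal_continuous_flux[OF \<phi> g f trace] by simp
  qed
  with cf(2) show thesis by (rule that)
qed

end

section \<open>Symmetric tangential traces\<close>

text \<open>The bilinear form of the matrix \<open>2 sym (M \<times> n)\<close>, where \<open>M \<times> n\<close> is the row-wise cross product. It
  is the trace that has to be continuous for \<open>sym Curl\<close> to be a function.\<close>
definition sym_trace :: "real^3 \<Rightarrow> real^3^3 \<Rightarrow> real^3 \<Rightarrow> real^3 \<Rightarrow> real" where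
  "sym_trace n M u v = bil u M (n \<times> v) + bil v M (n \<times> u)"

lemma bil_linear:
  "bil (u + u') M v = bil u M v + bil u' M v" "bil (r *\<^sub>R u) M v = r * bil u M v"
  "bil u M (v + v') = bil u M v + bil u M v'" "bil u M (r *\<^sub>R v) = r * bil u M v"
  "bil u M (- v) = - bil u M v" "bil u M 0 = 0" "bil 0 M v = 0"
  "bil u (M - M') v = bil u M v - bil u M' v"
proof -
  have l: "linear (\<lambda>v. M *v v)" by (rule matrix_vector_mul_linear)
  show "bil u M (v + v') = bil u M v + bil u M v'" "bil u M (r *\<^sub>R v) = r * bil u M v"
    "bil u M (- v) = - bil u M v" "bil u M 0 = 0"
    using linear_add[OF l] linear_scale[OF l] linear_neg[OF l] linear_0[OF l] by (simp_all add: bil_def inner_add_right)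
  show "bil (u + u') M v = bil u M v + bil u' M v" "bil (r *\<^sub>R u) M v = r * bil u M v"
    "bil 0 M v = 0" "bil u (M - M') v = bil u M v - bil u M' v"
    by (simp_all add: bil_def inner_add_left matrix_vector_mult_diff_rdistrib inner_diff_right)
qed

lemma sym_trace_diff: "sym_trace n (M - M') u v = sym_trace n M u v - sym_trace n M' u v"
  by (simp add: sym_trace_def bil_linear)

lemma sym_trace_commute: "sym_trace n M u v = sym_trace n M v u"
  by (simp add: sym_trace_def)

lemma sym_trace_scale: "sym_trace (r *\<^sub>R n) M u v = r * sym_trace n M u v"
  by (simp add: sym_trace_def cross_mult_left bil_linear distrib_left)

lemma subspace_sym_trace: "subspace {u. \<forall>v\<in>A. sym_trace n M u v = 0}"
proof -
  have "sym_trace n M (u + u') v = sym_trace n M u v + sym_trace n M u' v"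
    "sym_trace n M (r *\<^sub>R u) v = r * sym_trace n M u v" "sym_trace n M 0 v = 0" for u u' v r
    by (simp_all add: sym_trace_def bil_linear cross_add_right cross_mult_right distrib_left)
  then show ?thesis by (simp add: subspace_def)
qed

lemma sym_trace_eq_0:
  assumes span: "span {x, y, z} = UNIV"
    and zero: "sym_trace n M x x = 0" "sym_trace n M y y = 0" "sym_trace n M z z = 0"
      "sym_trace n M x y = 0" "sym_trace n M x z = 0" "sym_trace n M y z = 0"
  shows "sym_trace n M u v = 0"
proof -
  have 1: "sym_trace n M u v = 0"
    if "sym_trace n M x v = 0" "sym_trace n M y v = 0" "sym_trace n M z v = 0" for u v
  proof -
    have "span {x, y, z} \<subseteq> {u. \<forall>v\<in>{v}. sym_trace n M u v = 0}"
      by (rule span_minimal[OF _ subspace_sym_trace]) (simp add: that)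
    then have "u \<in> {u. \<forall>v\<in>{v}. sym_trace n M u v = 0}"
      unfolding span by (rule subsetD) (rule UNIV_I)
    then show ?thesis by simp
  qed
  have sym: "sym_trace n M y x = 0" "sym_trace n M z x = 0" "sym_trace n M z y = 0"
    by (rule trans[OF sym_trace_commute], rule zero)+
  have 2: "sym_trace n M x w = 0" "sym_trace n M y w = 0" "sym_trace n M z w = 0" for w
    by (rule trans[OF sym_trace_commute], rule 1, rule zero sym, rule zero sym, rule zero sym)+
  show ?thesis by (rule 1) (rule 2)+
qed

lemma triple_expansion:
  fixes x y z v :: "real^3"
  shows "(x \<bullet> (y \<times> z)) *\<^sub>R v = (v \<bullet> (y \<times> z)) *\<^sub>R x + (v \<bullet> (z \<times> x)) *\<^sub>R y + (v \<bullet> (x \<times> y)) *\<^sub>R z"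
  by (simp add: vec_eq_iff forall_3 cross3_simps inner_vec_def sum_3 algebra_simps)

lemma span_triple:
  fixes x y z :: "real^3"
  assumes "x \<bullet> (y \<times> z) \<noteq> 0" shows "span {x, y, z} = UNIV"
proof -
  have "v \<in> span {x, y, z}" for v
  proof -
    have "(x \<bullet> (y \<times> z)) *\<^sub>R v \<in> span {x, y, z}"
      unfolding triple_expansion[of x y z v] by (intro span_add span_scale span_base) auto
    then have "(1 / (x \<bullet> (y \<times> z))) *\<^sub>R ((x \<bullet> (y \<times> z)) *\<^sub>R v) \<in> span {x, y, z}" by (rule span_scale)
    then show ?thesis using assms by simp
  qed
  then show ?thesis by blast
qed

lemma span_independent_3:
  fixes B :: "(real^3) set"
  assumes "independent B" "card B = 3" shows "span B = UNIV"
  using assms dim_eq_full[of B] by (simp add: dim_eq_card_independent)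

section \<open>Polynomials in local coordinates\<close>

lemma poly_Q_coordinate:
  assumes "poly_Q k (f :: real^3 \<Rightarrow> real)"
  obtains p where "degree p \<le> k" "\<And>r. f (upd \<xi> m r) = poly p r"
proof -
  from assms obtain C where C: "\<And>\<xi>. f \<xi> = (\<Sum>a\<le>k. \<Sum>b\<le>k. \<Sum>c\<le>k. ((\<xi>$1)^a * (\<xi>$2)^b * (\<xi>$3)^c) * C a b c)"
    unfolding poly_Q_def by auto
  \<comment> \<open>\<open>e\<close> is the exponent of the moving coordinate, \<open>co\<close> collects the powers of the fixed ones.\<close>
  define e where "e a b c = (if m = 1 then a else if m = 2 then b else c)" for a b c :: nat
  define co where "co a b c = (if m = 1 then 1 else \<xi>$1 ^ a) * (if m = 2 then 1 else \<xi>$2 ^ b) * (if m = 3 then 1 else \<xi>$3 ^ c) * C a b c" for a b c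
  define p where "p = (\<Sum>a\<le>k. \<Sum>b\<le>k. \<Sum>c\<le>k. monom (co a b c) (e a b c))"
  have "degree p \<le> k"
    unfolding p_def by (intro degree_sum_le) (auto intro!: order_trans[OF degree_monom_le] simp: e_def)
  moreover have "f (upd \<xi> m r) = poly p r" for r
  proof -
    have "((upd \<xi> m r $1)^a * (upd \<xi> m r $2)^b * (upd \<xi> m r $3)^c) * C a b c = co a b c * r ^ e a b c" for a b c
      by (cases m rule: three_cases) (auto simp: upd_def co_def e_def)
    then show ?thesis by (simp add: C p_def poly_sum poly_monom)
  qed
  ultimately show thesis by (rule that)
qed

text \<open>Each parameter of a chart runs along a single local coordinate, forwards or backwards.\<close>
lemma poly_Q_chart:
  assumes "poly_Q k (f :: real^3 \<Rightarrow> real)" "i \<noteq> l"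
  shows "\<exists>p. degree p \<le> k \<and> (\<forall>s. f (chart l c i a b s t) = poly p s)"
    and "\<exists>p. degree p \<le> k \<and> (\<forall>t. f (chart l c i a b s t) = poly p t)"
proof -
  obtain j where j: "j \<noteq> l" "j \<noteq> i" using third_axis[OF assms(2)] .
  have flip: "\<exists>q. degree q \<le> k \<and> (\<forall>r. poly p (if a then 1 - r else r) = poly q r)" if "degree p \<le> k" for p :: "real poly" and a
  proof (cases a)
    case True
    have "degree (pcompose p [:1, -1:]) \<le> k" using that degree_pcompose_le[of p "[:1, -1:]"] by simp
    moreover have "poly p (1 - r) = poly (pcompose p [:1, -1:]) r" for r by (simp add: poly_pcompose)
    ultimately show ?thesis using True by auto
  qed (use that in auto)
  obtain p where p: "degree p \<le> k" "\<And>r. f (upd (chart l c i a b 0 t) i r) = poly p r"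
    using poly_Q_coordinate[OF assms(1)] by blast
  from flip[OF p(1), of a] obtain q where q: "degree q \<le> k" "\<And>r. poly p (if a then 1 - r else r) = poly q r" by blast
  have "f (chart l c i a b s t) = poly q s" for s
    unfolding chart_upd(1)[OF assms(2) j, of c a b s t 0] p(2) q(2) ..
  with q(1) show "\<exists>p. degree p \<le> k \<and> (\<forall>s. f (chart l c i a b s t) = poly p s)" by blast
  obtain p where p: "degree p \<le> k" "\<And>r. f (upd (chart l c i a b s 0) j r) = poly p r"
    using poly_Q_coordinate[OF assms(1)] by blast
  from flip[OF p(1), of b] obtain q where q: "degree q \<le> k" "\<And>r. poly p (if b then 1 - r else r) = poly q r" by blast
  have "f (chart l c i a b s t) = poly q t" for t
    unfolding chart_upd(2)[OF assms(2) j, of c a b s t 0] p(2) q(2) ..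
  with q(1) show "\<exists>p. degree p \<le> k \<and> (\<forall>t. f (chart l c i a b s t) = poly p t)" by blast
qed

text \<open>A nonzero polynomial of degree at most \<open>k\<close> has fewer than \<open>k + 1\<close> roots.\<close>
lemma poly_lagrange_eq_0:
  assumes "degree p \<le> k" "k \<ge> 1" "\<And>j. j \<le> k \<Longrightarrow> poly p (real j / real k) = 0"
  shows "p = (0 :: real poly)"
proof (rule ccontr)
  assume "p \<noteq> 0"
  then have fin: "finite {x. poly p x = 0}" and "card {x. poly p x = 0} \<le> degree p"
    by (auto simp: poly_roots_finite card_poly_roots_bound)
  moreover have "(\<lambda>j. real j / real k) ` {..k} \<subseteq> {x. poly p x = 0}" using assms(3) by auto
  then have "card ((\<lambda>j. real j / real k) ` {..k}) \<le> card {x. poly p x = 0}" by (rule card_mono[OF fin])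
  moreover have "card ((\<lambda>j. real j / real k) ` {..k}) = k + 1"
    using assms(2) by (subst card_image) (auto simp: inj_on_def)
  ultimately show False using assms(1) by linarith
qed

lemma poly2_lagrange_eq_0:
  fixes f :: "real \<Rightarrow> real \<Rightarrow> real"
  assumes "\<And>t. \<exists>p. degree p \<le> k \<and> (\<forall>s. f s t = poly p s)" "\<And>s. \<exists>p. degree p \<le> k \<and> (\<forall>t. f s t = poly p t)"
    and k: "k \<ge> 1" and zero: "\<And>i j. i \<le> k \<Longrightarrow> j \<le> k \<Longrightarrow> f (real i / real k) (real j / real k) = 0"
  shows "f s t = 0"
proof -
  have 1: "f s (real j / real k) = 0" if "j \<le> k" for j s
  proof -
    obtain p where p: "degree p \<le> k" "\<And>s. f s (real j / real k) = poly p s" using assms(1) by metis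
    have "p = 0" using zero[OF _ that] p(2) by (intro poly_lagrange_eq_0[OF p(1) k]) simp
    then show ?thesis using p(2) by simp
  qed
  obtain p where p: "degree p \<le> k" "\<And>t. f s t = poly p t" using assms(2) by metis
  have "p = 0" using 1 p(2) by (intro poly_lagrange_eq_0[OF p(1) k]) metis
  then show ?thesis using p(2) by simp
qed

section \<open>Edges and vertices of an element\<close>

lemma hex_edge_segment:
  assumes F: "trilinear F" and v: "\<And>j. v $ j \<in> {0, 1}"
  shows "closed_segment (F (upd v i 0)) (F (upd v i 1)) \<in> hex_edges F"
proof -
  have "{\<xi> \<in> unit_cube. \<forall>j. j \<noteq> i \<longrightarrow> \<xi> $ j = v $ j} = upd v i ` {0..1}"
  proof (intro set_eqI iffI)
    fix \<xi> assume "\<xi> \<in> {\<xi> \<in> unit_cube. \<forall>j. j \<noteq> i \<longrightarrow> \<xi> $ j = v $ j}"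
    then have "\<xi> = upd v i (\<xi> $ i)" "\<xi> $ i \<in> {0..1}" by (auto simp: upd_def vec_eq_iff)
    then show "\<xi> \<in> upd v i ` {0..1}" by (rule image_eqI)
  next
    fix \<xi> assume "\<xi> \<in> upd v i ` {0..1}"
    then obtain r where r: "\<xi> = upd v i r" "0 \<le> r" "r \<le> 1" by auto
    have "0 \<le> v $ j \<and> v $ j \<le> 1" for j using v[of j] by auto
    then show "\<xi> \<in> {\<xi> \<in> unit_cube. \<forall>j. j \<noteq> i \<longrightarrow> \<xi> $ j = v $ j}"
      using r by (simp add: upd_def)
  qed
  moreover have "F ` upd v i ` {0..1} = closed_segment (F (upd v i 0)) (F (upd v i 1))"
  proof -
    have "(\<lambda>r. F (upd v i r)) = (\<lambda>r. (1 - r) *\<^sub>R F (upd v i 0) + r *\<^sub>R F (upd v i 1))"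
      by (rule ext) (rule F[unfolded trilinear_def, rule_format])
    then show ?thesis unfolding closed_segment_image_interval image_image by (rule arg_cong)
  qed
  ultimately show ?thesis unfolding hex_edges_def using v by (intro CollectI exI[of _ i] exI[of _ v]) auto
qed

lemma chart_edges:
  assumes F: "trilinear F" and i: "i \<noteq> l" and c: "c \<in> {0, 1}"
  shows "s \<in> {0, 1} \<Longrightarrow> closed_segment (F (chart l c i a b s 0)) (F (chart l c i a b s 1)) \<in> hex_edges F"
    and "t \<in> {0, 1} \<Longrightarrow> closed_segment (F (chart l c i a b 0 t)) (F (chart l c i a b 1 t)) \<in> hex_edges F"
proof -
  obtain j where j: "j \<noteq> l" "j \<noteq> i" using third_axis[OF i] .
  have v: "chart l c i a b s t $ m \<in> {0, 1}" if "s \<in> {0, 1}" "t \<in> {0, 1}" for s t m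
    using that c by (auto simp: chart_def)
  have edge: "closed_segment (F (upd w m (if b then 1 - 0 else 0))) (F (upd w m (if b then 1 - 1 else 1))) \<in> hex_edges F"
    if "\<And>j. w $ j \<in> {0, 1}" for w m and b :: bool
  proof -
    have 1: "closed_segment (F (upd w m 0)) (F (upd w m 1)) \<in> hex_edges F" by (rule hex_edge_segment[OF F that])
    then have 2: "closed_segment (F (upd w m 1)) (F (upd w m 0)) \<in> hex_edges F"
      by (subst closed_segment_commute)
    show ?thesis by (cases b) (use 1 2 in simp_all)
  qed
  show "closed_segment (F (chart l c i a b s 0)) (F (chart l c i a b s 1)) \<in> hex_edges F" if "s \<in> {0, 1}"
  proof -
    define w where "w = chart l c i a b s 0"
    have e: "chart l c i a b s 0 = upd w j (if b then 1 - 0 else 0)" "chart l c i a b s 1 = upd w j (if b then 1 - 1 else 1)"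
      unfolding w_def by (rule chart_upd(2)[OF i j])+
    show ?thesis unfolding e by (rule edge) (unfold w_def, rule v, use that in auto)
  qed
  show "closed_segment (F (chart l c i a b 0 t)) (F (chart l c i a b 1 t)) \<in> hex_edges F" if "t \<in> {0, 1}"
  proof -
    define w where "w = chart l c i a b 0 t"
    have e: "chart l c i a b 0 t = upd w i (if a then 1 - 0 else 0)" "chart l c i a b 1 t = upd w i (if a then 1 - 1 else 1)"
      unfolding w_def by (rule chart_upd(1)[OF i j])+
    show ?thesis unfolding e by (rule edge) (unfold w_def, rule v, use that in auto)
  qed
qed

lemma tangent_trilinear:
  assumes "poly_map F" "trilinear F"
  shows "tangent F m \<xi> = F (upd \<xi> m 1) - F (upd \<xi> m 0)"
proof -
  have T: "(\<Sum>k\<in>UNIV. (h *\<^sub>R axis m 1 :: real^3) $ k *\<^sub>R tangent F k \<xi>) = h *\<^sub>R tangent F m \<xi>" for h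
    by (simp add: axis_def if_distrib[of "\<lambda>c. _ * c"] if_distrib[of "\<lambda>c. c *\<^sub>R _"] cong: if_cong)
  have u: "upd \<xi> m r = upd \<xi> m 0 + r *\<^sub>R axis m 1" for r
    by (simp add: upd_def vec_eq_iff axis_def)
  have x: "upd \<xi> m 0 + (\<xi> $ m) *\<^sub>R axis m 1 = \<xi>" by (simp add: upd_def vec_eq_iff axis_def)
  have "((\<lambda>r. upd \<xi> m 0 + r *\<^sub>R axis m 1) has_derivative (\<lambda>h. h *\<^sub>R axis m 1)) (at (\<xi> $ m))"
    by (auto intro!: derivative_eq_intros)
  from has_derivative_compose[OF this, unfolded x, OF poly_map_derivative[OF assms(1)]]
  have d: "((\<lambda>r. F (upd \<xi> m r)) has_derivative (\<lambda>h. h *\<^sub>R tangent F m \<xi>)) (at (\<xi> $ m))"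
    unfolding T u[symmetric] .
  have e: "(\<lambda>r. F (upd \<xi> m r)) = (\<lambda>r. (1 - r) *\<^sub>R F (upd \<xi> m 0) + r *\<^sub>R F (upd \<xi> m 1))"
    by (rule ext) (rule assms(2)[unfolded trilinear_def, rule_format])
  have "((\<lambda>r. (1 - r) *\<^sub>R F (upd \<xi> m 0) + r *\<^sub>R F (upd \<xi> m 1)) has_derivative (\<lambda>h. h *\<^sub>R (F (upd \<xi> m 1) - F (upd \<xi> m 0)))) (at (\<xi> $ m))"
    by (auto intro!: derivative_eq_intros simp: algebra_simps)
  from has_derivative_unique[OF d[unfolded e] this] have "(\<lambda>h. h *\<^sub>R tangent F m \<xi>) = (\<lambda>h. h *\<^sub>R (F (upd \<xi> m 1) - F (upd \<xi> m 0)))" .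
  from fun_cong[OF this, of 1] show ?thesis by simp
qed

text \<open>The tangents at a point form a basis, because the Jacobian determinant does not vanish.\<close>
lemma tangents_span:
  assumes "hexmap F" "\<xi> \<in> unit_cube" "\<And>m. n \<bullet> tangent F m \<xi> = 0"
  shows "n = 0"
proof -
  have "jdet F \<xi> * (n \<bullet> n) = 0"
    unfolding jdet_expansion[OF hexmap_poly[OF assms(1)]] by (simp add: assms(3))
  then show ?thesis using assms(1,2) by (auto simp: hexmap_def)
qed

text \<open>The open side of the cube is mapped injectively into the affine hull of the face, which has
  dimension at most two; by invariance of domain its image is open there.\<close>
lemma inner_face_rel_interior:
  assumes F: "hexmap F" and c: "c \<in> {0, 1}" and cop: "coplanar (F ` local_face l c)"
    and st: "s \<in> {0<..<1}" "t \<in> {0<..<1}"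
  shows "F (fpt l c s t) \<in> rel_interior (F ` local_face l c)"
proof -
  let ?U = "{\<xi> :: real^3. \<xi> $ l = c}" and ?S = "F ` local_face l c"
  let ?O = "?U \<inter> {\<xi>. 0 < \<xi> $ (l+1) \<and> \<xi> $ (l+1) < 1 \<and> 0 < \<xi> $ (l+2) \<and> \<xi> $ (l+2) < 1}"
  have sub: "?O \<subseteq> local_face l c"
  proof
    fix \<xi> assume \<xi>: "\<xi> \<in> ?O"
    have "\<forall>m. 0 \<le> \<xi> $ m \<and> \<xi> $ m \<le> 1" by (subst forall_axis[of _ l]) (use \<xi> c in auto)
    then show "\<xi> \<in> local_face l c" using \<xi> unfolding local_face_def by blast
  qed
  have subc: "local_face l c \<subseteq> unit_cube" unfolding local_face_def by blast
  have U: "?U = {\<xi>. axis l 1 \<bullet> \<xi> = c}" by (simp add: inner_axis')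
  have "openin (top_of_set (affine hull ?S)) (F ` ?O)"
  proof (rule invariance_of_domain_affine_sets)
    show "openin (top_of_set ?U) ?O"
      by (intro openin_open_Int open_Collect_conj open_Collect_less continuous_intros)
    show "affine ?U" unfolding U by (rule affine_hyperplane)
    have "aff_dim ?U = 2" unfolding U by (subst aff_dim_hyperplane) (auto simp: axis_eq_0_iff)
    moreover have "aff_dim ?S \<le> 2"
    proof -
      obtain u v w where "?S \<subseteq> affine hull {u, v, w}" using cop unfolding coplanar_def by blast
      then have "aff_dim ?S \<le> aff_dim {u, v, w}" by (metis aff_dim_affine_hull aff_dim_subset)
      also have "\<dots> \<le> int (card {u, v, w}) - 1" by (rule aff_dim_le_card) simp
      also have "card {u, v, w} \<le> 3" using card_insert_le_m1[of 3 "{v, w}" u] card_insert_le_m1[of 2 "{w}" v] by simp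
      finally show ?thesis by simp
    qed
    ultimately show "aff_dim (affine hull ?S) \<le> aff_dim ?U" by simp
    show "continuous_on ?O F" using F by (intro poly_map_continuous hexmap_poly)
    show "F \<in> ?O \<rightarrow> affine hull ?S" using sub hull_subset[of ?S affine] by blast
    have "inj_on F unit_cube" using F by (simp add: hexmap_def)
    then show "inj_on F ?O" by (rule inj_on_subset) (rule order_trans[OF sub subc])
  qed auto
  then have "F ` ?O \<subseteq> rel_interior ?S" using sub by (intro rel_interior_maximal) auto
  moreover have "fpt l c s t \<in> ?O" using st by (simp add: fpt_nth)
  ultimately show ?thesis by blast
qed

section \<open>Continuity of the symmetric tangential traces\<close>

lemma coincide_at:
  "coincide A q \<Longrightarrow> H \<in> A \<Longrightarrow> H' \<in> A \<Longrightarrow> q H = q H'"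
  unfolding coincide_def by blast

locale hex_fem = hex_grid +
  fixes k :: nat
  assumes vertex_vecs: "vertex_vectors T \<Phi> D" and edge_vecs: "edge_vectors T \<Phi> D" and k: "k \<ge> 1"
begin

text \<open>The two edge vectors span the plane orthogonal to the edge, so vanishing of the two degrees of
  freedom extends to all vectors of that plane.\<close>
lemma edge_functionals:
  assumes H: "H \<in> T" "E \<in> hex_edges (\<Phi> H)" and E: "X \<in> E" "Y \<in> E" "X \<noteq> Y"
    and dofs: "bil (edge_n1 D E) P (edge_tangent D E) = 0" "bil (edge_n2 D E) P (edge_tangent D E) = 0"
  obtains r where "r \<noteq> 0" "X - Y = r *\<^sub>R edge_tangent D E" "norm (edge_tangent D E) = 1"
    "\<And>w. w \<bullet> edge_tangent D E = 0 \<Longrightarrow> bil w P (edge_tangent D E) = 0"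
proof -
  let ?t = "edge_tangent D E"
  have Eg: "E \<in> grid_edges T \<Phi>" using H by (auto simp: grid_edges_def)
  then have t: "norm ?t = 1" "\<forall>x\<in>E. \<forall>y\<in>E. x - y \<in> span {?t}"
    and sp: "span {edge_n1 D E, edge_n2 D E} = {x. orthogonal x ?t}"
    using edge_vecs by (auto simp: edge_vectors_def)
  have "X - Y \<in> span {?t}" using t(2) E by blast
  then obtain r where r: "X - Y = r *\<^sub>R ?t" unfolding span_singleton by auto
  have sub: "subspace {w. bil w P ?t = 0}" by (simp add: subspace_def bil_linear)
  have "span {edge_n1 D E, edge_n2 D E} \<subseteq> {w. bil w P ?t = 0}"
    by (rule span_minimal[OF _ sub]) (simp add: dofs)
  then have "bil w P ?t = 0" if "w \<bullet> ?t = 0" for w using that unfolding sp orthogonal_def by blast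
  moreover have "r \<noteq> 0" using r E(3) by auto
  ultimately show thesis using r t(1) by (intro that)
qed

text \<open>In the orthonormal frame of the tangent \<open>t\<close>, the conormal \<open>d = t \<times> n\<close> and \<open>n\<close>, the entries \<open>(t,
  t)\<close>, \<open>(t, n)\<close> and \<open>(t, d)\<close> of the form are, up to a factor, degrees of freedom of the face at
  the edge. Since \<open>n \<times> d = t\<close>, the entries \<open>(d, d)\<close> and \<open>(d, n)\<close> reduce to those of the edge
  itself, and \<open>(n, n)\<close> is always zero.\<close>
lemma sym_trace_edge:
  assumes W: "edge_dofs_coincide k T \<Phi> D W"
    and S: "S \<in> grid_faces T \<Phi>" and at: "H1 \<in> at_face T \<Phi> S" "H2 \<in> at_face T \<Phi> S"
    and E: "E = closed_segment X Y" "X \<noteq> Y" "E \<in> hex_edges (\<Phi> H1)" "E \<in> hex_edges (\<Phi> H2)" "E \<subseteq> S"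
    and L: "L \<in> open_segment X Y" "L \<in> lagrange_points k (\<Phi> H1)"
  shows "sym_trace (face_normal D S) (W H1 L - W H2 L) u v = 0"
proof -
  let ?t = "edge_tangent D E" and ?n = "face_normal D S" and ?P = "W H1 L - W H2 L"
  have H: "H1 \<in> T" "H2 \<in> T" using at by (auto simp: at_face_def)
  have Eg: "E \<in> grid_edges T \<Phi>" using H E by (auto simp: grid_edges_def)
  have ae: "H1 \<in> at_edge T \<Phi> E" "H2 \<in> at_edge T \<Phi> E" using H E by (auto simp: at_edge_def)
  have Li: "L \<in> inner_lagrange k \<Phi> (at_edge T \<Phi> E) E"
    unfolding inner_lagrange_def E(1) rel_interior_closed_segment using L E(2) ae(1) E(1) by auto
  note c = W[unfolded edge_dofs_coincide_def Let_def, rule_format, OF Eg Li]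
  have "bil (edge_n1 D E) ?P ?t = 0" "bil (edge_n2 D E) ?P ?t = 0"
    using c coincide_at[OF _ ae] by (auto simp: bil_linear)
  moreover have "X \<in> E" "Y \<in> E" unfolding E(1) by simp_all
  ultimately obtain r where r: "r \<noteq> 0" "X - Y = r *\<^sub>R ?t" and t: "norm ?t = 1"
    and bt: "\<And>w. w \<bullet> ?t = 0 \<Longrightarrow> bil w ?P ?t = 0"
    using edge_functionals[OF H(1) E(3) _ _ E(2)] by blast
  have nn: "?n \<bullet> ?n = 1" and tt: "?t \<bullet> ?t = 1" using face_normal_D(1)[OF S] t by (simp_all add: norm_eq_1)
  have "?n \<bullet> (X - Y) = 0"
    using face_normal_D(2)[OF S] \<open>X \<in> E\<close> \<open>Y \<in> E\<close> E(5) unfolding orthogonal_to_set_def by blast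
  then have nt: "?n \<bullet> ?t = 0" using r by simp
  let ?d = "?t \<times> ?n"
  have f: "coincide (at_face T \<Phi> S) (\<lambda>H. bil ?t (W H L) (?n \<times> ?t))"
     "coincide (at_face T \<Phi> S) (\<lambda>H. bil ?n (W H L) (?n \<times> ?t))"
     "coincide (at_face T \<Phi> S) (\<lambda>H. bil ?t (W H L) (?n \<times> ?d) + bil ?d (W H L) (?n \<times> ?t))"
    using c S E(5) by auto
  have nd: "?n \<times> ?d = ?t" using nt nn by (simp add: Lagrange)
  show ?thesis
  proof (rule sym_trace_eq_0)
    have "?t \<bullet> (?d \<times> ?n) = - (?d \<bullet> ?d)"
      by (simp add: cross3_simps inner_vec_def sum_3 algebra_simps)
    moreover have "?d \<noteq> 0" using nd tt by (metis cross_zero_right inner_zero_left zero_neq_one)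
    ultimately show "span {?t, ?d, ?n} = UNIV" by (intro span_triple) simp
    show "sym_trace ?n ?P ?t ?t = 0" using coincide_at[OF f(1) at] by (simp add: sym_trace_def bil_linear)
    have "bil ?d ?P ?t = 0" by (rule bt) (simp add: inner_commute dot_cross_self)
    then show "sym_trace ?n ?P ?d ?d = 0" by (simp add: sym_trace_def nd)
    show "sym_trace ?n ?P ?n ?n = 0" by (simp add: sym_trace_def bil_linear)
    show "sym_trace ?n ?P ?t ?d = 0" using coincide_at[OF f(3) at] by (simp add: sym_trace_def bil_linear)
    show "sym_trace ?n ?P ?t ?n = 0" using coincide_at[OF f(2) at] by (simp add: sym_trace_def bil_linear)
    have "bil ?n ?P ?t = 0" by (rule bt) (rule nt)
    then show "sym_trace ?n ?P ?d ?n = 0" by (simp add: sym_trace_def nd bil_linear)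
  qed
qed

text \<open>The form is zero at the pair \<open>(n, n)\<close> for every matrix; its other five entries in the basis of
  the face vectors are, up to a factor, the degrees of freedom.\<close>
lemma sym_trace_face_inner:
  assumes W: "face_dofs_coincide k T \<Phi> D W"
    and S: "S \<in> grid_faces T \<Phi>" and at: "H1 \<in> at_face T \<Phi> S" "H2 \<in> at_face T \<Phi> S"
    and L: "L \<in> rel_interior S" "L \<in> lagrange_points k (\<Phi> H1)"
  shows "sym_trace (face_normal D S) (W H1 L - W H2 L) u v = 0"
proof -
  let ?n = "face_normal D S" and ?a1 = "face_a1 D S" and ?a2 = "face_a2 D S" and ?P = "W H1 L - W H2 L"
  have Li: "L \<in> inner_lagrange k \<Phi> (at_face T \<Phi> S) S" unfolding inner_lagrange_def using L at(1) by auto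
  note c = W[unfolded face_dofs_coincide_def Let_def, rule_format, OF S Li]
  have f: "coincide (at_face T \<Phi> S) (\<lambda>H. bil ?a1 (W H L) (?n \<times> ?a1))"
     "coincide (at_face T \<Phi> S) (\<lambda>H. bil ?a2 (W H L) (?n \<times> ?a2))"
     "coincide (at_face T \<Phi> S) (\<lambda>H. bil ?a1 (W H L) (?n \<times> ?a2) + bil ?a2 (W H L) (?n \<times> ?a1))"
     "coincide (at_face T \<Phi> S) (\<lambda>H. bil ?n (W H L) (?n \<times> ?a1))"
     "coincide (at_face T \<Phi> S) (\<lambda>H. bil ?n (W H L) (?n \<times> ?a2))"
    using c by auto
  have fv: "distinct [?a1, ?a2, ?n]" "independent {?a1, ?a2, ?n}"
    using face_vecs S by (auto simp: face_vectors_def)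
  show ?thesis
  proof (rule sym_trace_eq_0)
    show "span {?a1, ?a2, ?n} = UNIV" by (rule span_independent_3) (use fv in auto)
    show "sym_trace ?n ?P ?a1 ?a1 = 0" using coincide_at[OF f(1) at] by (simp add: sym_trace_def bil_linear)
    show "sym_trace ?n ?P ?a2 ?a2 = 0" using coincide_at[OF f(2) at] by (simp add: sym_trace_def bil_linear)
    show "sym_trace ?n ?P ?n ?n = 0" by (simp add: sym_trace_def bil_linear)
    show "sym_trace ?n ?P ?a1 ?a2 = 0" using coincide_at[OF f(3) at] by (simp add: sym_trace_def bil_linear)
    show "sym_trace ?n ?P ?a1 ?n = 0" using coincide_at[OF f(4) at] by (simp add: sym_trace_def bil_linear)
    show "sym_trace ?n ?P ?a2 ?n = 0" using coincide_at[OF f(5) at] by (simp add: sym_trace_def bil_linear)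
  qed
qed

text \<open>If two faces of an element at a vertex had the same normal, that normal would be orthogonal to
  all three tangents. So the three faces use all three vertex normals.\<close>
lemma vertex_normal_index:
  assumes H: "H \<in> T" and v: "\<And>j. v $ j \<in> {0, 1}"
  obtains p :: "3 \<Rightarrow> 3" where "inj p"
    "\<And>m m'. m' \<noteq> m \<Longrightarrow> vertex_normal D (\<Phi> H v) (p m) \<bullet> tangent (\<Phi> H) m' v = 0"
proof -
  let ?V = "\<Phi> H v" and ?F = "\<Phi> H"
  have vc: "0 \<le> v $ j \<and> v $ j \<le> 1" for j using v[of j] by auto
  have V: "?V \<in> hex_vertices ?F" unfolding hex_vertices_def using v by blast
  then have Vg: "?V \<in> grid_vertices T \<Phi>" using H by (auto simp: grid_vertices_def)
  have face: "?F ` local_face m (v $ m) \<in> hex_faces ?F" for m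
    unfolding hex_faces_iff using v by blast
  have vin: "upd v m' r \<in> local_face m (v $ m)" if "m' \<noteq> m" "0 \<le> r" "r \<le> 1" for m m' r
    using that vc by (simp add: local_face_def upd_def)
  have "v \<in> local_face m (v $ m)" for m using vc by (simp add: local_face_def)
  then have "?V \<in> ?F ` local_face m (v $ m)" for m by blast
  then have "\<exists>i. orthogonal_to_set (vertex_normal D ?V i) (?F ` local_face m (v $ m))" for m
    using vertex_vecs[unfolded vertex_vectors_def, rule_format, OF Vg] H V face by blast
  then obtain p where p: "\<And>m. orthogonal_to_set (vertex_normal D ?V (p m)) (?F ` local_face m (v $ m))" by metis
  have orth: "vertex_normal D ?V (p m) \<bullet> tangent ?F m' v = 0" if "m' \<noteq> m" for m m'
    unfolding tangent_trilinear[OF hexmap_poly[OF hexD(1)[OF H]] hexD(2)[OF H]]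
    using p[of m] vin[OF that order_refl zero_le_one] vin[OF that zero_le_one order_refl] unfolding orthogonal_to_set_def by blast
  have "inj p"
  proof (rule injI, rule ccontr)
    fix m m' assume eq: "p m = p m'" and "m \<noteq> m'"
    then have "vertex_normal D ?V (p m) \<bullet> tangent ?F j v = 0" for j
      using orth[of j m] orth[of j m'] by metis
    then have "vertex_normal D ?V (p m) = 0"
      using tangents_span[OF hexD(1)[OF H], of v] vc by blast
    moreover have "norm (vertex_normal D ?V (p m)) = 1"
      using vertex_vecs[unfolded vertex_vectors_def, rule_format, OF Vg] by blast
    ultimately show False by simp
  qed
  then show thesis using orth by (rule that)
qed

text \<open>There are three such forms, one for each \<open>p\<close>; their sum is zero, so two of them determine the
  third.\<close>
lemma vertex_form_permutation:
  assumes "bil (N 2) P (N 1 \<times> N 3) + bil (N 3) P (N 1 \<times> N 2) = 0"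
    and "bil (N 3) P (N 2 \<times> N 1) + bil (N 1) P (N 2 \<times> N 3) = 0"
    and "p \<noteq> q" "q \<noteq> r" "p \<noteq> (r::3)"
  shows "bil (N q) P (N p \<times> N r) + bil (N r) P (N p \<times> N q) = 0"
proof -
  have m: "bil a P (b \<times> c) = - bil a P (c \<times> b)" for a b c
    by (subst cross_skew) (rule bil_linear)
  have "bil (N 1) P (N 3 \<times> N 2) + bil (N 2) P (N 3 \<times> N 1) = 0"
    using assms(1,2) m[of "N 1" "N 3" "N 2"] m[of "N 2" "N 3" "N 1"] m[of "N 3" "N 1" "N 2"] by linarith
  then show ?thesis
    using assms by (cases p rule: three_cases; cases q rule: three_cases; cases r rule: three_cases) (simp_all add: add.commute)
qed

text \<open>Let \<open>N\<^sub>p\<close> be the normal of the face and \<open>N\<^sub>q\<close>, \<open>N\<^sub>r\<close> the normals of the other two faces of \<open>H1\<close>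
  at the vertex. The two edges of the face point in the directions \<open>N\<^sub>p \<times> N\<^sub>q\<close> and \<open>N\<^sub>p \<times> N\<^sub>r\<close>,
  and their degrees of freedom yield all entries of the form in the basis of the vertex normals
  except for \<open>(N\<^sub>q, N\<^sub>r)\<close>. That entry follows from the degrees of freedom of the vertex by
  \<open>vertex_form_permutation\<close>.\<close>
lemma sym_trace_vertex:
  assumes W: "vertex_dofs_coincide T \<Phi> D W" "vertex_edge_dofs_coincide T \<Phi> D W"
    and S: "S \<in> grid_faces T \<Phi>" and at: "H1 \<in> at_face T \<Phi> S" "H2 \<in> at_face T \<Phi> S"
    and c: "c \<in> {0, 1}" "S = \<Phi> H1 ` local_face l c"
    and st: "s \<in> {0, 1}" "t \<in> {0, 1}" and L: "L = \<Phi> H1 (fpt l c s t)" "L \<in> hex_vertices (\<Phi> H2)"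
    and E2: "closed_segment (\<Phi> H1 (fpt l c 0 t)) (\<Phi> H1 (fpt l c 1 t)) \<in> hex_edges (\<Phi> H2)"
      "closed_segment (\<Phi> H1 (fpt l c s 0)) (\<Phi> H1 (fpt l c s 1)) \<in> hex_edges (\<Phi> H2)"
  shows "sym_trace (face_normal D S) (W H1 L - W H2 L) u v = 0"
proof -
  let ?n = "face_normal D S" and ?P = "W H1 L - W H2 L" and ?F = "\<Phi> H1" and ?v = "fpt l c s t"
  let ?N = "vertex_normal D L"
  have H: "H1 \<in> T" "H2 \<in> T" using at by (auto simp: at_face_def)
  have pF: "poly_map ?F" and tF: "trilinear ?F" using hexD[OF H(1)] hexmap_poly by auto
  have v01: "?v $ j \<in> {0, 1}" for j using st c(1) by (auto simp: chart_def)
  obtain p where p: "inj p" "\<And>m m'. m' \<noteq> m \<Longrightarrow> ?N (p m) \<bullet> tangent ?F m' ?v = 0"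
    using vertex_normal_index[OF H(1) v01] unfolding L(1)[symmetric] by blast
  have V1: "L \<in> hex_vertices ?F" unfolding hex_vertices_def L(1) using v01 by blast
  then have Vg: "L \<in> grid_vertices T \<Phi>" using H by (auto simp: grid_vertices_def)
  have av: "H1 \<in> at_vertex T \<Phi> L" "H2 \<in> at_vertex T \<Phi> L" using V1 L H by (auto simp: at_vertex_def)
  have nv: "norm (?N i) = 1" "inj ?N" "independent (range ?N)" for i
    using vertex_vecs[unfolded vertex_vectors_def, rule_format, OF Vg] by blast+
  have st': "s \<in> {0..1}" "t \<in> {0..1}" using st by auto
  have c01: "coincide (at_vertex T \<Phi> L) (\<lambda>H. bil (?N 2) (W H L) (?N 1 \<times> ?N 3) + bil (?N 3) (W H L) (?N 1 \<times> ?N 2))"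
     "coincide (at_vertex T \<Phi> L) (\<lambda>H. bil (?N 3) (W H L) (?N 2 \<times> ?N 1) + bil (?N 1) (W H L) (?N 2 \<times> ?N 3))"
    using W(1)[unfolded vertex_dofs_coincide_def Let_def, rule_format, OF Vg] by auto
  have form: "bil (?N q) ?P (?N p \<times> ?N r) + bil (?N r) ?P (?N p \<times> ?N q) = 0"
    if "p \<noteq> q" "q \<noteq> r" "p \<noteq> r" for p q r
    by (rule vertex_form_permutation[OF _ _ that])
       (use coincide_at[OF c01(1) av] coincide_at[OF c01(2) av] in \<open>simp_all add: bil_linear\<close>)
  \<comment> \<open>An edge of the face at the vertex, with the normals \<open>p1\<close> and \<open>p2\<close> of the two faces that meet there.\<close>
  have edge: "bil (?N p1) ?P (?N p1 \<times> ?N p2) = 0 \<and> bil (?N p2) ?P (?N p1 \<times> ?N p2) = 0"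
    if E: "closed_segment X Y \<in> hex_edges ?F" "closed_segment X Y \<in> hex_edges (\<Phi> H2)" "L \<in> closed_segment X Y" "X \<noteq> Y"
      and orth: "?N p1 \<bullet> (Y - X) = 0" "?N p2 \<bullet> (Y - X) = 0" for X Y p1 p2
  proof -
    let ?E = "closed_segment X Y"
    let ?t = "edge_tangent D ?E"
    have Eg: "?E \<in> grid_edges T \<Phi>" using H E by (auto simp: grid_edges_def)
    have ae: "H1 \<in> at_edge T \<Phi> ?E" "H2 \<in> at_edge T \<Phi> ?E" using H E by (auto simp: at_edge_def)
    have "bil (edge_n1 D ?E) ?P ?t = 0" "bil (edge_n2 D ?E) ?P ?t = 0"
      using W(2)[unfolded vertex_edge_dofs_coincide_def, rule_format, OF Vg Eg E(3)] coincide_at[OF _ ae]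
      by (auto simp: bil_linear)
    then obtain r where r: "r \<noteq> 0" "Y - X = r *\<^sub>R ?t" and t: "norm ?t = 1" and bt: "\<And>w. w \<bullet> ?t = 0 \<Longrightarrow> bil w ?P ?t = 0"
      using edge_functionals[OF H(1) E(1), of Y X] E(4) by (metis ends_in_segment)
    have o: "?N p1 \<bullet> ?t = 0" "?N p2 \<bullet> ?t = 0" using orth r by auto
    have "?N p1 \<times> ?N p2 = (?t \<bullet> (?N p1 \<times> ?N p2)) *\<^sub>R ?t"
      using o by (intro orthogonal_cross_parallel t) (simp_all add: inner_commute)
    then show ?thesis using bt[OF o(1)] bt[OF o(2)] by (metis bil_linear(4) mult_zero_right)
  qed
  let ?p = "p l" and ?q = "p (l + 2)" and ?r = "p (l + 1)"
  have dist: "?p \<noteq> ?q" "?q \<noteq> ?r" "?p \<noteq> ?r" using p(1) axis_fpt_3(1-3)[of l] by (metis injD)+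
  have T1: "tangent ?F (l+1) ?v = ?F (fpt l c 1 t) - ?F (fpt l c 0 t)"
    unfolding tangent_trilinear[OF pF tF] using axis_fpt_3(1-3)[of l]
    by (intro arg_cong2[where f = "(-)"] arg_cong[where f = ?F]) (auto simp: upd_def chart_def vec_eq_iff)
  have T2: "tangent ?F (l+2) ?v = ?F (fpt l c s 1) - ?F (fpt l c s 0)"
    unfolding tangent_trilinear[OF pF tF] using axis_fpt_3(1-3)[of l] forall_axis[of _ l]
    by (intro arg_cong2[where f = "(-)"] arg_cong[where f = ?F]; unfold vec_eq_iff; subst forall_axis[of _ l]) (auto simp: upd_def chart_def)
  have nS: "norm ?n = 1" "orthogonal_to_set ?n (?F ` local_face l c)"
    using face_normal_D[OF S] c(2) by auto
  have A: "area ?F l ?v = (?n \<bullet> area ?F l ?v) *\<^sub>R ?n" "?n \<bullet> area ?F l ?v \<noteq> 0"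
    using face_area[OF hexD(1,2)[OF H(1)] c(1) nS st'] by auto
  then have A0: "area ?F l ?v \<noteq> 0" by auto
  then have nz: "tangent ?F (l+1) ?v \<noteq> 0" "tangent ?F (l+2) ?v \<noteq> 0" by (auto simp: area_def)
  have o: "?N ?p \<bullet> tangent ?F (l+1) ?v = 0" "?N ?p \<bullet> tangent ?F (l+2) ?v = 0"
    "?N ?q \<bullet> tangent ?F (l+1) ?v = 0" "?N ?r \<bullet> tangent ?F (l+2) ?v = 0"
    using p(2) axis_fpt_3(1-3)[of l] by metis+
  have e1: "bil (?N ?p) ?P (?N ?p \<times> ?N ?q) = 0 \<and> bil (?N ?q) ?P (?N ?p \<times> ?N ?q) = 0"
  proof (rule edge)
    show "closed_segment (?F (fpt l c 0 t)) (?F (fpt l c 1 t)) \<in> hex_edges ?F"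
      by (rule chart_edges(2)[OF tF axis_fpt_3(1) c(1) st(2)])
    show "L \<in> closed_segment (?F (fpt l c 0 t)) (?F (fpt l c 1 t))" using st(1) L(1) by auto
  qed (use E2(1) nz(1) o in \<open>simp_all add: T1\<close>)
  have e2: "bil (?N ?p) ?P (?N ?p \<times> ?N ?r) = 0 \<and> bil (?N ?r) ?P (?N ?p \<times> ?N ?r) = 0"
  proof (rule edge)
    show "closed_segment (?F (fpt l c s 0)) (?F (fpt l c s 1)) \<in> hex_edges ?F"
      by (rule chart_edges(1)[OF tF axis_fpt_3(1) c(1) st(1)])
    show "L \<in> closed_segment (?F (fpt l c s 0)) (?F (fpt l c s 1))" using st(2) L(1) by auto
  qed (use E2(2) nz(2) o in \<open>simp_all add: T2\<close>)
  have "sym_trace (?N ?p) ?P u v = 0"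
  proof (rule sym_trace_eq_0)
    have "{?N ?p, ?N ?q, ?N ?r} = range ?N"
    proof -
      have "{?p, ?q, ?r} = UNIV" using dist by (intro card_subset_eq) auto
      then show ?thesis by (metis image_empty image_insert)
    qed
    moreover have "card (range ?N) = 3" using nv(2) by (simp add: card_image)
    ultimately show "span {?N ?p, ?N ?q, ?N ?r} = UNIV" using nv(3) by (simp add: span_independent_3)
    show "sym_trace (?N ?p) ?P (?N ?p) (?N ?p) = 0" by (simp add: sym_trace_def bil_linear)
    show "sym_trace (?N ?p) ?P (?N ?q) (?N ?q) = 0" "sym_trace (?N ?p) ?P (?N ?p) (?N ?q) = 0"
      using e1 by (simp_all add: sym_trace_def bil_linear)
    show "sym_trace (?N ?p) ?P (?N ?r) (?N ?r) = 0" "sym_trace (?N ?p) ?P (?N ?p) (?N ?r) = 0"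
      using e2 by (simp_all add: sym_trace_def bil_linear)
    show "sym_trace (?N ?p) ?P (?N ?q) (?N ?r) = 0"
      using form[OF dist] by (simp add: sym_trace_def)
  qed
  moreover have "?n = ((?N ?p \<bullet> area ?F l ?v) / (?n \<bullet> area ?F l ?v)) *\<^sub>R ?N ?p"
  proof -
    have "area ?F l ?v = (?N ?p \<bullet> area ?F l ?v) *\<^sub>R ?N ?p"
      using o unfolding area_def by (intro orthogonal_cross_parallel nv(1))
    then have "(?n \<bullet> area ?F l ?v) *\<^sub>R ?n = (?N ?p \<bullet> area ?F l ?v) *\<^sub>R ?N ?p" using A(1) by simp
    then have "(1 / (?n \<bullet> area ?F l ?v)) *\<^sub>R ((?n \<bullet> area ?F l ?v) *\<^sub>R ?n) =
       (1 / (?n \<bullet> area ?F l ?v)) *\<^sub>R ((?N ?p \<bullet> area ?F l ?v) *\<^sub>R ?N ?p)" by simp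
    then show ?thesis using A(2) by simp
  qed
  ultimately show ?thesis by (metis mult_zero_right sym_trace_scale)
qed

end

lemma bounded_linear_entry: "bounded_linear (\<lambda>M :: real^3^3. M $ i $ m)"
  by (intro bounded_linear_compose[OF bounded_linear_vec_nth[of m]] bounded_linear_vec_nth)

lemma bounded_linear_sym_trace: "bounded_linear (\<lambda>M. sym_trace n M u v)"
proof -
  have "linear (\<lambda>M. sym_trace n M u v)"
    by (rule linearI)
       (simp_all add: sym_trace_def bil_def matrix_vector_mult_add_rdistrib inner_add_right
          scaleR_matrix_vector_assoc[symmetric] distrib_left)
  then show ?thesis by (rule linear_conv_bounded_linear[THEN iffD1])
qed

lemma chart_affine:
  assumes "trilinear F" "i \<noteq> l"
  shows "F (chart l c i a b s t) = (1 - t) *\<^sub>R F (chart l c i a b s 0) + t *\<^sub>R F (chart l c i a b s 1)"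
    and "F (chart l c i a b s t) = (1 - s) *\<^sub>R F (chart l c i a b 0 t) + s *\<^sub>R F (chart l c i a b 1 t)"
proof -
  let ?Q = "quad (F (chart l c i a b 0 0)) (F (chart l c i a b 1 0)) (F (chart l c i a b 1 1)) (F (chart l c i a b 0 1))"
  have q: "quad A B C D s t = (1 - t) *\<^sub>R quad A B C D s 0 + t *\<^sub>R quad A B C D s 1"
    "quad A B C D s t = (1 - s) *\<^sub>R quad A B C D 0 t + s *\<^sub>R quad A B C D 1 t" for A B C D s t
    by (simp_all add: quad_def algebra_simps)
  have F: "F (chart l c i a b s t) = ?Q s t" for s t by (rule trilinear_chart[OF assms])
  show "F (chart l c i a b s t) = (1 - t) *\<^sub>R F (chart l c i a b s 0) + t *\<^sub>R F (chart l c i a b s 1)"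
    using q(1)[of _ _ _ _ s t] F[of s t] F[of s 0] F[of s 1] by metis
  show "F (chart l c i a b s t) = (1 - s) *\<^sub>R F (chart l c i a b 0 t) + s *\<^sub>R F (chart l c i a b 1 t)"
    using q(2)[of _ _ _ _ s t] F[of s t] F[of 0 t] F[of 1 t] by metis
qed

lemma fpt_inject: "fpt l c s t = fpt l c s' t' \<longleftrightarrow> s = s' \<and> t = t'"
  by (metis fpt_nth(2,3))

lemma face_segment:
  assumes F: "hexmap F" "trilinear F" and c: "c \<in> {0, 1}" and s: "s \<in> {0..1}"
  shows "closed_segment (F (fpt l c s 0)) (F (fpt l c s 1)) \<subseteq> F ` local_face l c"
    and "closed_segment (F (fpt l c 0 s)) (F (fpt l c 1 s)) \<subseteq> F ` local_face l c"
    and "F (fpt l c s 0) \<noteq> F (fpt l c s 1)" "F (fpt l c 0 s) \<noteq> F (fpt l c 1 s)"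
proof -
  have inj: "inj_on F unit_cube" using F(1) by (simp add: hexmap_def)
  have cube: "fpt l c s t \<in> unit_cube" if "s \<in> {0..1}" "t \<in> {0..1}" for s t
    by (rule fpt_unit_cube[OF c that axis_fpt_3(1)])
  have mem: "F (fpt l c s t) \<in> F ` local_face l c" if "s \<in> {0..1}" "t \<in> {0..1}" for s t
    by (rule imageI) (rule chart_in_face[OF axis_fpt_3(1) c that])
  show "closed_segment (F (fpt l c s 0)) (F (fpt l c s 1)) \<subseteq> F ` local_face l c"
  proof
    fix x assume "x \<in> closed_segment (F (fpt l c s 0)) (F (fpt l c s 1))"
    then obtain r where r: "0 \<le> r" "r \<le> 1" "x = (1 - r) *\<^sub>R F (fpt l c s 0) + r *\<^sub>R F (fpt l c s 1)"
      by (auto simp: closed_segment_def)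
    then have "x = F (fpt l c s r)" using chart_affine(1)[OF F(2) axis_fpt_3(1)] by metis
    then show "x \<in> F ` local_face l c" using mem[OF s, of r] r by simp
  qed
  show "closed_segment (F (fpt l c 0 s)) (F (fpt l c 1 s)) \<subseteq> F ` local_face l c"
  proof
    fix x assume "x \<in> closed_segment (F (fpt l c 0 s)) (F (fpt l c 1 s))"
    then obtain r where r: "0 \<le> r" "r \<le> 1" "x = (1 - r) *\<^sub>R F (fpt l c 0 s) + r *\<^sub>R F (fpt l c 1 s)"
      by (auto simp: closed_segment_def)
    then have "x = F (fpt l c r s)" using chart_affine(2)[OF F(2) axis_fpt_3(1)] by metis
    then show "x \<in> F ` local_face l c" using mem[OF _ s, of r] r by simp
  qed
  show "F (fpt l c s 0) \<noteq> F (fpt l c s 1)"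
  proof
    assume "F (fpt l c s 0) = F (fpt l c s 1)"
    then have "fpt l c s 0 = fpt l c s 1" using inj_onD[OF inj _ cube cube] s by auto
    then show False by (simp add: fpt_inject)
  qed
  show "F (fpt l c 0 s) \<noteq> F (fpt l c 1 s)"
  proof
    assume "F (fpt l c 0 s) = F (fpt l c 1 s)"
    then have "fpt l c 0 s = fpt l c 1 s" using inj_onD[OF inj _ cube cube] s by auto
    then show False by (simp add: fpt_inject)
  qed
qed

lemma lagrange_unit: "j \<le> k \<Longrightarrow> real j / real k \<in> {0..1}"
  by (cases "k = 0") (simp_all add: divide_le_eq_1)

context hex_fem
begin

text \<open>The parameters of a Lagrange point decide whether it is an inner point of the face, an inner
  point of an edge, or a vertex.\<close>
lemma sym_trace_lagrange:
  assumes W: "vertex_dofs_coincide T \<Phi> D W" "vertex_edge_dofs_coincide T \<Phi> D W"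
      "edge_dofs_coincide k T \<Phi> D W" "face_dofs_coincide k T \<Phi> D W"
    and S: "S \<in> grid_faces T \<Phi>" and at: "H1 \<in> at_face T \<Phi> S" "H2 \<in> at_face T \<Phi> S"
    and c: "c \<in> {0, 1}" "S = \<Phi> H1 ` local_face l c"
    and c': "c' \<in> {0, 1}" and i: "i \<noteq> l'"
    and m: "\<And>s t. \<Phi> H2 (chart l' c' i a b s t) = \<Phi> H1 (fpt l c s t)"
    and st: "s = real js / real k" "js \<le> k" "t = real jt / real k" "jt \<le> k"
  shows "sym_trace (face_normal D S) (W H1 (\<Phi> H1 (fpt l c s t)) - W H2 (\<Phi> H1 (fpt l c s t))) u v = 0"
proof -
  let ?L = "\<Phi> H1 (fpt l c s t)"
  have H: "H1 \<in> T" "H2 \<in> T" using at by (auto simp: at_face_def)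
  note h1 = hexD(1,2)[OF H(1)] and h2 = hexD(1,2)[OF H(2)]
  have st': "s \<in> {0..1}" "t \<in> {0..1}" using st lagrange_unit by simp_all
  have lag: "?L \<in> lagrange_points k (\<Phi> H1)"
  proof -
    have "\<exists>j\<le>k. c = real j / real k"
    proof (cases "c = 0")
      case True then show ?thesis by (intro exI[of _ 0]) simp
    next
      case False then show ?thesis using c(1) k by (intro exI[of _ k]) simp
    qed
    then have "\<forall>m. \<exists>j\<le>k. fpt l c s t $ m = real j / real k"
      using st by (subst forall_axis[of _ l]) (auto simp: fpt_nth)
    then show ?thesis unfolding lagrange_points_def by blast
  qed
  have E1: "closed_segment (\<Phi> H1 (fpt l c s 0)) (\<Phi> H1 (fpt l c s 1)) \<in> hex_edges (\<Phi> H1)"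
      "closed_segment (\<Phi> H1 (fpt l c s 0)) (\<Phi> H1 (fpt l c s 1)) \<in> hex_edges (\<Phi> H2)" if "s \<in> {0, 1}"
    using chart_edges(1)[OF h1(2) axis_fpt_3(1) c(1) that] chart_edges(1)[OF h2(2) i c' that, of a b] unfolding m .
  have E2: "closed_segment (\<Phi> H1 (fpt l c 0 t)) (\<Phi> H1 (fpt l c 1 t)) \<in> hex_edges (\<Phi> H1)"
      "closed_segment (\<Phi> H1 (fpt l c 0 t)) (\<Phi> H1 (fpt l c 1 t)) \<in> hex_edges (\<Phi> H2)" if "t \<in> {0, 1}"
    using chart_edges(2)[OF h1(2) axis_fpt_3(1) c(1) that] chart_edges(2)[OF h2(2) i c' that, of a b] unfolding m .
  consider (inner) "s \<in> {0<..<1}" "t \<in> {0<..<1}" | (edge1) "s \<in> {0, 1}" "t \<in> {0<..<1}"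
    | (edge2) "s \<in> {0<..<1}" "t \<in> {0, 1}" | (vertex) "s \<in> {0, 1}" "t \<in> {0, 1}"
  proof -
    have "s \<in> {0<..<1} \<or> s \<in> {0, 1}" "t \<in> {0<..<1} \<or> t \<in> {0, 1}" using st' by auto
    then show thesis using that by blast
  qed
  then show ?thesis
  proof cases
    case inner
    have "\<forall>S\<in>hex_faces (\<Phi> H1). coplanar S" using grid H by (simp add: conforming_grid_def hexahedron_def)
    moreover have "\<Phi> H1 ` local_face l c \<in> hex_faces (\<Phi> H1)" unfolding hex_faces_iff using c(1) by blast
    ultimately have "coplanar (\<Phi> H1 ` local_face l c)" by (rule bspec)
    then have "?L \<in> rel_interior S" unfolding c(2) by (rule inner_face_rel_interior[OF h1(1) c(1) _ inner])
    then show ?thesis by (rule sym_trace_face_inner[OF W(4) S at _ lag])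
  next
    case edge1
    show ?thesis
    proof (rule sym_trace_edge[OF W(3) S at refl _ E1[OF edge1(1)] _ _ lag])
      show "\<Phi> H1 (fpt l c s 0) \<noteq> \<Phi> H1 (fpt l c s 1)" by (rule face_segment(3)[OF h1 c(1) st'(1)])
      then show "?L \<in> open_segment (\<Phi> H1 (fpt l c s 0)) (\<Phi> H1 (fpt l c s 1))"
        unfolding in_segment using edge1(2) chart_affine(1)[OF h1(2) axis_fpt_3(1), of l c False False s t] by auto
      show "closed_segment (\<Phi> H1 (fpt l c s 0)) (\<Phi> H1 (fpt l c s 1)) \<subseteq> S"
        unfolding c(2) by (rule face_segment(1)[OF h1 c(1) st'(1)])
    qed
  next
    case edge2
    show ?thesis
    proof (rule sym_trace_edge[OF W(3) S at refl _ E2[OF edge2(2)] _ _ lag])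
      show "\<Phi> H1 (fpt l c 0 t) \<noteq> \<Phi> H1 (fpt l c 1 t)" by (rule face_segment(4)[OF h1 c(1) st'(2)])
      then show "?L \<in> open_segment (\<Phi> H1 (fpt l c 0 t)) (\<Phi> H1 (fpt l c 1 t))"
        unfolding in_segment using edge2(1) chart_affine(2)[OF h1(2) axis_fpt_3(1), of l c False False s t] by auto
      show "closed_segment (\<Phi> H1 (fpt l c 0 t)) (\<Phi> H1 (fpt l c 1 t)) \<subseteq> S"
        unfolding c(2) by (rule face_segment(2)[OF h1 c(1) st'(2)])
    qed
  next
    case vertex
    have "chart l' c' i a b s t $ j \<in> {0, 1}" for j using vertex c' by (auto simp: chart_def)
    then have "?L \<in> hex_vertices (\<Phi> H2)" unfolding m[symmetric] hex_vertices_def by blast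
    then show ?thesis
      by (rule sym_trace_vertex[OF W(1,2) S at c vertex refl _ E2(2)[OF vertex(2)] E1(2)[OF vertex(1)]])
  qed
qed

text \<open>In the common parametrization of the face the difference of the two traces is a polynomial of
  degree at most \<open>k\<close> in each parameter that vanishes at all Lagrange points.\<close>
lemma sym_trace_continuous:
  assumes W: "vertex_dofs_coincide T \<Phi> D W" "vertex_edge_dofs_coincide T \<Phi> D W"
      "edge_dofs_coincide k T \<Phi> D W" "face_dofs_coincide k T \<Phi> D W"
    and q: "\<And>H. H \<in> T \<Longrightarrow> poly_Q k (q H)" "\<And>H \<xi>. H \<in> T \<Longrightarrow> \<xi> \<in> unit_cube \<Longrightarrow> W H (\<Phi> H \<xi>) = q H \<xi>"
    and S: "S \<in> grid_faces T \<Phi>" and at: "H1 \<in> at_face T \<Phi> S" "H2 \<in> at_face T \<Phi> S" and x: "x \<in> S"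
  shows "sym_trace (face_normal D S) (W H1 x) u v = sym_trace (face_normal D S) (W H2 x) u v"
proof -
  let ?n = "face_normal D S"
  have H: "H1 \<in> T" "H2 \<in> T" using at by (auto simp: at_face_def)
  obtain l c where c: "c \<in> {0, 1}" "S = \<Phi> H1 ` local_face l c" using at(1) unfolding at_face_iff by blast
  obtain l' c' where c': "c' \<in> {0, 1}" "S = \<Phi> H2 ` local_face l' c'" using at(2) unfolding at_face_iff by blast
  obtain i a b where i: "i \<noteq> l'" and m: "\<And>s t. \<Phi> H2 (chart l' c' i a b s t) = \<Phi> H1 (fpt l c s t)"
    using face_matching[OF hexD(1,2)[OF H(1)] c(1) hexD(1,2)[OF H(2)] c'(1) face_normal_D[OF S] c(2) c'(2)] by blast
  define f1 where "f1 \<xi> = sym_trace ?n (q H1 \<xi>) u v" for \<xi>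
  define f2 where "f2 \<xi> = sym_trace ?n (q H2 \<xi>) u v" for \<xi>
  have pf: "poly_Q k f1" "poly_Q k f2"
    unfolding f1_def f2_def by (rule poly_Q_component[OF q(1) bounded_linear_sym_trace], rule H)+
  define f where "f s t = f1 (fpt l c s t) - f2 (chart l' c' i a b s t)" for s t
  have Wf: "sym_trace ?n (W H1 (\<Phi> H1 (fpt l c s t)) - W H2 (\<Phi> H1 (fpt l c s t))) u v = f s t"
    if "s \<in> {0..1}" "t \<in> {0..1}" for s t
  proof -
    have "W H1 (\<Phi> H1 (fpt l c s t)) = q H1 (fpt l c s t)"
      by (rule q(2)[OF H(1) fpt_unit_cube[OF c(1) that axis_fpt_3(1)]])
    moreover have "W H2 (\<Phi> H1 (fpt l c s t)) = q H2 (chart l' c' i a b s t)"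
      unfolding m[symmetric] by (rule q(2)[OF H(2) fpt_unit_cube[OF c'(1) that i]])
    ultimately show ?thesis by (simp add: f_def f1_def f2_def sym_trace_diff)
  qed
  have "f s t = 0" for s t
  proof (rule poly2_lagrange_eq_0[where f = f, OF _ _ k])
    fix t
    obtain p1 where p1: "degree p1 \<le> k" "\<And>s. f1 (fpt l c s t) = poly p1 s"
      using poly_Q_chart(1)[OF pf(1) axis_fpt_3(1)] by metis
    obtain p2 where p2: "degree p2 \<le> k" "\<And>s. f2 (chart l' c' i a b s t) = poly p2 s"
      using poly_Q_chart(1)[OF pf(2) i] by metis
    show "\<exists>p. degree p \<le> k \<and> (\<forall>s. f s t = poly p s)"
      by (intro exI[of _ "p1 - p2"]) (simp add: f_def p1 p2 degree_diff_le)
  next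
    fix s
    obtain p1 where p1: "degree p1 \<le> k" "\<And>t. f1 (fpt l c s t) = poly p1 t"
      using poly_Q_chart(2)[OF pf(1) axis_fpt_3(1)] by metis
    obtain p2 where p2: "degree p2 \<le> k" "\<And>t. f2 (chart l' c' i a b s t) = poly p2 t"
      using poly_Q_chart(2)[OF pf(2) i] by metis
    show "\<exists>p. degree p \<le> k \<and> (\<forall>t. f s t = poly p t)"
      by (intro exI[of _ "p1 - p2"]) (simp add: f_def p1 p2 degree_diff_le)
  next
    fix js jt assume j: "js \<le> k" "jt \<le> k"
    have "real js / real k \<in> {0..1}" "real jt / real k \<in> {0..1}" using j by (simp_all only: lagrange_unit)
    then show "f (real js / real k) (real jt / real k) = 0"
      using sym_trace_lagrange[OF W S at c c'(1) i m refl j(1) refl j(2)] Wf by metis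
  qed
  moreover obtain \<xi> where "\<xi> \<in> local_face l c" "x = \<Phi> H1 \<xi>" using x c(2) by blast
  then obtain s t where "s \<in> {0..1}" "t \<in> {0..1}" "x = \<Phi> H1 (fpt l c s t)"
    unfolding local_face_fpt[OF c(1)] by blast
  ultimately have "sym_trace ?n (W H1 x - W H2 x) u v = 0" using Wf by metis
  then show ?thesis by (simp add: sym_trace_diff)
qed

lemma Curl_distr_piecewise:
  fixes W :: "(real^3) set \<Rightarrow> real^3 \<Rightarrow> real^3^3"
  assumes U: "U \<in> borel_measurable (lebesgue_on \<Omega>)" "AE x in lebesgue_on \<Omega>. U x = piecewise W x"
    and W: "\<And>H. H \<in> T \<Longrightarrow> continuous_on H (W H)" and \<phi>: "\<phi> \<in> test_functions \<Omega>"
  shows "Curl_distr \<Omega> U \<phi> $ i $ m = (\<integral>x. piecewise (\<lambda>H x. (axis m 1 \<times> (W H x $ i)) \<bullet> grad \<phi> x) x \<partial>lebesgue_on \<Omega>)"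
proof -
  let ?C = "\<lambda>(M :: real^3^3) p. \<chi> i. M $ i \<times> p"
  have C: "C_order 1 \<phi>" using \<phi> by (rule test_function_C1)
  have cg: "continuous_on S (grad \<phi>)" for S
    using grad_continuous[of 0 \<phi>] C by (auto intro: continuous_on_subset)
  have cC: "continuous_on S (\<lambda>x. ?C (f x) (g x))" if "continuous_on S f" "continuous_on S g" for S f and g :: "'z::t2_space \<Rightarrow> real^3"
    by (rule continuous_on_vec_lambda)
       (rule continuous_on_cross[OF bounded_linear.continuous_on[OF bounded_linear_vec_nth that(1)] that(2)])
  have lin: "?C (piecewise W x) (grad \<phi> x) = piecewise (\<lambda>H x. ?C (W H x) (grad \<phi> x)) x" for x
    by (simp add: vec_eq_iff piecewise_def sum_component cross3_def forall_3 sum_distrib_left sum_distrib_right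
        sum_subtractf[symmetric] algebra_simps)
  have gm: "grad \<phi> \<in> borel_measurable (lebesgue_on \<Omega>)"
    by (rule borel_measurable_lebesgue_on_continuous[OF cg])
  have int: "integrable (lebesgue_on \<Omega>) (piecewise (\<lambda>H x. ?C (W H x) (grad \<phi> x)))"
    by (intro piecewise_integral(1) cC W cg)
  have "Curl_distr \<Omega> U \<phi> = (\<integral>x. piecewise (\<lambda>H x. ?C (W H x) (grad \<phi> x)) x \<partial>lebesgue_on \<Omega>)"
    unfolding Curl_distr_def
  proof (rule integral_cong_AE)
    show "(\<lambda>x. \<chi> i. U x $ i \<times> grad \<phi> x) \<in> borel_measurable (lebesgue_on \<Omega>)"
      by (rule borel_measurable_continuous_Pair[OF U(1) gm]) (intro cC continuous_intros)
    show "AE x in lebesgue_on \<Omega>. (\<chi> i. U x $ i \<times> grad \<phi> x) = piecewise (\<lambda>H x. ?C (W H x) (grad \<phi> x)) x"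
      using U(2) by (rule AE_mp) (intro AE_I2 impI, simp add: lin[symmetric])
  qed (use int in auto)
  moreover have "bounded_linear (\<lambda>M :: real^3^3. M $ i $ m)"
    by (rule bounded_linear_entry)
  ultimately have "Curl_distr \<Omega> U \<phi> $ i $ m = (\<integral>x. piecewise (\<lambda>H x. ?C (W H x) (grad \<phi> x)) x $ i $ m \<partial>lebesgue_on \<Omega>)"
    using integral_bounded_linear[OF _ int, of "\<lambda>M. M $ i $ m"] by simp
  also have "(\<lambda>x. piecewise (\<lambda>H x. ?C (W H x) (grad \<phi> x)) x $ i $ m) = piecewise (\<lambda>H x. (axis m 1 \<times> (W H x $ i)) \<bullet> grad \<phi> x)"
  proof
    fix x
    have "(a \<times> b) $ m = (axis m 1 \<times> a) \<bullet> b" for a b :: "real^3"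
      by (cases m rule: three_cases) (simp_all add: cross3_simps inner_vec_def sum_3 axis_def)
    then show "piecewise (\<lambda>H x. ?C (W H x) (grad \<phi> x)) x $ i $ m = piecewise (\<lambda>H x. (axis m 1 \<times> (W H x $ i)) \<bullet> grad \<phi> x) x"
      by (simp add: piecewise_def sum_component)
  qed
  finally show ?thesis .
qed

text \<open>The entries of \<open>2 sym Curl\<close> are, up to sign, divergences of fields whose normal components are
  the symmetric traces.\<close>
lemma H_h_sym_Curl_subset:
  assumes p: "p \<ge> 1"
  shows "H_h_sym_Curl k \<Omega> T \<Phi> D \<subseteq> H_sym_Curl p \<Omega>"
proof
  fix U assume "U \<in> H_h_sym_Curl k \<Omega> T \<Phi> D"
  then obtain W where U2: "U \<in> Lp_space 2 \<Omega>"
    and Pi: "\<And>H. H \<in> T \<Longrightarrow> W H \<in> Pi_k k (\<Phi> H)" and AE: "\<And>H. H \<in> T \<Longrightarrow> AE x in lebesgue_on (H \<inter> \<Omega>). U x = W H x"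
    and W: "vertex_dofs_coincide T \<Phi> D W" "vertex_edge_dofs_coincide T \<Phi> D W"
      "edge_dofs_coincide k T \<Phi> D W" "face_dofs_coincide k T \<Phi> D W"
    unfolding H_h_sym_Curl_def by blast
  have "\<exists>q. \<forall>H\<in>T. poly_Q k (q H) \<and> (\<forall>\<xi>\<in>unit_cube. W H (\<Phi> H \<xi>) = q H \<xi>)"
    using Pi unfolding Pi_k_def by (intro bchoice) blast
  then obtain q where q: "\<And>H. H \<in> T \<Longrightarrow> poly_Q k (q H)" "\<And>H \<xi>. H \<in> T \<Longrightarrow> \<xi> \<in> unit_cube \<Longrightarrow> W H (\<Phi> H \<xi>) = q H \<xi>"
    by blast
  have cW: "continuous_on H (W H)" if H: "H \<in> T" for H
  proof -
    have "continuous_on unit_cube (q H)"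
    proof -
      have "continuous_on unit_cube (\<lambda>\<xi>. q H \<xi> $ i $ j)" for i j
        by (rule real_polynomial_continuous[OF poly_Q_real_polynomial[OF poly_Q_component[OF q(1)[OF H]]]])
           (rule bounded_linear_entry)
      then have "continuous_on unit_cube (\<lambda>\<xi>. \<chi> i j. q H \<xi> $ i $ j)" by (intro continuous_on_vec_lambda)
      then show ?thesis by simp
    qed
    then have "continuous_on (\<Phi> H ` unit_cube) (W H)"
      by (rule continuous_on_hex[OF hexD(1)[OF H]]) (rule q(2)[OF H])
    then show ?thesis using hexD(3)[OF H] by simp
  qed
  have Um: "U \<in> borel_measurable (lebesgue_on \<Omega>)" using U2 by (simp add: Lp_space_def)
  have UA: "AE x in lebesgue_on \<Omega>. U x = piecewise W x" using AE by (rule AE_piecewise)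
  obtain B where B: "\<And>x. norm (piecewise W x) \<le> B" using piecewise_bounded[OF cW] by blast
  have "AE x in lebesgue_on \<Omega>. norm (U x) \<le> B" using UA by (rule AE_mp) (intro AE_I2 impI, simp add: B)
  then have Up: "U \<in> Lp_space p \<Omega>" using p by (intro Lp_space_bounded[OF \<Omega>_lmeasurable(1) Um]) auto
  define f where "f i m H x = axis m 1 \<times> (W H x $ i) + axis i 1 \<times> (W H x $ m)" for i m :: 3 and H x
  define is_div where "is_div i m d \<longleftrightarrow> (\<forall>H\<in>T. continuous_on H (d H)) \<and> (\<forall>\<phi>\<in>test_functions \<Omega>.
      (\<integral>x. piecewise (\<lambda>H x. f i m H x \<bullet> grad \<phi> x) x \<partial>lebesgue_on \<Omega>) = - (\<integral>x. \<phi> x * piecewise d x \<partial>lebesgue_on \<Omega>))"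
    for i m and d :: "(real^3) set \<Rightarrow> real^3 \<Rightarrow> real"
  have "\<exists>d. is_div i m d" for i m
  proof (rule piecewise_divergence)
    fix H assume H: "H \<in> T"
    have "linear (\<lambda>M :: real^3^3. axis m 1 \<times> (M $ i) + axis i 1 \<times> (M $ m))"
      by (rule linearI) (simp_all add: cross_add_right cross_mult_right scaleR_add_right)
    then have "bounded_linear (\<lambda>M :: real^3^3. axis m 1 \<times> (M $ i) + axis i 1 \<times> (M $ m))"
      by (rule linear_conv_bounded_linear[THEN iffD1])
    then show "poly_map (\<lambda>\<xi>. axis m 1 \<times> (q H \<xi> $ i) + axis i 1 \<times> (q H \<xi> $ m))"
      by (rule poly_Q_poly_map[OF poly_Q_component[OF q(1)[OF H]]])
    show "f i m H (\<Phi> H \<xi>) = axis m 1 \<times> (q H \<xi> $ i) + axis i 1 \<times> (q H \<xi> $ m)" if "\<xi> \<in> unit_cube" for \<xi>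
      by (simp only: f_def q(2)[OF H that])
  next
    fix S H H' x assume S: "S \<in> grid_faces T \<Phi>" and at: "H \<in> at_face T \<Phi> S" "H' \<in> at_face T \<Phi> S" and x: "x \<in> S"
    have "f i m H x \<bullet> n = sym_trace n (W H x) (axis i 1) (axis m 1)" for H n
    proof -
      have b: "bil (axis i 1) M v = M $ i \<bullet> v" for M v i
        by (simp add: bil_def inner_axis' matrix_vector_mul_component)
      have "(a \<times> w) \<bullet> n = w \<bullet> (n \<times> a)" for a w :: "real^3"
        by (simp add: cross3_simps inner_vec_def sum_3 algebra_simps)
      then show ?thesis by (simp add: f_def sym_trace_def b inner_add_left)
    qed
    then show "f i m H x \<bullet> face_normal D S = f i m H' x \<bullet> face_normal D S"
      using sym_trace_continuous[OF W q S at x] by simp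
  next
    fix d assume "\<And>H. H \<in> T \<Longrightarrow> continuous_on H (d H)"
      "\<And>\<phi>. \<phi> \<in> test_functions \<Omega> \<Longrightarrow> (\<integral>x. piecewise (\<lambda>H x. f i m H x \<bullet> grad \<phi> x) x \<partial>lebesgue_on \<Omega>) =
         - (\<integral>x. \<phi> x * piecewise d x \<partial>lebesgue_on \<Omega>)"
    then show ?thesis unfolding is_div_def by blast
  qed
  then obtain d where "\<And>i m. is_div i m (d i m)" by metis
  then have d: "\<And>i m H. H \<in> T \<Longrightarrow> continuous_on H (d i m H)"
    and div: "\<And>i m \<phi>. \<phi> \<in> test_functions \<Omega> \<Longrightarrow>
      (\<integral>x. piecewise (\<lambda>H x. f i m H x \<bullet> grad \<phi> x) x \<partial>lebesgue_on \<Omega>) = - (\<integral>x. \<phi> x * piecewise (d i m) x \<partial>lebesgue_on \<Omega>)"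
    unfolding is_div_def by blast+
  define G where "G = piecewise (\<lambda>H x. \<chi> i m. - (1/2) * d i m H x)"
  have cG: "continuous_on H (\<lambda>x. \<chi> i m. - (1/2) * d i m H x)" if "H \<in> T" for H
    by (intro continuous_on_vec_lambda continuous_intros d that)
  have GL: "G \<in> Lp_space p \<Omega>" unfolding G_def using cG p by (rule piecewise_Lp)
  have "mat_sym (Curl_distr \<Omega> U \<phi>) = (\<integral>x. \<phi> x *\<^sub>R G x \<partial>lebesgue_on \<Omega>)" if \<phi>: "\<phi> \<in> test_functions \<Omega>" for \<phi>
  proof -
    have C: "C_order 1 \<phi>" using \<phi> by (rule test_function_C1)
    have cg: "continuous_on S (grad \<phi>)" for S
      using grad_continuous[of 0 \<phi>] C by (auto intro: continuous_on_subset)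
    have "mat_sym (Curl_distr \<Omega> U \<phi>) $ i $ m = (\<integral>x. \<phi> x *\<^sub>R G x \<partial>lebesgue_on \<Omega>) $ i $ m" for i m
    proof -
      have CD: "Curl_distr \<Omega> U \<phi> $ i $ m =
          (\<integral>x. piecewise (\<lambda>H x. (axis m 1 \<times> (W H x $ i)) \<bullet> grad \<phi> x) x \<partial>lebesgue_on \<Omega>)" for i m
        by (rule Curl_distr_piecewise[OF Um UA _ \<phi>]) (rule cW)
      have ci: "integrable (lebesgue_on \<Omega>) (piecewise (\<lambda>H x. (axis m 1 \<times> (W H x $ i)) \<bullet> grad \<phi> x))" for i m
        by (intro piecewise_integral(1) continuous_intros cg continuous_on_cross bounded_linear.continuous_on[OF bounded_linear_vec_nth] cW)
      have "2 * mat_sym (Curl_distr \<Omega> U \<phi>) $ i $ m = Curl_distr \<Omega> U \<phi> $ i $ m + Curl_distr \<Omega> U \<phi> $ m $ i"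
        by (simp add: mat_sym_def transpose_def)
      also have "\<dots> = (\<integral>x. piecewise (\<lambda>H x. (axis m 1 \<times> (W H x $ i)) \<bullet> grad \<phi> x) x +
          piecewise (\<lambda>H x. (axis i 1 \<times> (W H x $ m)) \<bullet> grad \<phi> x) x \<partial>lebesgue_on \<Omega>)"
        unfolding CD by (rule Bochner_Integration.integral_add[OF ci ci, symmetric])
      also have "\<dots> = (\<integral>x. piecewise (\<lambda>H x. f i m H x \<bullet> grad \<phi> x) x \<partial>lebesgue_on \<Omega>)"
        by (simp add: piecewise_def f_def inner_add_left distrib_left sum.distrib)
      also have "\<dots> = - (\<integral>x. \<phi> x * piecewise (d i m) x \<partial>lebesgue_on \<Omega>)" by (rule div[OF \<phi>])
      finally have 1: "mat_sym (Curl_distr \<Omega> U \<phi>) $ i $ m = - (1/2) * (\<integral>x. \<phi> x * piecewise (d i m) x \<partial>lebesgue_on \<Omega>)" by simp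
      have bl: "bounded_linear (\<lambda>M :: real^3^3. M $ i $ m)"
        by (rule bounded_linear_entry)
      have "integrable (lebesgue_on \<Omega>) (\<lambda>x. \<phi> x *\<^sub>R G x)"
        unfolding G_def by (rule test_function_times_integrable[OF \<phi> piecewise_integral(1)[OF cG]])
      from integral_bounded_linear[OF bl this]
      have "(\<integral>x. \<phi> x *\<^sub>R G x \<partial>lebesgue_on \<Omega>) $ i $ m = (\<integral>x. \<phi> x * G x $ i $ m \<partial>lebesgue_on \<Omega>)" by simp
      also have "(\<lambda>x. \<phi> x * G x $ i $ m) = (\<lambda>x. - (1/2) * (\<phi> x * piecewise (d i m) x))"
        by (auto simp: G_def piecewise_def sum_component sum_distrib_left algebra_simps)
      finally show ?thesis unfolding 1 by simp
    qed
    then show ?thesis by (simp add: vec_eq_iff)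
  qed
  then show "U \<in> H_sym_Curl p \<Omega>"
    unfolding H_sym_Curl_def H_space_def using Up GL by blast
qed

end

section \<open>A discontinuous multiple of the identity\<close>

lemma bil_mat_1: "bil u (mat 1) v = u \<bullet> v" by (simp add: bil_def)

lemma bil_0: "bil u 0 v = 0" by (simp add: bil_def)

lemma triple_antisym: "(u :: real^3) \<bullet> (w \<times> v) + v \<bullet> (w \<times> u) = 0"
  by (simp add: cross3_simps inner_vec_def sum_3 algebra_simps)

lemma finite_cube_vertices: "finite {\<xi> :: real^3. \<forall>i. \<xi> $ i \<in> {0, 1}}"
proof -
  have "{\<xi> :: real^3. \<forall>i. \<xi> $ i \<in> {0, 1}} \<subseteq> (\<lambda>(a, b, c). vector [a, b, c]) ` Sigma {0, 1} (\<lambda>_. Sigma {0, 1} (\<lambda>_. {0, 1}))"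
  proof
    fix \<xi> :: "real^3" assume "\<xi> \<in> {\<xi>. \<forall>i. \<xi> $ i \<in> {0, 1}}"
    then have m: "\<xi> $ i \<in> {0, 1}" for i by blast
    have "\<xi> = (\<lambda>(a, b, c). vector [a, b, c]) (\<xi> $ 1, \<xi> $ 2, \<xi> $ 3)" by (simp add: vec_eq_iff forall_3)
    then show "\<xi> \<in> (\<lambda>(a, b, c). vector [a, b, c]) ` Sigma {0, 1} (\<lambda>_. Sigma {0, 1} (\<lambda>_. {0, 1}))"
      by (rule image_eqI) (intro SigmaI m)
  qed
  then show ?thesis by (rule finite_subset) simp
qed

lemma negligible_affine_hull_3:
  fixes a b c :: "real^3" shows "negligible (affine hull {a, b, c})"
proof -
  have "aff_dim {a, b, c} \<le> int (card {a, b, c}) - 1" by (rule aff_dim_le_card) simp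
  moreover have "card {a, b, c} \<le> 3"
    using card_insert_le_m1[of 3 "{b, c}" a] card_insert_le_m1[of 2 "{c}" b] by simp
  ultimately have "aff_dim {a, b, c} \<noteq> int DIM(real^3)" by simp
  then have "interior (affine hull {a, b, c}) = {}"
    using aff_dim_nonempty_interior[of "affine hull {a, b, c}"] by (auto simp: aff_dim_affine_hull)
  then show ?thesis
    using negligible_convex_interior[of "affine hull {a, b, c}"] affine_imp_convex affine_affine_hull by blast
qed

lemma chart_onto_inner:
  assumes "i \<noteq> l" "s \<in> {0<..<1}" "t \<in> {0<..<1}"
  shows "\<exists>s' \<in> {0<..<1}. \<exists>t' \<in> {0<..<1}. chart l c i a b s' t' = fpt l c s t"
proof -
  let ?fl = "\<lambda>a r. if a then 1 - r else r :: real"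
  have fl: "?fl a (?fl a r) = r" "r \<in> {0<..<1} \<Longrightarrow> ?fl a r \<in> {0<..<1}" for a r by auto
  consider "i = l + 1" | "i = l + 2" using assms(1) axis_fpt_3(4)[of i l] by blast
  then show ?thesis
  proof cases
    case 1
    have "chart l c i a b (?fl a s) (?fl b t) = fpt l c s t"
      unfolding 1 chart_fpt(1)[of l c a b] fl(1) ..
    then show ?thesis using fl(2) assms(2,3) by blast
  next
    case 2
    have "chart l c i a b (?fl a t) (?fl b s) = fpt l c s t"
      unfolding 2 chart_fpt(2)[of l c a b] fl(1) ..
    then show ?thesis using fl(2) assms(2,3) by blast
  qed
qed

lemma open_cube_nonempty: "open_cube \<noteq> {}"
proof -
  have "(\<chi> i. 1/2) \<in> open_cube" by (simp add: mem_box_cart)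
  then show ?thesis by blast
qed

context hex_fem
begin

text \<open>All pairs of vertices of one element. Apart from the edges they include diagonals, which does no
  harm in a finite exceptional set.\<close>
definition edge_segments :: "((real^3) * (real^3)) set" where
  "edge_segments = (\<Union>H\<in>T. (\<lambda>(\<xi>, \<eta>). (\<Phi> H \<xi>, \<Phi> H \<eta>)) `
     Sigma {\<xi>. \<forall>i. \<xi> $ i \<in> {0, 1}} (\<lambda>_. {\<xi>. \<forall>i. \<xi> $ i \<in> {0, 1}}))"

lemma finite_edge_segments: "finite edge_segments"
  unfolding edge_segments_def using finite_T finite_cube_vertices by auto

lemma edge_segmentsI:
  assumes "H \<in> T" "c \<in> {0, 1}" "s \<in> {0, 1}" "t \<in> {0, 1}" "s' \<in> {0, 1}" "t' \<in> {0, 1}"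
  shows "(\<Phi> H (fpt l c s t), \<Phi> H (fpt l c s' t')) \<in> edge_segments"
proof -
  have "fpt l c s t $ j \<in> {0, 1}" "fpt l c s' t' $ j \<in> {0, 1}" for j using assms by (auto simp: chart_def)
  then show ?thesis unfolding edge_segments_def using assms(1)
    by (intro UN_I[of H] image_eqI[of _ _ "(fpt l c s t, fpt l c s' t')"]) auto
qed

text \<open>Two elements meet at a point of the domain, by connectedness. Near it, a segment from one to the
  other can be chosen that avoids all edges, since the end points for which it meets a given edge
  lie in a plane. If no relative interior of a face met the domain, this segment would be covered
  by the disjoint open elements.\<close>
lemma inner_face_point:
  assumes conn: "connected \<Omega>" and card: "card T > 1"
  obtains H l c s t where "H \<in> T" "c \<in> {0, 1}" "s \<in> {0<..<1}" "t \<in> {0<..<1}" "\<Phi> H (fpt l c s t) \<in> \<Omega>"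
proof (rule ccontr)
  note found = that
  assume nt: "\<not> thesis"
  have none: "\<Phi> H (fpt l c s t) \<notin> \<Omega>" if "H \<in> T" "c \<in> {0, 1}" "s \<in> {0<..<1}" "t \<in> {0<..<1}" for H l c s t
    using found[OF that] nt by blast
  have cl: "closed H" if "H \<in> T" for H
    using compact_hex[OF hexD(1)[OF that]] hexD(3)[OF that] by (simp add: compact_imp_closed)
  have ne: "elem_open H \<noteq> {}" for H
    using open_cube_nonempty by simp
  obtain H0 where H0: "H0 \<in> T" using card by fastforce
  have "card (T - {H0}) > 0" using card H0 finite_T by simp
  then have "T - {H0} \<noteq> {}" by (metis card.empty less_irrefl)
  then obtain H1 where H1: "H1 \<in> T" "H1 \<noteq> H0" by blast
  have "H0 \<inter> \<Union>(T - {H0}) \<inter> \<Omega> \<noteq> {}"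
  proof
    assume "H0 \<inter> \<Union>(T - {H0}) \<inter> \<Omega> = {}"
    moreover have "closed (\<Union>(T - {H0}))" using finite_T cl by (intro closed_Union) auto
    moreover have "\<Omega> \<subseteq> H0 \<union> \<Union>(T - {H0})" using interior_subset[of "\<Union>T"] unfolding \<Omega>_eq by blast
    moreover have "H0 \<inter> \<Omega> \<noteq> {}" using ne[of H0] elem_open_subset[OF H0] elem_open_\<Omega>[OF H0] by blast
    moreover have "\<Union>(T - {H0}) \<inter> \<Omega> \<noteq> {}" using ne[of H1] elem_open_subset[OF H1(1)] elem_open_\<Omega>[OF H1(1)] H1 by blast
    ultimately show False using conn cl[OF H0] unfolding connected_closed by blast
  qed
  then obtain x H where x: "x \<in> H0" "x \<in> H" "x \<in> \<Omega>" and H: "H \<in> T" "H \<noteq> H0" by blast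
  obtain r where r: "r > 0" "ball x r \<subseteq> \<Omega>" using open_\<Omega> x(3) open_contains_ball by blast
  have near: "elem_open H \<inter> ball x r \<noteq> {}" if "H \<in> T" "x \<in> H" for H
  proof -
    have cc: "closure open_cube = unit_cube" unfolding unit_cube_cbox by (rule closure_box[OF open_cube_nonempty])
    have "\<Phi> H ` closure open_cube \<subseteq> closure (\<Phi> H ` open_cube)"
      by (rule continuous_image_closure_subset[OF poly_map_continuous[OF hexmap_poly[OF hexD(1)[OF that(1)]], of UNIV]]) simp
    then have "x \<in> closure (elem_open H)" using hexD(3)[OF that(1)] that(2) unfolding cc by blast
    then show ?thesis using r(1) by (meson centre_in_ball closure_iff_nhds_not_empty disjoint_iff open_ball order_refl)
  qed
  have avoid: "\<exists>y \<in> A. \<forall>e \<in> edge_segments. y \<notin> P e"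
    if A: "open A" "A \<noteq> {}" and P: "\<And>e. negligible (P e)" for A and P :: "(real^3) * (real^3) \<Rightarrow> (real^3) set"
  proof (rule ccontr)
    assume "\<not> ?thesis"
    then have "A \<subseteq> \<Union>(P ` edge_segments)" by blast
    moreover have "negligible (\<Union>(P ` edge_segments))"
      using finite_edge_segments P by (intro negligible_Union) auto
    ultimately show False using open_not_negligible[OF A] negligible_subset by blast
  qed
  have opn: "open (elem_open H \<inter> ball x r)" if "H \<in> T" for H
    using open_hex_interior[OF hexD(1)[OF that]] by (rule open_Int) (rule open_ball)
  obtain a where a: "a \<in> elem_open H0 \<inter> ball x r"
    "\<And>X Y. (X, Y) \<in> edge_segments \<Longrightarrow> a \<notin> affine hull {X, X, Y}"
    using avoid[OF opn[OF H0] near[OF H0 x(1)], of "\<lambda>e. affine hull {fst e, fst e, snd e}"] negligible_affine_hull_3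
    by fastforce
  obtain b where b: "b \<in> elem_open H \<inter> ball x r"
    "\<And>X Y. (X, Y) \<in> edge_segments \<Longrightarrow> b \<notin> affine hull {a, X, Y}"
    using avoid[OF opn[OF H(1)] near[OF H(1) x(2)], of "\<lambda>e. affine hull {a, fst e, snd e}"] negligible_affine_hull_3
    by fastforce
  have seg: "closed_segment a b \<subseteq> \<Omega>"
    using a(1) b(1) r(2) convex_ball[of x r] by (meson IntD2 closed_segment_subset order_trans)
  have no_edge: "z \<notin> closed_segment X Y" if z: "z \<in> closed_segment a b" and XY: "(X, Y) \<in> edge_segments" for z X Y
  proof
    assume "z \<in> closed_segment X Y"
    then have zXY: "z \<in> affine hull {X, Y}" by (metis closed_segment_subset_convex_hull convex_hull_subset_affine_hull hull_insert segment_convex_hull subsetD)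
    obtain u where u: "z = (1 - u) *\<^sub>R a + u *\<^sub>R b" using z by (auto simp: closed_segment_def)
    have "u \<noteq> 0" using u zXY a(2)[OF XY] by auto
    then have "b = (1 - 1/u) *\<^sub>R a + (1/u) *\<^sub>R z" unfolding u by (simp add: algebra_simps)
    moreover have "z \<in> affine hull {a, X, Y}" using zXY hull_mono[of "{X, Y}" "{a, X, Y}"] by blast
    moreover have "a \<in> affine hull {a, X, Y}" by (simp add: hull_inc)
    ultimately have "b \<in> affine hull {a, X, Y}"
      using mem_affine[OF affine_affine_hull, of a "{a, X, Y}" z "1 - 1/u" "1/u"] by simp
    then show False using b(2)[OF XY] by simp
  qed
  have cover: "closed_segment a b \<subseteq> (\<Union>H\<in>T. elem_open H)"
  proof
    fix z assume z: "z \<in> closed_segment a b"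
    then have "z \<in> \<Omega>" using seg by blast
    then obtain H' where H': "H' \<in> T" "z \<in> H'" unfolding \<Omega>_eq using interior_subset by blast
    then obtain \<xi> where \<xi>: "\<xi> \<in> unit_cube" "z = \<Phi> H' \<xi>" using hexD(3)[OF H'(1)] by blast
    show "z \<in> (\<Union>H\<in>T. elem_open H)"
    proof (cases "\<xi> \<in> open_cube")
      case True
      then show ?thesis using H' \<xi>(2) by blast
    next
      case False
      then obtain l where "\<not> (0 < \<xi> $ l \<and> \<xi> $ l < 1)" by (auto simp: mem_box_cart)
      moreover have "0 \<le> \<xi> $ l \<and> \<xi> $ l \<le> 1" using \<xi>(1) by blast
      ultimately have c: "\<xi> $ l \<in> {0, 1}" by auto
      have "\<xi> \<in> local_face l (\<xi> $ l)" using \<xi>(1) unfolding local_face_def by blast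
      then obtain s t where st: "\<xi> = fpt l (\<xi> $ l) s t" "s \<in> {0..1}" "t \<in> {0..1}" unfolding local_face_fpt[OF c] by blast
      let ?c = "\<xi> $ l"
      have z': "z = \<Phi> H' (fpt l ?c s t)" using st(1) \<xi>(2) by simp
      have "\<not> (s \<in> {0<..<1} \<and> t \<in> {0<..<1})" using none[OF H'(1) c, of s t l] \<open>z \<in> \<Omega>\<close> z' by metis
      then have "s \<in> {0, 1} \<or> t \<in> {0, 1}" using st(2,3) by auto
      then show ?thesis
      proof
        assume s: "s \<in> {0, 1}"
        have "z \<in> closed_segment (\<Phi> H' (fpt l ?c s 0)) (\<Phi> H' (fpt l ?c s 1))"
          unfolding closed_segment_def z' using chart_affine(1)[OF hexD(2)[OF H'(1)] axis_fpt_3(1), of l ?c False False s t] st(3) by auto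
        then show ?thesis using no_edge[OF z edge_segmentsI[OF H'(1) c s _ s]] by simp
      next
        assume t: "t \<in> {0, 1}"
        have "z \<in> closed_segment (\<Phi> H' (fpt l ?c 0 t)) (\<Phi> H' (fpt l ?c 1 t))"
          unfolding closed_segment_def z' using chart_affine(2)[OF hexD(2)[OF H'(1)] axis_fpt_3(1), of l ?c False False s t] st(2) by auto
        then show ?thesis using no_edge[OF z edge_segmentsI[OF H'(1) c _ t _ t]] by simp
      qed
    qed
  qed
  let ?A = "elem_open H0" and ?B = "\<Union>H\<in>T - {H0}. elem_open H"
  have o: "open ?A" "open ?B" using open_hex_interior[OF hexD(1)] H0 by (auto intro!: open_UN)
  have c: "closed_segment a b \<subseteq> ?A \<union> ?B" using cover by blast
  have d: "?A \<inter> ?B \<inter> closed_segment a b = {}"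
    using elem_open_disjoint[OF H0] elem_open_subset by blast
  have "?A \<inter> closed_segment a b \<noteq> {}" using a(1) ends_in_segment(1)[of a b] by blast
  moreover have "?B \<inter> closed_segment a b \<noteq> {}" using b(1) H ends_in_segment(2)[of b a] by blast
  ultimately show False using connectedD[OF connected_segment(1) o d c] by blast
qed

text \<open>On multiples of the identity all degrees of freedom vanish, either by orthogonality or by
  antisymmetry of the triple product. So such functions may jump freely from element to element.\<close>
lemma scalar_identity_dofs:
  defines "Z M \<equiv> M = mat 1 \<or> M = (0 :: real^3^3)"
  assumes W: "\<And>H x. Z (W H x)"
  shows "vertex_dofs_coincide T \<Phi> D W" "vertex_edge_dofs_coincide T \<Phi> D W"
    "edge_dofs_coincide k T \<Phi> D W" "face_dofs_coincide k T \<Phi> D W"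
proof -
  have b0: "bil u M v = 0" if "Z M" "u \<bullet> v = 0" for u M v
    using that by (auto simp: Z_def bil_mat_1 bil_0)
  have b2: "bil u M (n \<times> v) + bil v M (n \<times> u) = 0" if "Z M" for u v n M
    using that triple_antisym[of u n v] by (auto simp: Z_def bil_mat_1 bil_0)
  have co: "coincide A q" if "\<And>H. q H = 0" for A :: "(real^3) set set" and q using that by (simp add: coincide_def)
  have o: "n \<bullet> (n \<times> v) = 0" "v \<bullet> (n \<times> v) = 0" for n v :: "real^3" by (simp_all add: dot_cross_self)
  have e: "edge_n1 D E \<bullet> edge_tangent D E = 0" "edge_n2 D E \<bullet> edge_tangent D E = 0" if "E \<in> grid_edges T \<Phi>" for E
  proof -
    have sp: "span {edge_n1 D E, edge_n2 D E} = {x. orthogonal x (edge_tangent D E)}"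
      using edge_vecs that by (auto simp: edge_vectors_def)
    have "edge_n1 D E \<in> span {edge_n1 D E, edge_n2 D E}" "edge_n2 D E \<in> span {edge_n1 D E, edge_n2 D E}"
      by (auto intro: span_base)
    then show "edge_n1 D E \<bullet> edge_tangent D E = 0" "edge_n2 D E \<bullet> edge_tangent D E = 0"
      unfolding sp orthogonal_def by blast+
  qed
  show "vertex_dofs_coincide T \<Phi> D W"
    unfolding vertex_dofs_coincide_def Let_def by (intro ballI conjI co b2 W)
  show "vertex_edge_dofs_coincide T \<Phi> D W"
    unfolding vertex_edge_dofs_coincide_def by (intro ballI impI conjI co b0 W e)
  show "edge_dofs_coincide k T \<Phi> D W"
    unfolding edge_dofs_coincide_def Let_def by (intro ballI impI conjI co b2 b0 W e o)
  show "face_dofs_coincide k T \<Phi> D W"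
    unfolding face_dofs_coincide_def Let_def by (intro ballI impI conjI co b2 b0 W e o)
qed

text \<open>The bumps are bounded by one and tend to zero off a plane, which is a null set.\<close>
lemma bump_integral_tendsto_0:
  fixes h :: "real^3 \<Rightarrow> real"
  assumes h: "integrable (lebesgue_on \<Omega>) h" and n: "n \<noteq> 0"
  shows "(\<lambda>K. \<integral>x. bump a r n (real K) x * h x \<partial>lebesgue_on \<Omega>) \<longlonglongrightarrow> 0"
proof -
  have m: "bump a r n K \<in> borel_measurable (lebesgue_on \<Omega>)" for K
    by (rule borel_measurable_lebesgue_on_continuous[OF C_order_continuous[OF bump_C_order]])
  have "(\<lambda>K. \<integral>x. bump a r n (real K) x * h x \<partial>lebesgue_on \<Omega>) \<longlonglongrightarrow> (\<integral>x. 0 \<partial>lebesgue_on \<Omega>)"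
  proof (rule integral_dominated_convergence[where w = "\<lambda>x. \<bar>h x\<bar>"])
    have "negligible {x. n \<bullet> x = n \<bullet> a}" using n by (intro negligible_hyperplane) simp
    then have "AE x in lebesgue. x \<notin> {x. n \<bullet> x = n \<bullet> a}"
      by (intro AE_not_in) (simp add: negligible_iff_null_sets)
    then have "AE x in lebesgue_on \<Omega>. x \<notin> {x. n \<bullet> x = n \<bullet> a}"
      using \<Omega>_lmeasurable(2) by (subst AE_restrict_space_iff) auto
    then show "AE x in lebesgue_on \<Omega>. (\<lambda>K. bump a r n (real K) x * h x) \<longlonglongrightarrow> 0"
    proof (rule AE_mp, intro AE_I2 impI)
      fix x assume "x \<notin> {x. n \<bullet> x = n \<bullet> a}"
      then have "(x - a) \<bullet> n \<noteq> 0" by (simp add: inner_diff_left inner_commute[of n])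
      from tendsto_mult_left_zero[OF bump_tendsto[OF this]]
      show "(\<lambda>K. bump a r n (real K) x * h x) \<longlonglongrightarrow> 0" .
    qed
    show "AE x in lebesgue_on \<Omega>. norm (bump a r n (real K) x * h x) \<le> \<bar>h x\<bar>" for K
    proof (rule AE_I2)
      fix x
      have "bump a r n (real K) x * \<bar>h x\<bar> \<le> 1 * \<bar>h x\<bar>" by (rule mult_right_mono[OF bump_le_1]) simp
      then show "norm (bump a r n (real K) x * h x) \<le> \<bar>h x\<bar>" by (simp add: abs_mult bump_nonneg)
    qed
  qed (use m h in auto)
  then show ?thesis by simp
qed

text \<open>The function is the identity on one element and zero on all others. Its distributional \<open>Curl\<close>,
  tested with a bump at a point of a face, is the surface integral of the bump over the face times
  \<open>e\<^sub>i \<times> n\<close>, up to sign. This does not change with \<open>K\<close>, whereas the integral against an \<open>L\<^sup>p\<close>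
  function would tend to zero.\<close>
lemma exists_not_H_Curl:
  assumes conn: "connected \<Omega>" and card: "card T > 1" and p: "p \<ge> 1"
  shows "\<exists>U \<in> H_h_sym_Curl k \<Omega> T \<Phi> D. U \<notin> H_Curl p \<Omega>"
proof -
  obtain H l c s t where H: "H \<in> T" and c: "c \<in> {0, 1}" and st: "s \<in> {0<..<1}" "t \<in> {0<..<1}"
    and x: "\<Phi> H (fpt l c s t) \<in> \<Omega>"
    by (rule inner_face_point[OF conn card])
  define S where "S = \<Phi> H ` local_face l c"
  let ?n = "face_normal D S"
  have S: "S \<in> grid_faces T \<Phi>" unfolding grid_faces_def UN_iff hex_faces_iff S_def using H c by blast
  have atH: "H \<in> at_face T \<Phi> S" unfolding at_face_iff S_def using H c by blast
  define W :: "(real^3) set \<Rightarrow> real^3 \<Rightarrow> real^3^3" where "W H' x = (if H' = H then mat 1 else 0)" for H' x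
  define U where "U = piecewise W"
  have cW: "continuous_on H' (W H')" for H' by (simp add: W_def)
  have UL: "U \<in> Lp_space q \<Omega>" if "q \<ge> 1" for q unfolding U_def using cW that by (rule piecewise_Lp)
  have "AE x in lebesgue_on (H' \<inter> \<Omega>). U x = W H' x" if H': "H' \<in> T" for H'
  proof -
    have "compact H'" using compact_hex[OF hexD(1)[OF H']] hexD(3)[OF H'] by simp
    then have "H' \<in> sets lebesgue" by (auto intro!: sets_completionI_sets borel_closed compact_imp_closed)
    then have ms: "H' \<inter> \<Omega> \<in> sets lebesgue" using \<Omega>_lmeasurable(2) by (rule sets.Int)
    have "AE x in lebesgue. x \<notin> \<Phi> H' ` (unit_cube - open_cube)"
      using negligible_hex_boundary[OF hexD(1)[OF H']] by (intro AE_not_in) (simp add: negligible_iff_null_sets)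
    then have "AE x in lebesgue. x \<in> H' \<inter> \<Omega> \<longrightarrow> U x = W H' x"
    proof (rule AE_mp, intro AE_I2 impI)
      fix x assume "x \<notin> \<Phi> H' ` (unit_cube - open_cube)" "x \<in> H' \<inter> \<Omega>"
      then have "x \<in> elem_open H'" using hexD(3)[OF H'] by blast
      then show "U x = W H' x" unfolding U_def by (rule piecewise_on[OF H'])
    qed
    then show ?thesis using ms by (subst AE_restrict_space_iff) auto
  qed
  moreover have "W H' \<in> Pi_k k (\<Phi> H')" for H'
  proof -
    define M :: "real^3^3" where "M = (if H' = H then mat 1 else 0)"
    have "poly_Q k (\<lambda>\<xi>. M)"
      unfolding poly_Q_def
      by (intro exI[of _ "\<lambda>a b c. if c = 0 then if b = 0 then if a = 0 then M else 0 else 0 else 0"] allI)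
         (simp add: if_distrib[of "\<lambda>y. _ *\<^sub>R y"] sum.delta cong: if_cong)
    then show ?thesis unfolding Pi_k_def W_def M_def[symmetric] by blast
  qed
  moreover have Z: "W H' x = mat 1 \<or> W H' x = 0" for H' x by (simp add: W_def)
  have dofs: "vertex_dofs_coincide T \<Phi> D W" "vertex_edge_dofs_coincide T \<Phi> D W"
    "edge_dofs_coincide k T \<Phi> D W" "face_dofs_coincide k T \<Phi> D W"
    by (rule scalar_identity_dofs, rule Z)+
  have "U \<in> Lp_space 2 \<Omega>" by (rule UL) simp
  ultimately have Uh: "U \<in> H_h_sym_Curl k \<Omega> T \<Phi> D"
    unfolding H_h_sym_Curl_def by (intro CollectI conjI exI[of _ W] ballI dofs)
  have "U \<notin> H_Curl p \<Omega>"
  proof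
    assume "U \<in> H_Curl p \<Omega>"
    then obtain G where G: "G \<in> Lp_space p \<Omega>"
      and eq: "\<And>\<phi>. \<phi> \<in> test_functions \<Omega> \<Longrightarrow> Curl_distr \<Omega> U \<phi> = (\<integral>x. \<phi> x *\<^sub>R G x \<partial>lebesgue_on \<Omega>)"
      unfolding H_Curl_def H_space_def by blast
    have Gi: "integrable (lebesgue_on \<Omega>) G" by (rule Lp_space_integrable[OF \<Omega>_lmeasurable(1) G p])
    have n0: "?n \<noteq> 0" using face_normal_D(1)[OF S] by auto
    then obtain j where j: "?n $ j \<noteq> 0" by (auto simp: vec_eq_iff)
    \<comment> \<open>With this entry of \<open>Curl\<close> the normal is tested in the direction \<open>e\<^sub>m \<times> e\<^sub>i = e\<^sub>j\<close>.\<close>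
    define i m where "i = j + 2" and "m = j + 1"
    let ?v = "axis m 1 \<times> axis i 1 :: real^3"
    have v: "?v = axis j 1"
      by (cases j rule: three_cases) (simp_all add: i_def m_def three_num vec_eq_iff forall_3 cross3_def axis_def)
    show False
    proof (rule face_structure[OF S])
      fix Q w \<sigma> H0 l0 c0
      assume H0: "H0 \<in> T" and c0: "c0 \<in> {0, 1}" and S0: "S = \<Phi> H0 ` local_face l0 c0"
        and Q: "\<And>s t. Q s t = \<Phi> H0 (fpt l0 c0 s t)"
        and w: "continuous_on UNIV (\<lambda>x. w (fst x) (snd x) :: real)" "\<And>s t. s \<in> {0..1} \<Longrightarrow> t \<in> {0..1} \<Longrightarrow> w s t > 0"
        and \<sigma>: "\<And>H'. H' \<in> at_face T \<Phi> S \<Longrightarrow> \<sigma> H' \<noteq> (0::real)"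
        and "\<And>H'. H' \<in> T - at_face T \<Phi> S \<Longrightarrow> \<sigma> H' = 0"
        and flux: "\<And>H' g f \<phi>. H' \<in> T \<Longrightarrow> poly_map g \<Longrightarrow> (\<And>\<xi>. \<xi> \<in> unit_cube \<Longrightarrow> f (\<Phi> H' \<xi>) = g \<xi>) \<Longrightarrow> continuous_on UNIV \<phi> \<Longrightarrow>
           element_face_flux D (\<Phi> H') g \<phi> S =
             \<sigma> H' * integral square (\<lambda>(s, t). \<phi> (Q s t) * (f (Q s t) \<bullet> face_normal D S) * w s t)"
      obtain i' a b where i': "i' \<noteq> l" and match: "\<And>s t. \<Phi> H (chart l c i' a b s t) = \<Phi> H0 (fpt l0 c0 s t)"
        using face_matching[OF hexD(1,2)[OF H0] c0 hexD(1,2)[OF H] c face_normal_D[OF S] S0 S_def] by blast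
      obtain s0 t0 where st0': "s0 \<in> {0<..<1}" "t0 \<in> {0<..<1}" "chart l c i' a b s0 t0 = fpt l c s t"
        using chart_onto_inner[OF i' st] by blast
      then have st0: "s0 \<in> {0<..<1}" "t0 \<in> {0<..<1}" "Q s0 t0 = \<Phi> H (fpt l c s t)"
        unfolding Q match[symmetric] by simp_all
      let ?a = "Q s0 t0"
      obtain r where r: "r > 0" "cball ?a r \<subseteq> \<Omega>"
        and iso: "\<And>S'. S' \<in> grid_faces T \<Phi> \<Longrightarrow> S' \<noteq> S \<Longrightarrow> S' \<inter> cball ?a r = {}"
        using isolating_ball[OF H c S_def st x] unfolding st0(3) by blast
      let ?b = "\<lambda>K. bump ?a r ?n (real K)"
      have cQ: "continuous_on UNIV (\<lambda>x. Q (fst x) (snd x))"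
        unfolding Q by (intro poly_map_continuous[OF hexmap_poly[OF hexD(1)[OF H0]], THEN continuous_on_compose2[where t = UNIV]] continuous_intros) auto
      define I where "I = integral square (\<lambda>(s', t'). bump ?a r ?n 0 (Q s' t') * w s' t')"
      have I: "I \<noteq> 0" unfolding I_def by (rule bump_face_integral_pos[OF cQ w st0(1,2) r(1)])
      have "Curl_distr \<Omega> U (?b K) $ i $ m = \<sigma> H * (?n $ j) * I" for K
      proof -
        have test: "?b K \<in> test_functions \<Omega>" by (rule bump_test) (use r in auto)
        have C: "C_order 1 (?b K)" using test by (rule test_function_C1)
        have cphi: "continuous_on UNIV (?b K)" using C by (rule C_order_continuous)
        have cg: "continuous_on A (grad (?b K))" for A
          using grad_continuous[of 0 "?b K"] C by (auto intro: continuous_on_subset)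
        have zero: "?b K x = 0" if "S' \<in> grid_faces T \<Phi>" "S' \<noteq> S" "x \<in> S'" for S' x
          using iso[OF that(1,2)] that(3) r(1) by (intro bump_outside) (auto simp: disjoint_iff)
        have "Curl_distr \<Omega> U (?b K) $ i $ m =
           (\<integral>x. piecewise (\<lambda>H x. (axis m 1 \<times> (W H x $ i)) \<bullet> grad (?b K) x) x \<partial>lebesgue_on \<Omega>)"
          using UL[of 1] cW test by (intro Curl_distr_piecewise) (auto simp: U_def Lp_space_def)
        also have "\<dots> = (\<Sum>H'\<in>T. integral H' (\<lambda>x. (axis m 1 \<times> (W H' x $ i)) \<bullet> grad (?b K) x))"
          by (intro piecewise_integral(2) continuous_intros cg) (simp add: W_def)
        also have "\<dots> = (\<Sum>H'\<in>{H}. integral H' (\<lambda>x. (axis m 1 \<times> (W H' x $ i)) \<bullet> grad (?b K) x))"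
          using H finite_T by (intro sum.mono_neutral_right) (auto simp: W_def)
        also have "\<dots> = integral H (\<lambda>x. ?v \<bullet> grad (?b K) x)"
        proof -
          have "(mat 1 :: real^3^3) $ i = axis i 1" by (simp add: vec_eq_iff mat_def axis_def)
          then show ?thesis by (simp add: W_def)
        qed
        also have "\<dots> = orient (\<Phi> H) * flux (\<Phi> H) (\<lambda>\<xi>. ?v) (?b K)"
          using element_integration_by_parts(1)[OF hexD(1)[OF H] poly_map_const C, of "\<lambda>x. ?v" ?v "\<lambda>x. 0"]
            hexD(3)[OF H] fdiv_const[OF hexmap_poly[OF hexD(1)[OF H]]] by simp
        also have "\<dots> = element_face_flux D (\<Phi> H) (\<lambda>\<xi>. ?v) (?b K) S"
          by (rule flux_isolated[OF H S zero])
        also have "\<dots> = \<sigma> H * integral square (\<lambda>(s, t). ?b K (Q s t) * (?v \<bullet> ?n) * w s t)"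
          by (rule flux[OF H poly_map_const _ cphi]) (rule refl)
        also have "integral square (\<lambda>(s, t). ?b K (Q s t) * (?v \<bullet> ?n) * w s t) =
            integral square (\<lambda>x. (?n $ j) * (\<lambda>(s', t'). bump ?a r ?n 0 (Q s' t') * w s' t') x)"
        proof (rule Henstock_Kurzweil_Integration.integral_cong)
          fix y assume "y \<in> square"
          then obtain s' t' where y: "y = (s', t')" and st': "s' \<in> {0..1}" "t' \<in> {0..1}" by (cases y) (auto simp: cbox_Pair_eq)
          have inS: "Q s' t' \<in> S" if "s' \<in> {0..1}" "t' \<in> {0..1}" for s' t'
            unfolding Q S0 by (rule imageI) (rule chart_in_face[OF axis_fpt_3(1) c0 that])
          have "Q s' t' \<in> S" by (rule inS[OF st'])
          moreover have "?a \<in> S" by (rule inS) (use st0(1,2) in simp_all)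
          ultimately have "?n \<bullet> (Q s' t' - ?a) = 0" using face_normal_D(2)[OF S] unfolding orthogonal_to_set_def by blast
          then have "?b K (Q s' t') = bump ?a r ?n 0 (Q s' t')" by (intro bump_plane) (simp add: inner_commute)
          then show "(case y of (s, t) \<Rightarrow> ?b K (Q s t) * (?v \<bullet> ?n) * w s t) =
             (?n $ j) * (case y of (s', t') \<Rightarrow> bump ?a r ?n 0 (Q s' t') * w s' t')"
            by (simp add: y v inner_axis')
        qed
        also have "\<dots> = (?n $ j) * I" unfolding I_def by simp
        finally show ?thesis by simp
      qed
      moreover have "Curl_distr \<Omega> U (?b K) $ i $ m = (\<integral>x. ?b K x * (G x $ i $ m) \<partial>lebesgue_on \<Omega>)" for K
      proof -
        have test: "?b K \<in> test_functions \<Omega>" by (rule bump_test) (use r in auto)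
        have bl: "bounded_linear (\<lambda>M :: real^3^3. M $ i $ m)"
          by (rule bounded_linear_entry)
        show ?thesis
          using integral_bounded_linear[OF bl test_function_times_integrable[OF test Gi]] by (simp add: eq[OF test])
      qed
      moreover have "(\<lambda>K. \<integral>x. ?b K x * (G x $ i $ m) \<partial>lebesgue_on \<Omega>) \<longlonglongrightarrow> 0"
      proof (rule bump_integral_tendsto_0[OF _ n0])
        have bl: "bounded_linear (\<lambda>M :: real^3^3. M $ i $ m)"
          by (rule bounded_linear_entry)
        show "integrable (lebesgue_on \<Omega>) (\<lambda>x. G x $ i $ m)" by (rule integrable_bounded_linear[OF bl Gi])
      qed
      ultimately have "(\<lambda>K::nat. \<sigma> H * (?n $ j) * I) \<longlonglongrightarrow> 0" by simp
      then have "\<sigma> H * (?n $ j) * I = 0" by (simp add: LIMSEQ_const_iff)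
      then show False using \<sigma>[OF atH] j I by simp
    qed
  qed
  with Uh show ?thesis by blast
qed

end

theorem theorem19:
  fixes \<Omega> :: "(real^3) set" and p :: real and k :: nat
    and T :: "(real^3) set set" and \<Phi> :: "(real^3) set \<Rightarrow> real^3 \<Rightarrow> real^3"
    and D :: grid_vectors
  assumes "open \<Omega>" and "connected \<Omega>" and "\<Omega> \<noteq> {}" and "bounded \<Omega>"
    and "p \<ge> 1" and "k \<ge> 1"
    and "conforming_grid \<Omega> T \<Phi>"
    and "vertex_vectors T \<Phi> D" and "face_vectors T \<Phi> D" and "edge_vectors T \<Phi> D"
  shows "H_h_sym_Curl k \<Omega> T \<Phi> D \<subseteq> H_sym_Curl p \<Omega> \<and>
         H_sym_Curl p \<Omega> \<subseteq> H_dev_sym_Curl p \<Omega> \<and>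
         (card T > 1 \<longrightarrow> (\<exists>U \<in> H_h_sym_Curl k \<Omega> T \<Phi> D. U \<notin> H_Curl p \<Omega>))"
proof -
  interpret hex_fem \<Omega> T \<Phi> D k
    using assms by unfold_locales
  have "H_sym_Curl p \<Omega> \<subseteq> H_dev_sym_Curl p \<Omega>"
    unfolding H_sym_Curl_def H_dev_sym_Curl_def
    by (rule H_space_bounded_linear_mono[OF bounded_linear_mat_dev \<Omega>_lmeasurable(1) assms(5)])
  then show ?thesis
    using H_h_sym_Curl_subset[OF assms(5)] exists_not_H_Curl[OF assms(2) _ assms(5)] by blast
qed

end
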